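(* Let $\mu\in\{0,1\}$. Let $S$ be a finite generating subset of an abelian group $G$ such that $0\in S$ and $3\le |S|\le \frac{|G|+5\mu-4}{2}$. Assume moreover that $\kappa_{3-\mu}(S)\le |S|-\mu$, and that $\kappa_4(S)\le |S|$ if $|S|=3=\mu+3$ (i.e. if $|S|=3$ and $\mu=0$). If $S$ is non-degenerate, then $S$ is an $(r,\mu-1)$-progression for some $r\in G$.
   Context: Let $S$ be a finite generating subset of $G$ with $0\in S$. For $X\subset G$ put $\partial_S(X)=(X+S)\setminus X$ and $X^S=G\setminus (X+S)$. For $|G|\ge 2k-1$, $\kappa_k(S)=\min\{|\partial_S(X)| : \infty>|X|\ge k \text{ and } |X^S|\ge k\}$, where $\min\emptyset=|G|-2k+1$. A $k$-fragment of $S$ is a finite $X\subset G$ with $|X|\ge k$, $|X^S|\ge k$ and $|\partial_S(X)|=\kappa_k(S)$. $S$ is degenerate if some subgroup of $G$ is a $2$-fragment of $S$, and non-degenerate otherwise. A set is an $(r,-j)$-progression if it can be obtained from an arithmetic progression with difference $r$ by deleting $j$ elements (so for $\mu=1$ an $(r,\mu-1)$-progression is an arithmetic progression with difference $r$, and for $\mu=0$ it is obtained from one by deleting one element). A set of cardinality $1$ is considered a progression with every difference. *)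

theory Defs
  imports Complex_Main "HOL-Algebra.Generated_Groups"
begin

text \<open>
  Abelian groups are rendered by the locale \<^locale>\<open>comm_group\<close> and hence written
  multiplicatively: the sumset \<open>X + S\<close> is \<open>X <#>\<^bsub>G\<^esub> S\<close>, the element \<open>0\<close> is \<open>\<one>\<^bsub>G\<^esub>\<close>, and
  \<open>a + i r\<close> is \<open>a \<otimes>\<^bsub>G\<^esub> r [^]\<^bsub>G\<^esub> i\<close>.  The group may be infinite.
\<close>

definition boundary :: "('a, 'b) monoid_scheme \<Rightarrow> 'a set \<Rightarrow> 'a set \<Rightarrow> 'a set" where
  "boundary G S X = (X <#>\<^bsub>G\<^esub> S) - X"

definition exterior :: "('a, 'b) monoid_scheme \<Rightarrow> 'a set \<Rightarrow> 'a set \<Rightarrow> 'a set" where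
  "exterior G S X = carrier G - (X <#>\<^bsub>G\<^esub> S)"

text \<open>The exterior of a finite set is infinite when \<open>G\<close> is infinite, where \<^const>\<open>card\<close> is \<open>0\<close>.\<close>

definition k_separating :: "('a, 'b) monoid_scheme \<Rightarrow> nat \<Rightarrow> 'a set \<Rightarrow> 'a set \<Rightarrow> bool" where
  "k_separating G k S X \<longleftrightarrow>
     X \<subseteq> carrier G \<and> finite X \<and> k \<le> card X \<and>
     (infinite (exterior G S X) \<or> k \<le> card (exterior G S X))"

text \<open>
  The infimum of a nonempty set of naturals is its minimum.  The first branch is only
  reached for finite \<open>G\<close> (if \<open>S\<close> is finite), and its value is \<open>|G| - 2k + 1\<close>, without
  truncation as long as \<open>|G| \<ge> 2k - 1\<close>, the range in which \<open>\<kappa>\<^sub>k\<close> is meaningful.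
\<close>

definition kappa :: "('a, 'b) monoid_scheme \<Rightarrow> nat \<Rightarrow> 'a set \<Rightarrow> nat" where
  "kappa G k S =
     (if {X. k_separating G k S X} = {} then order G + 1 - 2 * k
      else Inf {card (boundary G S X) | X. k_separating G k S X})"

definition fragment :: "('a, 'b) monoid_scheme \<Rightarrow> nat \<Rightarrow> 'a set \<Rightarrow> 'a set \<Rightarrow> bool" where
  "fragment G k S X \<longleftrightarrow> k_separating G k S X \<and> card (boundary G S X) = kappa G k S"

definition degenerate :: "('a, 'b) monoid_scheme \<Rightarrow> 'a set \<Rightarrow> bool" where
  "degenerate G S \<longleftrightarrow> (\<exists>H. subgroup H G \<and> fragment G 2 S H)"

text \<open>
  Repetitions among the terms are harmless: they only occur when the progression is a
  whole coset of the subgroup generated by \<open>r\<close>, which is also a progression without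
  repetitions.  Taking \<open>m = 1\<close>, a singleton is a progression with every difference.
\<close>

definition arith_progression :: "('a, 'b) monoid_scheme \<Rightarrow> 'a \<Rightarrow> 'a set \<Rightarrow> bool" where
  "arith_progression G r P \<longleftrightarrow>
     (\<exists>a \<in> carrier G. \<exists>m::nat. P = (\<lambda>i. a \<otimes>\<^bsub>G\<^esub> r [^]\<^bsub>G\<^esub> i) ` {..<m})"

text \<open>The integer argument is \<open>-j\<close>, where \<open>j\<close> is the number of deleted elements.\<close>

definition rj_progression :: "('a, 'b) monoid_scheme \<Rightarrow> 'a \<Rightarrow> int \<Rightarrow> 'a set \<Rightarrow> bool" where
  "rj_progression G r l A \<longleftrightarrow>
     (\<exists>P D. arith_progression G r P \<and> D \<subseteq> P \<and> - int (card D) = l \<and> A = P - D)"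

end

theory Submission
  imports Defs "HOL-Algebra.Multiplicative_Group"
begin

text \<open>
  The isoperimetric method: by submodularity of \<open>|X + S|\<close>, a \<open>k\<close>-atom (a \<open>k\<close>-fragment of minimal size)
  meets each of its proper translates in fewer than \<open>k\<close> elements, unless it is periodic, and
  periodicity is incompatible with non-degeneracy for \<open>k \<le> 3\<close>.

  Let \<open>A\<close> be a \<open>2\<close>-atom of \<open>S\<close>. If \<open>\<kappa>\<^sub>2(S) < |S|\<close> or \<open>|A| \<ge> 3\<close>, then \<open>A\<close> generates \<open>G\<close>, as otherwise the
  subgroup it generates would be a \<open>2\<close>-fragment. So \<open>S\<close> is in turn a separating set of \<open>A\<close> with small boundary, and comparing \<open>A\<close> with
  its own \<open>2\<close>-atoms gives \<open>|A| = 2\<close> if \<open>\<kappa>\<^sub>2(S) < |S|\<close>, in which case \<open>S\<close> is a progression, and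
  \<open>|A| \<le> 3\<close> if \<open>\<kappa>\<^sub>2(S) = |S|\<close>.

  If \<open>\<kappa>\<^sub>2(S) = \<kappa>\<^sub>3(S) = |S|\<close> and \<open>{0, r}\<close> is a \<open>2\<close>-atom, let \<open>A\<close> be a \<open>3\<close>-atom. Suppose \<open>|A| \<ge> 4\<close>; then every element
  of \<open>W = A + S\<close> has two representations, so that \<open>W \<setminus> (W + r)\<close> lies in \<open>(A + f) \<inter> (A + f')\<close>, where
  \<open>S \<setminus> (S + r) = {f, f'}\<close>. This forces \<open>|A| = 4\<close> and \<open>A = {0, r, 2r, z}\<close> or \<open>A = {0, r, z, z + r}\<close>
  up to translation, and both are impossible. Hence there is a three-element \<open>A\<close> with \<open>|A + S| = |S| + 3\<close>.
  Exchanging the roles of \<open>A\<close> and \<open>S\<close>, the \<open>4\<close>-atoms of \<open>A\<close> show that \<open>A\<close> is a translate of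
  \<open>{0, r, 2r}\<close> or \<open>{0, r, 3r}\<close>, from which the shape of \<open>S\<close> is read off.
\<close>

subsection \<open>Translates, products and separating sets\<close>

text \<open>Notation below is multiplicative, as in the code: XY for \<open>X <#> Y\<close>, gX for
  \<open>g <# X\<close>, a/b for a quotient. Why 4: every three-element T satisfies |TT| <= 6 = |T|
  + 3, so once |G| >= 9 a bound by 3 on \<open>kappa\<close> at level 3 says nothing about T. Level
  4 is the first informative one. This explains the extra hypothesis for |S| = 3 and the 4-atoms in
  the study of a three-element \<open>A\<close>. There the main obstacle is to show that translates
  of T are the only three-element sets Z with |ZT| <= 6. The argument needs T to have no two
  elements whose quotient has order 2 or 3; a subgroup of order 2 or 3 would otherwise come too
  close to being a 2-fragment of S, which non-degeneracy forbids. Exchanging roles is possible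
  because AS = SA has one complement: what A leaves outside under S is what S leaves outside under
  A. Finiteness enters in two ways. In a finite group duality bounds exteriors from below, in an
  infinite one they are infinite. And if no separating set exists, \<open>kappa\<close> is a default
  value; the size hypotheses then leave only |G| = 5 (\<mu> = 1) and |G| = 10 (\<mu> = 0), both with
  |S| = 3, which are settled by direct counting.\<close>

lemma mem_set_mult: "x \<in> A <#>\<^bsub>G\<^esub> B \<longleftrightarrow> (\<exists>a\<in>A. \<exists>b\<in>B. x = a \<otimes>\<^bsub>G\<^esub> b)"
  by (auto simp: set_mult_def)

lemma mem_l_coset: "x \<in> g <#\<^bsub>G\<^esub> A \<longleftrightarrow> (\<exists>a\<in>A. x = g \<otimes>\<^bsub>G\<^esub> a)"
  by (auto simp: l_coset_def)

lemma set_multI: "a \<in> A \<Longrightarrow> b \<in> B \<Longrightarrow> a \<otimes>\<^bsub>G\<^esub> b \<in> A <#>\<^bsub>G\<^esub> B"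
  by (auto simp: set_mult_def)

lemma l_cosetI: "a \<in> A \<Longrightarrow> g \<otimes>\<^bsub>G\<^esub> a \<in> g <#\<^bsub>G\<^esub> A"
  by (auto simp: l_coset_def)

lemma finite_set_mult [simp]: "finite A \<Longrightarrow> finite B \<Longrightarrow> finite (A <#>\<^bsub>G\<^esub> B)"
  by (simp add: set_mult_def)

lemma finite_l_coset [simp]: "finite A \<Longrightarrow> finite (g <#\<^bsub>G\<^esub> A)"
  by (simp add: l_coset_def)

lemma set_mult_empty [simp]: "{} <#>\<^bsub>G\<^esub> B = {}" "A <#>\<^bsub>G\<^esub> {} = {}"
  by (auto simp: set_mult_def)

lemma set_mult_Un_left: "(A \<union> B) <#>\<^bsub>G\<^esub> C = (A <#>\<^bsub>G\<^esub> C) \<union> (B <#>\<^bsub>G\<^esub> C)"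
  by (auto simp: set_mult_def)

lemma set_mult_insert_left: "insert a A <#>\<^bsub>G\<^esub> C = (a <#\<^bsub>G\<^esub> C) \<union> (A <#>\<^bsub>G\<^esub> C)"
  by (auto simp: set_mult_def l_coset_def)

lemma l_coset_Un: "g <#\<^bsub>G\<^esub> (A \<union> B) = (g <#\<^bsub>G\<^esub> A) \<union> (g <#\<^bsub>G\<^esub> B)"
  by (auto simp: l_coset_def)

lemma l_coset_mono: "A \<subseteq> B \<Longrightarrow> g <#\<^bsub>G\<^esub> A \<subseteq> g <#\<^bsub>G\<^esub> B"
  by (auto simp: l_coset_def)

lemma l_coset_empty [simp]: "g <#\<^bsub>G\<^esub> {} = {}"
  by (auto simp: l_coset_def)

lemma l_coset_insert: "g <#\<^bsub>G\<^esub> insert a A = insert (g \<otimes>\<^bsub>G\<^esub> a) (g <#\<^bsub>G\<^esub> A)"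
  by (auto simp: l_coset_def)

lemma l_coset_eq_empty [simp]: "g <#\<^bsub>G\<^esub> A = {} \<longleftrightarrow> A = {}"
  by (auto simp: l_coset_def)

text \<open>Isolates the last disjunct of \<open>k_separating\<close>, so that monotonicity in the
  set covers finite and infinite groups at once.\<close>

definition large :: "nat \<Rightarrow> 'a set \<Rightarrow> bool" where
  "large k Z \<longleftrightarrow> infinite Z \<or> k \<le> card Z"

lemma large_mono: "large k Z \<Longrightarrow> Z \<subseteq> Z' \<Longrightarrow> large k Z'"
  unfolding large_def by (meson card_mono infinite_super le_trans)

lemma large_le: "large k Z \<Longrightarrow> j \<le> k \<Longrightarrow> large j Z"
  unfolding large_def by auto

lemma large_1 [simp]: "large (Suc 0) Z \<longleftrightarrow> Z \<noteq> {}"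
  unfolding large_def by (auto simp: Suc_le_eq card_gt_0_iff)

lemma k_separating_iff: "k_separating G k S X \<longleftrightarrow>
    X \<subseteq> carrier G \<and> finite X \<and> k \<le> card X \<and> large k (exterior G S X)"
  by (simp add: k_separating_def large_def)

lemma k_separating_le: "k_separating G k S X \<Longrightarrow> j \<le> k \<Longrightarrow> k_separating G j S X"
  using large_le by (auto simp: k_separating_iff)

lemma exterior_antimono: "X \<subseteq> Y \<Longrightarrow> exterior G S Y \<subseteq> exterior G S X"
  by (auto simp: exterior_def set_mult_def)

context comm_group
begin

lemma l_coset_closed [simp]: "g \<in> carrier G \<Longrightarrow> A \<subseteq> carrier G \<Longrightarrow> g <# A \<subseteq> carrier G"
  by (auto simp: l_coset_def)

lemma set_mult_subset [simp]: "A \<subseteq> carrier G \<Longrightarrow> B \<subseteq> carrier G \<Longrightarrow> A <#> B \<subseteq> carrier G"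
  by (auto simp: set_mult_def)

lemma set_mult_commute: "A \<subseteq> carrier G \<Longrightarrow> B \<subseteq> carrier G \<Longrightarrow> A <#> B = B <#> A"
  unfolding set_mult_def by (force simp: m_comm)

lemma card_l_coset [simp]: "g \<in> carrier G \<Longrightarrow> A \<subseteq> carrier G \<Longrightarrow> card (g <# A) = card A"
  unfolding l_coset_def UNION_singleton_eq_range
  by (rule card_image) (rule inj_on_subset[OF inj_on_cmult])

lemma finite_l_coset_iff [simp]:
  "g \<in> carrier G \<Longrightarrow> A \<subseteq> carrier G \<Longrightarrow> finite (g <# A) \<longleftrightarrow> finite A"
  unfolding l_coset_def UNION_singleton_eq_range
  by (rule finite_image_iff) (rule inj_on_subset[OF inj_on_cmult])

lemma l_coset_one [simp]: "A \<subseteq> carrier G \<Longrightarrow> \<one> <# A = A"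
  by (force simp: l_coset_def)

lemma l_coset_l_coset: "g \<in> carrier G \<Longrightarrow> h \<in> carrier G \<Longrightarrow> A \<subseteq> carrier G \<Longrightarrow>
    g <# (h <# A) = (g \<otimes> h) <# A"
  by (force simp: l_coset_def m_assoc)

lemma l_coset_commute: "g \<in> carrier G \<Longrightarrow> h \<in> carrier G \<Longrightarrow> A \<subseteq> carrier G \<Longrightarrow>
    g <# (h <# A) = h <# (g <# A)"
  by (simp add: l_coset_l_coset m_comm)

lemma l_coset_inv_cancel [simp]:
  assumes "g \<in> carrier G" "A \<subseteq> carrier G"
  shows "g <# (inv g <# A) = A" "inv g <# (g <# A) = A"
  using assms by (simp_all add: l_coset_l_coset)

lemma set_mult_l_coset: "g \<in> carrier G \<Longrightarrow> A \<subseteq> carrier G \<Longrightarrow> B \<subseteq> carrier G \<Longrightarrow>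
    (g <# A) <#> B = g <# (A <#> B)"
  by (auto simp: l_coset_def set_mult_def m_assoc subset_eq)

lemma l_coset_mem_iff: "g \<in> carrier G \<Longrightarrow> A \<subseteq> carrier G \<Longrightarrow> x \<in> carrier G \<Longrightarrow>
    g \<otimes> x \<in> g <# A \<longleftrightarrow> x \<in> A"
  unfolding mem_l_coset by (metis Units_eq Units_l_cancel subsetD)

lemma l_coset_Int: "g \<in> carrier G \<Longrightarrow> A \<subseteq> carrier G \<Longrightarrow> B \<subseteq> carrier G \<Longrightarrow>
    g <# (A \<inter> B) = (g <# A) \<inter> (g <# B)"
  unfolding l_coset_def UNION_singleton_eq_range
  by (rule inj_on_image_Int[OF inj_on_cmult])

lemma l_coset_Diff: "g \<in> carrier G \<Longrightarrow> A \<subseteq> carrier G \<Longrightarrow> B \<subseteq> carrier G \<Longrightarrow>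
    g <# (A - B) = (g <# A) - (g <# B)"
  unfolding l_coset_def UNION_singleton_eq_range
  by (rule inj_on_image_set_diff[OF inj_on_cmult]) auto

lemma l_coset_carrier [simp]: "g \<in> carrier G \<Longrightarrow> g <# carrier G = carrier G"
  using coset_join3 subgroup_self by blast

lemma l_coset_subset_eq: "g \<in> carrier G \<Longrightarrow> A \<subseteq> carrier G \<Longrightarrow> finite A \<Longrightarrow>
    g <# A \<subseteq> A \<Longrightarrow> g <# A = A"
  by (rule card_subset_eq) auto

lemma subset_l_coset_eq: "g \<in> carrier G \<Longrightarrow> A \<subseteq> carrier G \<Longrightarrow> finite A \<Longrightarrow>
    A \<subseteq> g <# A \<Longrightarrow> g <# A = A"
  by (metis card_l_coset card_subset_eq finite_l_coset)

lemma subset_set_mult: "\<one> \<in> B \<Longrightarrow> A \<subseteq> carrier G \<Longrightarrow> A \<subseteq> A <#> B"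
  unfolding set_mult_def by force

lemma subset_set_mult_left: "\<one> \<in> B \<Longrightarrow> A \<subseteq> carrier G \<Longrightarrow> A \<subseteq> B <#> A"
  unfolding set_mult_def by force

lemma l_coset_subset_set_mult: "b \<in> B \<Longrightarrow> b <# A \<subseteq> B <#> A"
  by (auto simp: l_coset_def set_mult_def)

lemma card_set_mult_ge:
  assumes "A \<subseteq> carrier G" "B \<subseteq> carrier G" "finite A" "finite B" "B \<noteq> {}"
  shows "card A \<le> card (A <#> B)"
proof -
  obtain b where b: "b \<in> B" using assms by blast
  have "card A = card (b <# A)" using b assms by (auto simp: subset_eq)
  also have "\<dots> \<le> card (B <#> A)"
    using l_coset_subset_set_mult[OF b] assms by (intro card_mono) auto
  finally show ?thesis using set_mult_commute assms by simp
qed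

text \<open>Products distribute exactly over unions, while the product of an intersection is only
  contained in the intersection of the products; the rest is inclusion-exclusion.\<close>

lemma submodular:
  assumes "finite X" "finite Y" "finite S"
  shows "card ((X \<inter> Y) <#> S) + card ((X \<union> Y) <#> S) \<le> card (X <#> S) + card (Y <#> S)"
proof -
  have "card ((X <#> S) \<inter> (Y <#> S)) + card ((X <#> S) \<union> (Y <#> S)) = card (X <#> S) + card (Y <#> S)"
    using assms card_Un_Int[of "X <#> S" "Y <#> S"] by simp
  moreover have "card ((X \<inter> Y) <#> S) \<le> card ((X <#> S) \<inter> (Y <#> S))"
    using assms by (intro card_mono) (auto simp: set_mult_def)
  ultimately show ?thesis by (simp add: set_mult_Un_left)
qed

text \<open>As the neutral element lies in S, X is contained in XS. This lets \<open>kappa\<close>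
  be handled through |XS| alone, without truncated subtraction.\<close>

lemma card_boundary:
  assumes "\<one> \<in> S" "S \<subseteq> carrier G" "finite S" "X \<subseteq> carrier G" "finite X"
  shows "card (X <#> S) = card X + card (boundary G S X)"
proof -
  have "X \<subseteq> X <#> S" using assms subset_set_mult by blast
  then show ?thesis unfolding boundary_def
    using assms by (simp add: card_Diff_subset card_mono)
qed

lemma card_exterior:
  assumes "finite (carrier G)" "S \<subseteq> carrier G" "X \<subseteq> carrier G"
  shows "card (exterior G S X) + card (X <#> S) = card (carrier G)"
  unfolding exterior_def using assms
  by (metis card_Diff_subset card_mono finite_subset le_add_diff_inverse2 set_mult_subset)

lemma infinite_exterior:
  assumes "infinite (carrier G)" "finite S" "finite X"
  shows "infinite (exterior G S X)"
  unfolding exterior_def using assms by simp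

lemma large_exteriorI:
  assumes "finite S" "finite X" "S \<subseteq> carrier G" "X \<subseteq> carrier G"
    and "finite (carrier G) \<Longrightarrow> k + card (X <#> S) \<le> card (carrier G)"
  shows "large k (exterior G S X)"
  using assms card_exterior[of S X] infinite_exterior[of S X] unfolding large_def by fastforce

lemma large_exteriorD:
  assumes "large k (exterior G S X)" "finite (carrier G)" "S \<subseteq> carrier G" "X \<subseteq> carrier G"
  shows "k + card (X <#> S) \<le> card (carrier G)"
proof -
  have "finite (exterior G S X)" using assms(2) by (simp add: exterior_def)
  with assms(1) have "k \<le> card (exterior G S X)" by (simp add: large_def)
  then show ?thesis using card_exterior[of S X] assms by linarith
qed

lemma exterior_l_coset:
  assumes "g \<in> carrier G" "X \<subseteq> carrier G" "S \<subseteq> carrier G"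
  shows "exterior G S (g <# X) = g <# exterior G S X"
  unfolding exterior_def using assms by (simp add: set_mult_l_coset l_coset_Diff)

lemma k_separating_l_coset:
  assumes "g \<in> carrier G" "S \<subseteq> carrier G" "k_separating G k S X"
  shows "k_separating G k S (g <# X)"
proof -
  have "exterior G S X \<subseteq> carrier G" by (auto simp: exterior_def)
  then show ?thesis using assms
    by (simp add: k_separating_iff exterior_l_coset large_def)
qed

subsection \<open>Fragments and atoms\<close>

definition based :: "'a set \<Rightarrow> bool" where
  "based S \<longleftrightarrow> S \<subseteq> carrier G \<and> finite S \<and> \<one> \<in> S"

lemma kappa_le:
  assumes "based S" "k_separating G k S X"
  shows "card X + kappa G k S \<le> card (X <#> S)"
proof -
  have "kappa G k S = Inf {card (boundary G S X) | X. k_separating G k S X}"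
    using assms(2) by (auto simp: kappa_def)
  also have "\<dots> \<le> card (boundary G S X)"
    by (rule cInf_lower) (use assms(2) in auto)
  finally show ?thesis
    using card_boundary[of S X] assms by (auto simp: based_def k_separating_def)
qed

lemma fragment_iff:
  assumes "based S"
  shows "fragment G k S X \<longleftrightarrow> k_separating G k S X \<and> card (X <#> S) = card X + kappa G k S"
  using card_boundary[of S X] assms by (auto simp: fragment_def based_def k_separating_def)

lemma fragmentI:
  assumes "based S" "k_separating G k S X" "card (X <#> S) \<le> card X + kappa G k S"
  shows "fragment G k S X"
  using kappa_le[OF assms(1,2)] assms by (simp add: fragment_iff)

lemma fragment_exists:
  assumes "k_separating G k S X"
  shows "\<exists>F. fragment G k S F"
proof -
  let ?B = "{card (boundary G S X) | X. k_separating G k S X}"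
  have k: "kappa G k S = Inf ?B" using assms by (auto simp: kappa_def)
  have "Inf ?B \<in> ?B" by (rule Inf_nat_def1) (use assms in auto)
  then show ?thesis unfolding fragment_def k by auto
qed

lemma fragment_l_coset:
  assumes "based S" "fragment G k S X" "g \<in> carrier G"
  shows "fragment G k S (g <# X)"
proof -
  have X: "X \<subseteq> carrier G" using assms by (auto simp: fragment_def k_separating_def)
  have S: "S \<subseteq> carrier G" using assms by (auto simp: based_def)
  show ?thesis
    using assms X S k_separating_l_coset
    by (simp add: fragment_iff set_mult_l_coset)
qed

text \<open>A k-separating set is also j-separating, so its existence excludes the default value at
  both levels, and a k-fragment competes in the minimum at level j.\<close>

lemma kappa_mono:
  assumes "based S" "j \<le> k" "k_separating G k S X"
  shows "kappa G j S \<le> kappa G k S"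
proof -
  obtain F where "fragment G k S F" using fragment_exists assms by blast
  then have "card (F <#> S) = card F + kappa G k S" "k_separating G j S F"
    using assms fragment_iff k_separating_le by blast+
  then show ?thesis using kappa_le[OF assms(1)] by fastforce
qed

lemma fragment_le:
  assumes "based S" "fragment G k S F" "j \<le> k" "kappa G j S = kappa G k S"
  shows "fragment G j S F"
  using assms fragment_iff k_separating_le by metis

definition atom :: "nat \<Rightarrow> 'a set \<Rightarrow> 'a set \<Rightarrow> bool" where
  "atom k S A \<longleftrightarrow> fragment G k S A \<and> (\<forall>F. fragment G k S F \<longrightarrow> card A \<le> card F)"

lemma atom_exists:
  assumes "based S" "k_separating G k S X" "1 \<le> k"
  shows "\<exists>A. atom k S A \<and> \<one> \<in> A"
proof -
  obtain F where "fragment G k S F" using fragment_exists assms by blast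
  then obtain A where A: "fragment G k S A" "\<And>F. fragment G k S F \<Longrightarrow> card A \<le> card F"
    using ex_has_least_nat[of "fragment G k S" F card] by blast
  have c: "A \<subseteq> carrier G" "finite A" "1 \<le> card A" using A assms(3)
    by (auto simp: fragment_def k_separating_def)
  then obtain a where a: "a \<in> A" by fastforce
  let ?A = "inv a <# A"
  have "fragment G k S ?A" using fragment_l_coset A a c assms by auto
  moreover have "card ?A = card A" using a c by (metis card_l_coset inv_closed subsetD)
  moreover have "\<one> \<in> ?A" unfolding mem_l_coset using a c by (metis l_inv subsetD)
  ultimately show ?thesis unfolding atom_def using A(2) by metis
qed

lemma card_image_inv: "X \<subseteq> carrier G \<Longrightarrow> card (m_inv G ` X) = card X"
  by (rule card_image) (rule inj_on_subset[OF inv_inj])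

text \<open>In a finite group, \<open>X \<mapsto> - (G \<setminus> (X + S))\<close> does not increase the boundary.\<close>

lemma fragment_dual:
  assumes "based S" "fragment G k S F" "finite (carrier G)"
  shows "fragment G k S (m_inv G ` exterior G S F)"
proof -
  let ?E = "exterior G S F" and ?Z = "m_inv G ` exterior G S F"
  have S: "S \<subseteq> carrier G" "finite S" using assms by (auto simp: based_def)
  have F: "F \<subseteq> carrier G" "finite F" "k \<le> card F" "large k ?E"
    using assms by (auto simp: fragment_def k_separating_iff)
  have E: "?E \<subseteq> carrier G" "finite ?E" using assms by (auto simp: exterior_def)
  have Z: "?Z \<subseteq> carrier G" "finite ?Z" using E by auto
  have "m_inv G ` F \<inter> (?Z <#> S) = {}"
  proof -
    have False if "f \<in> F" "e \<in> ?E" "s \<in> S" "inv f = inv e \<otimes> s" for f e s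
    proof -
      have c: "f \<in> carrier G" "e \<in> carrier G" "s \<in> carrier G" using that F E S by auto
      have "e = f \<otimes> s"
      proof -
        have "f \<otimes> s = f \<otimes> (e \<otimes> (inv e \<otimes> s))" using c by (simp add: m_assoc[symmetric])
        also have "\<dots> = f \<otimes> (e \<otimes> inv f)" using that by simp
        also have "\<dots> = e" using c by (simp add: m_lcomm)
        finally show ?thesis by simp
      qed
      then show False using that by (auto simp: exterior_def set_mult_def)
    qed
    then show ?thesis by (auto simp: mem_set_mult)
  qed
  then have "m_inv G ` F \<subseteq> exterior G S ?Z" using F by (auto simp: exterior_def)
  \<comment> \<open>That the exterior of \<open>?Z\<close> has at least |F| elements serves twice:
    it makes \<open>?Z\<close> separating, and by complementation it bounds \<open>?Z <#> S\<close>
    from above.\<close>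
  then have ext: "card F \<le> card (exterior G S ?Z)"
    using card_image_inv[OF F(1)] card_mono[of "exterior G S ?Z" "m_inv G ` F"] assms(3)
    by (simp add: exterior_def)
  have cE: "card ?Z = card ?E" using card_image_inv E by blast
  have k: "k \<le> card ?E" using F(4) E by (simp add: large_def)
  have sep: "k_separating G k S ?Z"
    using Z cE k ext F(3) by (simp add: k_separating_def)
  have "card (exterior G S ?Z) + card (?Z <#> S) = card (carrier G)"
    using card_exterior[OF assms(3) S(1) Z(1)] .
  moreover have "card ?E + card (F <#> S) = card (carrier G)"
    using card_exterior[OF assms(3) S(1) F(1)] .
  moreover have "card (F <#> S) = card F + kappa G k S"
    using assms fragment_iff by blast
  ultimately have "card (?Z <#> S) \<le> card ?Z + kappa G k S"
    using ext cE by linarith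
  then show ?thesis using fragmentI assms(1) sep by blast
qed

text \<open>In a finite group the inverted exterior of F is again a fragment, hence no smaller than
  an atom. In an infinite group the exterior is infinite.\<close>

lemma atom_le_exterior:
  assumes "based S" "atom k S A" "fragment G k S F"
  shows "large (card A) (exterior G S F)"
proof (cases "finite (carrier G)")
  case True
  have "exterior G S F \<subseteq> carrier G" by (auto simp: exterior_def)
  then show ?thesis
    using fragment_dual[OF assms(1,3) True] assms(2) card_image_inv
    by (metis atom_def large_def)
next
  case False
  then show ?thesis using infinite_exterior[of S F] assms
    by (auto simp: large_def based_def fragment_def k_separating_def)
qed

text \<open>Submodularity bounds the two excesses together, and each is at least
  \<open>kappa\<close> once the set is separating, so both are equal to it. Only the exterior of the
  union is in danger: |(X Un Y)S| <= |YS| + |X| - |X Int Y|, and the hypothesis on the exterior of Y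
  leaves |X Int Y| >= k points.\<close>

lemma uncross:
  assumes S: "based S" and X: "fragment G k S X" and Y: "fragment G k S Y"
    and I: "k \<le> card (X \<inter> Y)" and L: "large (card X) (exterior G S Y)"
  shows "fragment G k S (X \<inter> Y)" "fragment G k S (X \<union> Y)"
proof -
  have S': "S \<subseteq> carrier G" "finite S" using S by (auto simp: based_def)
  have X': "X \<subseteq> carrier G" "finite X" "large k (exterior G S X)" "k \<le> card X"
    using X by (auto simp: fragment_def k_separating_iff)
  have Y': "Y \<subseteq> carrier G" "finite Y" using Y by (auto simp: fragment_def k_separating_iff)
  have s1: "k_separating G k S (X \<inter> Y)"
    using X' Y' I large_mono[OF X'(3) exterior_antimono[of "X \<inter> Y" X]]
    by (auto simp: k_separating_iff)
  have le1: "card (X \<inter> Y) + kappa G k S \<le> card ((X \<inter> Y) <#> S)"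
    by (rule kappa_le[OF S s1])
  have sub: "card ((X \<inter> Y) <#> S) + card ((X \<union> Y) <#> S) \<le> card (X <#> S) + card (Y <#> S)"
    by (rule submodular) (use X' Y' S' in auto)
  have cX: "card (X <#> S) = card X + kappa G k S" and cY: "card (Y <#> S) = card Y + kappa G k S"
    using X Y S fragment_iff by blast+
  have cUI: "card X + card Y = card (X \<union> Y) + card (X \<inter> Y)"
    using card_Un_Int X' Y' by blast
  have leU: "card ((X \<union> Y) <#> S) \<le> card (X \<union> Y) + kappa G k S"
    using sub le1 cX cY cUI by linarith
  have "large k (exterior G S (X \<union> Y))"
  proof (rule large_exteriorI)
    assume fin: "finite (carrier G)"
    have "card X + card (Y <#> S) \<le> card (carrier G)"
      by (rule large_exteriorD[OF L fin]) (use S' Y' in auto)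
    then show "k + card ((X \<union> Y) <#> S) \<le> card (carrier G)"
      using leU cY cUI I by linarith
  qed (use S' X' Y' in auto)
  moreover have "k \<le> card (X \<union> Y)"
    using X' Y' card_mono[of "X \<union> Y" X] by auto
  ultimately have s2: "k_separating G k S (X \<union> Y)"
    using X' Y' by (auto simp: k_separating_iff)
  show "fragment G k S (X \<union> Y)" by (rule fragmentI[OF S s2 leU])
  have "card (X \<union> Y) + kappa G k S \<le> card ((X \<union> Y) <#> S)" by (rule kappa_le[OF S s2])
  then show "fragment G k S (X \<inter> Y)"
    using sub cX cY cUI by (intro fragmentI[OF S s1]) linarith
qed

text \<open>The intersection is a fragment by uncrossing, and minimality of the atom forbids a
  proper one. Applied to a translate of the atom itself, this is the intersection property of
  atoms.\<close>

lemma atom_subset_fragment: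
  assumes "based S" "atom k S A" "fragment G k S F" "k \<le> card (A \<inter> F)"
  shows "A \<subseteq> F"
proof -
  have "fragment G k S A" using assms by (simp add: atom_def)
  then have "fragment G k S (A \<inter> F)"
    using uncross(1) assms atom_le_exterior by blast
  then have "card A \<le> card (A \<inter> F)" using assms(2) by (simp add: atom_def)
  moreover have "finite A" using \<open>fragment G k S A\<close> by (simp add: fragment_def k_separating_def)
  ultimately have "A \<inter> F = A" by (metis card_seteq inf_le1)
  then show ?thesis by blast
qed

lemma atom_translate:
  assumes "based S" "atom k S A" "g \<in> carrier G" "k \<le> card (A \<inter> (g <# A))"
  shows "g <# A = A"
proof -
  have A: "A \<subseteq> carrier G" "finite A" using assms by (auto simp: atom_def fragment_def k_separating_def)
  have "fragment G k S (g <# A)" using assms fragment_l_coset by (simp add: atom_def)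
  then have "A \<subseteq> g <# A" using atom_subset_fragment assms by blast
  then show ?thesis using subset_l_coset_eq A assms by blast
qed


section \<open>Periods of sets and of atoms\<close>

definition stab :: "'a set \<Rightarrow> 'a set" where
  "stab Y = {g \<in> carrier G. g <# Y = Y}"

lemma stab_subgroup:
  assumes "Y \<subseteq> carrier G"
  shows "subgroup (stab Y) G"
proof (rule subgroupI)
  show "stab Y \<noteq> {}" using assms by (auto simp: stab_def intro!: exI[of _ \<one>])
  fix a assume a: "a \<in> stab Y"
  then show "inv a \<in> stab Y"
    using assms l_coset_inv_cancel(2)[of a Y] by (auto simp: stab_def)
  fix b assume b: "b \<in> stab Y"
  show "a \<otimes> b \<in> stab Y"
    using a b assms l_coset_l_coset[of a b Y] by (auto simp: stab_def)
qed (auto simp: stab_def)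

lemma subgroup_eq_carrier:
  assumes "subgroup H G" "A \<subseteq> H" "generate G A = carrier G"
  shows "H = carrier G"
  using generate_subgroup_incl[OF assms(2,1)] subgroup.subset[OF assms(1)] assms(3) by auto

text \<open>For a finite Y mere inclusion of aY in Y already makes a a period, so all generators lie
  in \<open>stab Y\<close>. This is the standard source of contradictions: no finite proper
  non-empty set is closed under a generating set.\<close>

lemma closed_eq_carrier:
  assumes "Y \<subseteq> carrier G" "finite Y" "Y \<noteq> {}" "A \<subseteq> carrier G" "generate G A = carrier G"
    and "\<And>a. a \<in> A \<Longrightarrow> a <# Y \<subseteq> Y"
  shows "Y = carrier G"
proof -
  have "A \<subseteq> stab Y"
  proof
    fix a assume a: "a \<in> A"
    then show "a \<in> stab Y" using l_coset_subset_eq[of a Y] assms by (auto simp: stab_def)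
  qed
  then have *: "stab Y = carrier G" using subgroup_eq_carrier stab_subgroup assms by blast
  obtain y where y: "y \<in> Y" using assms by blast
  have "g \<in> Y" if g: "g \<in> carrier G" for g
  proof -
    have "g \<otimes> inv y \<in> stab Y" using * y g assms by auto
    then have "(g \<otimes> inv y) \<otimes> y \<in> Y" using y l_cosetI by (fastforce simp: stab_def)
    then show ?thesis using y g assms by (simp add: m_assoc subset_eq)
  qed
  then show ?thesis using assms by blast
qed

lemma l_coset_subgroup_eq:
  assumes "subgroup H G" "s \<in> carrier G" "x \<in> s <# H"
  shows "x <# H = s <# H"
proof -
  obtain h where h: "h \<in> H" "x = s \<otimes> h" using assms by (auto simp: mem_l_coset)
  have H: "H \<subseteq> carrier G" using assms subgroup.subset by blast
  have "x <# H = s <# (h <# H)" using h H assms by (simp add: l_coset_l_coset subset_eq)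
  also have "h <# H = H" using h H assms coset_join3 by blast
  finally show ?thesis .
qed

lemma mem_own_l_coset: "subgroup H G \<Longrightarrow> s \<in> carrier G \<Longrightarrow> s \<in> s <# H"
  unfolding mem_l_coset using subgroup.one_closed by force

lemma l_coset_subgroup_disjoint:
  assumes H: "subgroup H G" and c: "s \<in> carrier G" "t \<in> carrier G" and t: "t \<notin> s <# H"
  shows "(s <# H) \<inter> (t <# H) = {}"
proof (rule ccontr)
  assume "(s <# H) \<inter> (t <# H) \<noteq> {}"
  then obtain x where "x \<in> s <# H" "x \<in> t <# H" by blast
  then have "s <# H = t <# H" using l_coset_subgroup_eq[OF H] c by metis
  then show False using mem_own_l_coset[OF H c(2)] t by simp
qed

lemma subgroup_set_mult:
  assumes "subgroup H G" "A \<subseteq> H" "A \<noteq> {}"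
  shows "H <#> A = H"
proof
  show "H <#> A \<subseteq> H" using assms by (auto simp: mem_set_mult subset_iff intro: subgroup.m_closed[OF assms(1)])
  obtain a where a: "a \<in> A" using assms by blast
  have H: "H \<subseteq> carrier G" using assms subgroup.subset by blast
  have "h = (h \<otimes> inv a) \<otimes> a" "h \<otimes> inv a \<in> H" if "h \<in> H" for h
    using that a H assms by (auto simp: m_assoc subset_eq subgroup.m_closed subgroup.m_inv_closed)
  then show "H \<subseteq> H <#> A" using a unfolding mem_set_mult subset_iff by blast
qed

text \<open>For a in A the coset of a modulo \<open>stab A\<close> lies in both A and aA. With k
  points in common, a becomes a period, so A consists of its own periods.\<close>

lemma atom_stab:
  assumes S: "based S" and A: "atom k S A" "\<one> \<in> A" and k: "k \<le> card (stab A)"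
  shows "subgroup A G"
proof -
  have Ac: "A \<subseteq> carrier G" "finite A" using A by (auto simp: atom_def fragment_def k_separating_def)
  have Z: "subgroup (stab A) G" using stab_subgroup Ac by blast
  have ZA: "stab A \<subseteq> A"
  proof
    fix z assume "z \<in> stab A"
    then have "z \<otimes> \<one> \<in> A" "z \<in> carrier G" using A(2) l_cosetI[of \<one> A G z] by (auto simp: stab_def)
    then show "z \<in> A" by simp
  qed
  have "A \<subseteq> stab A"
  proof
    fix a assume a: "a \<in> A"
    then have ac: "a \<in> carrier G" using Ac by blast
    have "a <# stab A \<subseteq> A \<inter> (a <# A)"
    proof
      fix x assume "x \<in> a <# stab A"
      then obtain z where z: "z \<in> stab A" "x = a \<otimes> z" by (auto simp: mem_l_coset)
      then have "z \<otimes> a \<in> A" using a l_cosetI[of a A G z] by (auto simp: stab_def)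
      then have "x \<in> A" using z ac by (auto simp: m_comm stab_def)
      then show "x \<in> A \<inter> (a <# A)" using z ZA by (auto simp: mem_l_coset)
    qed
    then have "card (a <# stab A) \<le> card (A \<inter> (a <# A))" using Ac by (intro card_mono) auto
    moreover have "card (a <# stab A) = card (stab A)" using ac by (intro card_l_coset) (auto simp: stab_def)
    ultimately have "a <# A = A" using atom_translate[OF S A(1) ac] k by linarith
    then show "a \<in> stab A" using ac by (simp add: stab_def)
  qed
  then show ?thesis using Z ZA by (metis subset_antisym)
qed

definition thin :: "nat \<Rightarrow> 'a set \<Rightarrow> bool" where
  "thin t A \<longleftrightarrow> (\<forall>g\<in>carrier G. g \<noteq> \<one> \<longrightarrow> card (A \<inter> (g <# A)) \<le> t)"

lemma stab_finite:
  assumes "finite A" "A \<subseteq> carrier G" "a \<in> A"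
  shows "finite (stab A)"
proof -
  have "(\<lambda>z. z \<otimes> a) ` stab A \<subseteq> A" using assms(3) by (force simp: stab_def mem_l_coset)
  moreover have "inj_on (\<lambda>z. z \<otimes> a) (stab A)"
    using assms by (intro inj_on_subset[OF inj_on_multc]) (auto simp: stab_def)
  ultimately show ?thesis using assms(1) finite_imageD finite_subset by blast
qed

lemma two_le_card_subgroup:
  assumes "subgroup H G" "finite H" "g \<in> H" "g \<noteq> \<one>"
  shows "2 \<le> card H"
proof -
  have "{\<one>, g} \<subseteq> H" using assms subgroup.one_closed by auto
  then have "card {\<one>, g} \<le> card H" using assms card_mono by blast
  then show ?thesis using assms by simp
qed

lemma two_atom_thin:
  assumes S: "based S" and A: "atom 2 S A" "\<one> \<in> A"
  shows "subgroup A G \<or> thin 1 A"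
proof (rule disjCI)
  assume "\<not> thin 1 A"
  then obtain g where g: "g \<in> carrier G" "g \<noteq> \<one>" "2 \<le> card (A \<inter> (g <# A))"
    by (auto simp: thin_def)
  then have gz: "g \<in> stab A" using atom_translate[OF S A(1)] by (simp add: stab_def)
  have Ac: "A \<subseteq> carrier G" "finite A" using A by (auto simp: atom_def fragment_def k_separating_def)
  have "2 \<le> card (stab A)"
    using two_le_card_subgroup[OF stab_subgroup[OF Ac(1)] stab_finite[OF Ac(2,1) A(2)] gz] g(2) .
  then show "subgroup A G" using atom_stab[OF S A] by blast
qed

lemma two_atom_thin':
  assumes "based S" "atom 2 S A" "\<one> \<in> A" "\<not> degenerate G S"
  shows "thin 1 A"
  using two_atom_thin[OF assms(1-3)] assms(2,4) by (auto simp: atom_def degenerate_def)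

text \<open>If thinness fails, the period group Z of A is non-trivial; order 3 or more would make A
  a subgroup, so |Z| = 2. For a in A outside Z the intersection of A and aA contains aZ and has at
  most two points, hence equals aZ. As the two values of \<open>kappa\<close> agree, uncrossing at
  level 2 makes Z a 2-fragment, contrary to non-degeneracy.\<close>

lemma three_atom_thin:
  assumes S: "based S" and A: "atom 3 S A" "\<one> \<in> A" and nd: "\<not> degenerate G S"
    and eq: "kappa G 2 S = kappa G 3 S"
  shows "thin 2 A"
proof (rule ccontr)
  assume "\<not> thin 2 A"
  then obtain g where g: "g \<in> carrier G" "g \<noteq> \<one>" "3 \<le> card (A \<inter> (g <# A))"
    by (auto simp: thin_def)
  have Af: "fragment G 3 S A" using A by (simp add: atom_def)
  have Ac: "A \<subseteq> carrier G" "finite A" "3 \<le> card A" using Af by (auto simp: fragment_def k_separating_def)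
  have A2: "fragment G 2 S A" by (rule fragment_le[OF S Af _ eq]) simp
  let ?Z = "stab A"
  have Z: "subgroup ?Z G" using stab_subgroup Ac by blast
  have gz: "g \<in> ?Z" using atom_translate[OF S A(1) g(1,3)] g by (simp add: stab_def)
  have cZ: "2 \<le> card ?Z"
    using two_le_card_subgroup[OF Z stab_finite[OF Ac(2,1) A(2)] gz] g(2) .
  have "\<not> 3 \<le> card ?Z" using atom_stab[OF S A] nd A2 by (auto simp: degenerate_def)
  then have cZ2: "card ?Z = 2" using cZ by linarith
  then have "\<not> A \<subseteq> ?Z" using Ac card_mono[of ?Z A] stab_finite[OF Ac(2,1) A(2)] by auto
  then obtain a where a: "a \<in> A" "a \<notin> ?Z" by blast
  have ac: "a \<in> carrier G" using a Ac by blast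
  have sub: "a <# ?Z \<subseteq> A \<inter> (a <# A)"
  proof
    fix x assume "x \<in> a <# ?Z"
    then obtain z where z: "z \<in> ?Z" "x = a \<otimes> z" by (auto simp: mem_l_coset)
    then have zc: "z \<in> carrier G" by (auto simp: stab_def)
    have "z \<otimes> a \<in> A" using a z l_cosetI[of a A G z] by (auto simp: stab_def)
    then have "x \<in> A" using z ac zc by (auto simp: m_comm)
    moreover have "z \<otimes> \<one> \<in> A" using A(2) z l_cosetI[of \<one> A G z] by (auto simp: stab_def)
    ultimately show "x \<in> A \<inter> (a <# A)" using z zc by (auto simp: mem_l_coset)
  qed
  have Zc: "?Z \<subseteq> carrier G" by (auto simp: stab_def)
  have caZ: "card (a <# ?Z) = 2" using cZ2 ac Zc by simp
  have "\<not> 3 \<le> card (A \<inter> (a <# A))"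
    using atom_translate[OF S A(1) ac] a(2) ac by (auto simp: stab_def)
  then have "card (A \<inter> (a <# A)) \<le> card (a <# ?Z)" using caZ by linarith
  then have e: "a <# ?Z = A \<inter> (a <# A)" using card_seteq[OF _ sub] Ac by blast
  have aA: "fragment G 3 S (a <# A)" using fragment_l_coset[OF S Af ac] .
  have aA2: "fragment G 2 S (a <# A)" by (rule fragment_le[OF S aA _ eq]) simp
  have "fragment G 2 S (A \<inter> (a <# A))"
    by (rule uncross(1)[OF S A2 aA2 _ atom_le_exterior[OF S A(1) aA]]) (use e caZ in simp)
  then have "fragment G 2 S (inv a <# (a <# ?Z))" using e fragment_l_coset[OF S] ac by auto
  then have "fragment G 2 S ?Z" using ac Zc by simp
  then show False using nd Z by (auto simp: degenerate_def)
qed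

subsection \<open>Fragments generate the group\<close>

text \<open>The \<open>1\<close>-atom containing the neutral element is a subgroup, so subgroups witness \<open>\<kappa>\<^sub>1\<close>.\<close>

lemma card_set_mult_ge_of_subgroups:
  assumes A: "based A" "generate G A = carrier G"
    and H: "\<And>H. subgroup H G \<Longrightarrow> finite H \<Longrightarrow> \<not> A \<subseteq> H \<Longrightarrow> card H + c \<le> card (H <#> A)"
    and X: "X \<subseteq> carrier G" "finite X" "X \<noteq> {}" "X <#> A \<noteq> carrier G"
  shows "card X + c \<le> card (X <#> A)"
proof -
  have Ac: "A \<subseteq> carrier G" "finite A" "\<one> \<in> A" using A by (auto simp: based_def)
  have "exterior G A X \<noteq> {}" using X(4) set_mult_subset[OF X(1) Ac(1)] unfolding exterior_def by blast
  then have sX: "k_separating G (Suc 0) A X"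
    using X by (auto simp: k_separating_iff Suc_le_eq card_gt_0_iff)
  obtain K where K: "atom (Suc 0) A K" "\<one> \<in> K" using atom_exists[OF A(1) sX] by auto
  have Kf: "fragment G (Suc 0) A K" using K by (simp add: atom_def)
  have Kc: "K \<subseteq> carrier G" "finite K" "exterior G A K \<noteq> {}"
    using Kf by (auto simp: fragment_def k_separating_iff)
  have "Suc 0 \<le> card (stab K)"
    using stab_finite[OF Kc(2,1) K(2)] subgroup.one_closed[OF stab_subgroup[OF Kc(1)]]
    by (auto simp: Suc_le_eq card_gt_0_iff)
  then have Ks: "subgroup K G" using atom_stab[OF A(1) K] by blast
  have "\<not> A \<subseteq> K"
  proof
    assume "A \<subseteq> K"
    then have "K = carrier G" using subgroup_eq_carrier Ks A by blast
    then show False using Kc subset_set_mult[OF Ac(3) Kc(1)] by (auto simp: exterior_def)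
  qed
  then have "card K + c \<le> card (K <#> A)" using H Ks Kc by blast
  moreover have "card (K <#> A) = card K + kappa G (Suc 0) A" using Kf A(1) fragment_iff by blast
  ultimately show ?thesis using kappa_le[OF A(1) sX] by linarith
qed

text \<open>The preceding bound inside the subgroup generated by A, regarded as a group of its own.
  It is needed while A is not yet known to generate G.\<close>

lemma card_set_mult_ge_of_subgroups_within:
  assumes A: "based A" and Q: "Q = generate G A"
    and H: "\<And>H. subgroup H G \<Longrightarrow> finite H \<Longrightarrow> \<not> A \<subseteq> H \<Longrightarrow> card H + c \<le> card (H <#> A)"
    and X: "X \<subseteq> Q" "finite X" "X \<noteq> {}" "X <#> A \<noteq> Q"
  shows "card X + c \<le> card (X <#> A)"
proof -
  have Ac: "A \<subseteq> carrier G" "finite A" "\<one> \<in> A" using A by (auto simp: based_def)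
  have Qs: "subgroup Q G" using Q generate_is_subgroup[OF Ac(1)] by simp
  have AQ: "A \<subseteq> Q" using Q by (auto intro: generate.incl)
  interpret GQ: comm_group "G\<lparr>carrier := Q\<rparr>"
    using subgroup.subgroup_is_group[OF Qs] subgroup_imp_group[OF Qs]
    by (intro group.group_comm_groupI) (auto intro: m_comm simp: subgroup.mem_carrier[OF Qs])
  have "card X + c \<le> card (X <#>\<^bsub>G\<lparr>carrier := Q\<rparr>\<^esub> A)"
  proof (rule GQ.card_set_mult_ge_of_subgroups)
    show "GQ.based A" using Ac AQ by (simp add: GQ.based_def)
    show "generate (G\<lparr>carrier := Q\<rparr>) A = carrier (G\<lparr>carrier := Q\<rparr>)"
      using generate_consistent[OF AQ Qs] Q by simp
  next
    fix K assume "subgroup K (G\<lparr>carrier := Q\<rparr>)" "finite K" "\<not> A \<subseteq> K"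
    then show "card K + c \<le> card (K <#>\<^bsub>G\<lparr>carrier := Q\<rparr>\<^esub> A)"
      using H incl_subgroup[OF Qs] by simp
  qed (use X in auto)
  then show ?thesis by simp
qed

text \<open>Cut S along the cosets of the subgroup Q generated by A. A piece whose product with A
  does not fill its coset gains at least |A| - 1 elements. Because of \<open>small\<close> this
  happens in at most one coset, so passing from A to Q adds at most |Q| - |A| elements to the
  product. Hence |QS| <= |Q| + \<open>kappa\<close>, and Q would be a 2-fragment.\<close>

lemma generate_fragment_eq_carrier:
  assumes S: "based S" "generate G S = carrier G" "\<not> degenerate G S"
    and A: "fragment G 2 S A" "based A"
    and c: "\<And>X. X \<subseteq> generate G A \<Longrightarrow> finite X \<Longrightarrow> X \<noteq> {} \<Longrightarrow> X <#> A \<noteq> generate G A \<Longrightarrow>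
               card X + card A \<le> card (X <#> A) + 1"
    and small: "kappa G 2 S + 2 < card A + card S"
    and big: "finite (carrier G) \<Longrightarrow> 2 * kappa G 2 S < card (carrier G)"
  shows "generate G A = carrier G"
proof (rule ccontr)
  define Q where "Q = generate G A"
  let ?k = "kappa G 2 S"
  assume "generate G A \<noteq> carrier G"
  then have QG: "Q \<noteq> carrier G" by (simp add: Q_def)
  have Ac: "A \<subseteq> carrier G" "finite A" "\<one> \<in> A" using A by (auto simp: based_def)
  have Sc: "S \<subseteq> carrier G" "finite S" "\<one> \<in> S" using S by (auto simp: based_def)
  have Qs: "subgroup Q G" using Q_def generate_is_subgroup[OF Ac(1)] by simp
  have Qc: "Q \<subseteq> carrier G" using Qs subgroup.subset by blast
  have AQ: "A \<subseteq> Q" using Q_def by (auto intro: generate.incl)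
  have sep: "k_separating G 2 S A" and cAS: "card (A <#> S) = card A + ?k"
    using A S fragment_iff by blast+
  have cA: "2 \<le> card A" using sep by (simp add: k_separating_def)
  have SA: "S <#> A = A <#> S" using set_mult_commute Ac Sc by blast
  define P where "P s = S \<inter> (s <# Q)" for s
  have Pc: "P s \<subseteq> carrier G" "finite (P s)" for s using Sc by (auto simp: P_def)
  have PQ: "P s <#> A \<subseteq> s <# Q" if "s \<in> S" for s
  proof -
    have "P s <#> A \<subseteq> (s <# Q) <#> A" by (rule mono_set_mult) (auto simp: P_def)
    also have "\<dots> = s <# (Q <#> A)" by (rule set_mult_l_coset) (use that Sc Qc Ac in auto)
    also have "Q <#> A = Q" using subgroup_set_mult[OF Qs AQ] Ac by blast
    finally show ?thesis .
  qed
  have inc: "card (P s) + card A \<le> card (P s <#> A) + 1" if s: "s \<in> S" "P s <#> A \<noteq> s <# Q" for s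
  proof -
    have sc: "s \<in> carrier G" using s Sc by blast
    let ?X = "inv s <# P s"
    have "inv s <# P s \<subseteq> inv s <# (s <# Q)" by (rule l_coset_mono) (auto simp: P_def)
    then have XQ: "?X \<subseteq> Q" using sc Qc by simp
    have "s \<in> P s" using s mem_own_l_coset[OF Qs sc] by (simp add: P_def)
    then have ne: "?X \<noteq> {}" by auto
    have XA: "?X <#> A = inv s <# (P s <#> A)" using set_mult_l_coset sc Pc Ac by simp
    have "?X <#> A \<noteq> Q"
    proof
      assume "?X <#> A = Q"
      then have "s <# Q = s <# (inv s <# (P s <#> A))" using XA by simp
      then show False using s sc Pc Ac by simp
    qed
    then have "card ?X + card A \<le> card (?X <#> A) + 1"
      using c[of ?X] XQ ne Pc by (simp add: Q_def)
    then show ?thesis using XA sc Pc Ac by simp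
  qed
  have disj: "(s <# Q) \<inter> (t <# Q) = {}" if "s \<in> carrier G" "t \<in> carrier G" "s <# Q \<noteq> t <# Q" for s t
    using l_coset_subgroup_eq[OF Qs] that by blast
  have one_inc: "s <# Q = t <# Q"
    if s: "s \<in> S" "P s <#> A \<noteq> s <# Q" and t: "t \<in> S" "P t <#> A \<noteq> t <# Q" for s t
  proof (rule ccontr)
    assume ne: "s <# Q \<noteq> t <# Q"
    have sc: "s \<in> carrier G" "t \<in> carrier G" using s t Sc by auto
    let ?R = "S - P s - P t"
    have R: "?R \<subseteq> carrier G" "finite ?R" using Sc by auto
    have Rn: "(?R <#> A) \<inter> (u <# Q) = {}" if u: "u = s \<or> u = t" for u
    proof -
      have False if x: "r \<in> ?R" "a \<in> A" "r \<otimes> a \<in> u <# Q" for r a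
      proof -
        have rc: "r \<in> carrier G" "u \<in> carrier G" using x u sc R by auto
        have "r \<notin> u <# Q" using x u by (auto simp: P_def)
        moreover have "r \<otimes> a \<in> r <# Q" using x AQ by (intro l_cosetI) auto
        ultimately show False using l_coset_subgroup_disjoint[OF Qs rc(2,1)] x by blast
      qed
      then show ?thesis unfolding disjoint_iff mem_set_mult by blast
    qed
    have "S <#> A = (P s <#> A) \<union> (P t <#> A) \<union> (?R <#> A)"
      unfolding set_mult_Un_left[symmetric] by (rule arg_cong[of _ _ "\<lambda>X. X <#> A"]) (auto simp: P_def)
    moreover have "(P s <#> A) \<inter> (P t <#> A) = {}" using PQ s t disj[OF sc ne] by blast
    moreover have "((P s <#> A) \<union> (P t <#> A)) \<inter> (?R <#> A) = {}" using PQ s t Rn by blast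
    ultimately have 1: "card (S <#> A) = card (P s <#> A) + card (P t <#> A) + card (?R <#> A)"
      using Pc R Ac by (simp add: card_Un_disjoint)
    have "P s \<inter> P t = {}" using disj[OF sc ne] by (auto simp: P_def)
    moreover have "S = P s \<union> P t \<union> ?R" by (auto simp: P_def)
    moreover have "(P s \<union> P t) \<inter> ?R = {}" by auto
    ultimately have 2: "card S = card (P s) + card (P t) + card ?R"
      using Pc R by (metis card_Un_disjoint finite_Un)
    have 3: "card ?R \<le> card (?R <#> A)" using card_set_mult_ge R Ac by blast
    \<comment> \<open>Two deficient cosets would give |A| + \<open>?k\<close> >= |S| + 2(|A| - 1),
      against \<open>small\<close>.\<close>
    show False using 1 2 3 inc[OF s] inc[OF t] cAS small SA by simp
  qed
  obtain s0 where s0: "s0 \<in> S" and comp: "\<And>s. s \<in> S \<Longrightarrow> s <# Q \<noteq> s0 <# Q \<Longrightarrow> P s <#> A = s <# Q"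
  proof (cases "\<exists>s\<in>S. P s <#> A \<noteq> s <# Q")
    case True
    then show ?thesis using one_inc that by metis
  next
    case False
    then show ?thesis using that Sc by blast
  qed
  have s0c: "s0 \<in> carrier G" using s0 Sc by blast
  have "\<not> S \<subseteq> s0 <# Q"
  proof
    assume *: "S \<subseteq> s0 <# Q"
    then have "\<one> <# Q = s0 <# Q" using l_coset_subgroup_eq[OF Qs s0c] Sc by blast
    then have "S \<subseteq> Q" using * Qc by simp
    then show False using QG subgroup_eq_carrier[OF Qs _ S(2)] by blast
  qed
  then obtain s1 where s1: "s1 \<in> S" "s1 \<notin> s0 <# Q" by blast
  have s1c: "s1 \<in> carrier G" using s1 Sc by blast
  have "s1 <# Q \<noteq> s0 <# Q" using s1 mem_own_l_coset[OF Qs s1c] by blast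
  then have "P s1 <#> A = s1 <# Q" using comp s1 by blast
  \<comment> \<open>A completely filled coset is a product of two finite sets; this is what makes Q
    finite in an infinite group.\<close>
  then have finQ: "finite Q" using Pc Ac s1c Qc by (metis finite_l_coset_iff finite_set_mult)
  \<comment> \<open>Outside the exceptional coset of \<open>s0\<close> the products QS and AS agree;
    inside it, AS contains at least \<open>s0 <# A\<close>.\<close>
  have sub: "Q <#> S \<subseteq> (A <#> S) \<union> ((s0 <# Q) - (s0 <# A))"
  proof
    fix x assume "x \<in> Q <#> S"
    then obtain q s where q: "q \<in> Q" "s \<in> S" "x = q \<otimes> s" by (auto simp: mem_set_mult)
    have x: "x \<in> s <# Q" using q Sc Qc by (auto simp: mem_l_coset m_comm subset_eq)
    have s0A: "s0 <# A \<subseteq> A <#> S" using l_coset_subset_set_mult[OF s0, of A] SA by simp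
    show "x \<in> (A <#> S) \<union> ((s0 <# Q) - (s0 <# A))"
    proof (cases "s <# Q = s0 <# Q")
      case True then show ?thesis using x s0A by blast
    next
      case False
      then have "x \<in> P s <#> A" using comp q x by blast
      moreover have "P s <#> A \<subseteq> S <#> A" by (rule mono_set_mult) (auto simp: P_def)
      ultimately show ?thesis using SA by blast
    qed
  qed
  have "card (Q <#> S) \<le> card (A <#> S) + card ((s0 <# Q) - (s0 <# A))"
    using card_mono[OF _ sub] card_Un_le[of "A <#> S"] finQ Ac Sc by (meson finite_Diff finite_UnI finite_l_coset finite_set_mult le_trans)
  also have "card ((s0 <# Q) - (s0 <# A)) = card Q - card A"
  proof -
    have "card (s0 <# (Q - A)) = card (Q - A)" by (rule card_l_coset) (use s0c Qc in auto)
    then show ?thesis using AQ s0c Qc Ac by (simp add: l_coset_Diff card_Diff_subset)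
  qed
  finally have QS: "card (Q <#> S) \<le> card Q + ?k"
    using cAS card_mono[OF finQ AQ] by linarith
  have cQ: "2 \<le> card Q" using card_mono[OF finQ AQ] cA by linarith
  obtain g where g: "g \<in> carrier G" "g \<notin> Q" using QG Qc by blast
  \<comment> \<open>If QS is all of G, then |G| <= |Q| + \<open>?k\<close> with |Q| <= |G|/2
    contradicts \<open>big\<close>. Otherwise the exterior of Q contains a whole coset of Q, so it
    has at least two points.\<close>
  show False
  proof (cases "Q <#> S = carrier G")
    case True
    then have fin: "finite (carrier G)" using finQ Sc by (metis finite_set_mult)
    have "(\<one> <# Q) \<inter> (g <# Q) = {}"
      using disj[of \<one> g] g mem_own_l_coset[OF Qs g(1)] Qc by auto
    then have "card Q + card (g <# Q) = card (Q \<union> (g <# Q))" using finQ Qc by (simp add: card_Un_disjoint)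
    also have "\<dots> \<le> card (carrier G)" using Qc g fin by (intro card_mono) auto
    finally have "2 * card Q \<le> card (carrier G)" using g Qc by simp
    then show False using QS True big[OF fin] by simp
  next
    case False
    then obtain y where y: "y \<in> carrier G" "y \<notin> Q <#> S"
      using set_mult_subset[OF Qc Sc(1)] by blast
    have "y <# Q \<subseteq> exterior G S Q"
    proof
      fix x assume "x \<in> y <# Q"
      then obtain q where q: "q \<in> Q" "x = y \<otimes> q" by (auto simp: mem_l_coset)
      have qc: "q \<in> carrier G" using q Qc by blast
      have "y \<in> exterior G S Q" using y by (simp add: exterior_def)
      then have "x \<in> q <# exterior G S Q" using q y qc by (auto simp: mem_l_coset m_comm)
      also have "\<dots> = exterior G S (q <# Q)" using exterior_l_coset[OF qc Qc Sc(1)] ..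
      also have "q <# Q = Q" using coset_join3[OF qc Qs q(1)] .
      finally show "x \<in> exterior G S Q" .
    qed
    moreover have "large 2 (y <# Q)" using cQ y Qc by (simp add: large_def)
    ultimately have "large 2 (exterior G S Q)" using large_mono by blast
    then have "k_separating G 2 S Q" using Qc finQ cQ by (simp add: k_separating_iff)
    then have "fragment G 2 S Q" using fragmentI S QS by blast
    then show False using S(3) Qs by (auto simp: degenerate_def)
  qed
qed

subsection \<open>Sets with small translate intersections\<close>

text \<open>Sets with \<open>thin 1\<close> are Sidon sets: two representations of g as a quotient
  would put two points into the intersection of A and gA.\<close>

lemma thin_diff_inj:
  assumes A: "A \<subseteq> carrier G" "finite A" "thin 1 A"
  shows "inj_on (\<lambda>(a, b). a \<otimes> inv b) {(a, b). a \<in> A \<and> b \<in> A \<and> a \<noteq> b}"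
proof (rule inj_onI, clarify)
  fix a b a' b'
  assume m: "a \<in> A" "b \<in> A" "a \<noteq> b" "a' \<in> A" "b' \<in> A" and e: "a \<otimes> inv b = a' \<otimes> inv b'"
  then have c: "a \<in> carrier G" "b \<in> carrier G" "a' \<in> carrier G" "b' \<in> carrier G" using A by auto
  let ?g = "a \<otimes> inv b"
  have g: "?g \<in> carrier G" using c by simp
  have "?g \<noteq> \<one>" using m c by (metis inv_equality inv_inv inv_closed)
  then have "card (A \<inter> (?g <# A)) \<le> 1" using A g by (simp add: thin_def)
  moreover have "a = ?g \<otimes> b" using c by (simp add: m_assoc)
  then have "a \<in> ?g <# A" using m by (auto simp: mem_l_coset)
  moreover have "a' = ?g \<otimes> b'" using c e by (simp add: m_assoc)
  then have "a' \<in> ?g <# A" using m by (auto simp: mem_l_coset)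
  ultimately have "a = a'" using m A by (auto simp: card_le_Suc0_iff_eq)
  then have "inv b = inv b'" using e c by simp
  then have "b = b'" using c by (metis inv_inv)
  then show "a = a' \<and> b = b'" using \<open>a = a'\<close> by blast
qed

text \<open>Ordered pairs of distinct points inside P or inside R give pairwise different
  non-trivial quotients, all lying in H.\<close>

lemma thin_subgroup_card:
  assumes A: "A \<subseteq> carrier G" "finite A" "thin 1 A" and H: "subgroup H G" "finite H"
    and P: "P \<subseteq> A" "R \<subseteq> A" "P \<inter> R = {}"
    and PH: "\<And>a b. a \<in> P \<Longrightarrow> b \<in> P \<Longrightarrow> a \<otimes> inv b \<in> H"
    and RH: "\<And>a b. a \<in> R \<Longrightarrow> b \<in> R \<Longrightarrow> a \<otimes> inv b \<in> H"
  shows "card P * (card P - 1) + card R * (card R - 1) + 1 \<le> card H"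
proof -
  define D where "D X = {(a, b). a \<in> X \<and> b \<in> X \<and> a \<noteq> b}" for X :: "'a set"
  have cD: "card (D X) = card X * (card X - 1)" if "X \<subseteq> A" for X
  proof -
    have f: "finite X" using that A finite_subset by blast
    have "D X = X \<times> X - (\<lambda>x. (x, x)) ` X" by (auto simp: D_def)
    moreover have "card ((\<lambda>x. (x, x)) ` X) = card X" by (rule card_image) (auto simp: inj_on_def)
    moreover have "(\<lambda>x. (x, x)) ` X \<subseteq> X \<times> X" by auto
    ultimately have "card (D X) = card X * card X - card X"
      using f by (simp add: card_Diff_subset card_cartesian_product)
    then show ?thesis by (simp add: diff_mult_distrib2)
  qed
  have fD: "finite (D X)" if "X \<subseteq> A" for X
    by (rule finite_subset[of _ "A \<times> A"]) (use that A in \<open>auto simp: D_def\<close>)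
  have disj: "D P \<inter> D R = {}" using P by (auto simp: D_def)
  let ?f = "\<lambda>(a, b). a \<otimes> inv b"
  have inj: "inj_on ?f (D P \<union> D R)"
    by (rule inj_on_subset[OF thin_diff_inj[OF A]]) (use P in \<open>auto simp: D_def\<close>)
  have img: "?f ` (D P \<union> D R) \<subseteq> H - {\<one>}"
  proof clarify
    fix a b assume ab: "(a, b) \<in> D P \<union> D R"
    then have m: "a \<in> carrier G" "b \<in> carrier G" "a \<noteq> b" using P A by (auto simp: D_def)
    have "a \<otimes> inv b \<noteq> \<one>" using m by (metis inv_equality inv_inv inv_closed)
    then show "a \<otimes> inv b \<in> H - {\<one>}" using ab PH RH by (auto simp: D_def)
  qed
  have "card (D P \<union> D R) \<le> card (H - {\<one>})"
    using card_inj_on_le[OF inj img] H by blast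
  moreover have "card (H - {\<one>}) + 1 = card H"
    using H subgroup.one_closed[OF H(1)] by (metis Suc_eq_plus1 card.remove)
  moreover have "card (D P \<union> D R) = card P * (card P - 1) + card R * (card R - 1)"
    using card_Un_disjoint[OF fD fD disj] cD P by simp
  ultimately show ?thesis by linarith
qed

text \<open>Here m and n stand for the sizes of two pieces of a Sidon set in different cosets of a
  subgroup of order h.\<close>

lemma quadratic_aux:
  fixes m n h :: nat
  assumes "m * (m - 1) + n * (n - 1) + 1 \<le> h"
  shows "m + n \<le> h + 1"
    and "2 \<le> h \<Longrightarrow> m + n \<le> h"
    and "4 \<le> m + n \<Longrightarrow> 1 \<le> m \<Longrightarrow> 1 \<le> n \<Longrightarrow> m + n + 1 \<le> h"
proof -
  have g': "k - 1 \<le> k * (k - 1)" for k :: nat by (cases k) auto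
  note g = g'[of m] g'[of n]
  then show "m + n \<le> h + 1" using assms by linarith
  have q: "k \<le> 1 \<or> k + (k - 2) \<le> k * (k - 1)" for k :: nat
  proof (cases "k \<le> 1")
    case False
    then have "2 * (k - 1) \<le> k * (k - 1)" by (intro mult_le_mono1) simp
    then show ?thesis by linarith
  qed simp
  show "m + n \<le> h" if "2 \<le> h" using q[of m] q[of n] assms g that by linarith
  show "m + n + 1 \<le> h" if "4 \<le> m + n" "1 \<le> m" "1 \<le> n"
    using q[of m] q[of n] assms g that by linarith
qed

text \<open>HA contains the cosets H and bH and all of A, so |HA| >= 2|H| + |A| - m - n, where m and
  n count the points of A in the two cosets. The Sidon property makes m and n of order sqrt |H|. For
  the last bound a third coset is used when A is not covered by two.\<close>

lemma thin_set_mult_subgroup: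
  assumes A: "based A" "thin 1 A" and H: "subgroup H G" "finite H" "\<not> A \<subseteq> H"
  shows "card H + card A \<le> card (H <#> A) + 1"
    and "2 \<le> card H \<Longrightarrow> card H + card A \<le> card (H <#> A)"
    and "2 \<le> card H \<Longrightarrow> 4 \<le> card A \<Longrightarrow> card H + card A + 1 \<le> card (H <#> A)"
proof -
  have Ac: "A \<subseteq> carrier G" "finite A" "\<one> \<in> A" using A by (auto simp: based_def)
  have Hc: "H \<subseteq> carrier G" using H subgroup.subset by blast
  define P where "P a = A \<inter> (a <# H)" for a
  have PH: "x \<otimes> inv y \<in> H" if xy: "x \<in> P a" "y \<in> P a" "a \<in> A" for x y a
  proof -
    obtain h h' where h: "h \<in> H" "h' \<in> H" "x = a \<otimes> h" "y = a \<otimes> h'"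
      using xy unfolding P_def Int_iff mem_l_coset by blast
    have c: "a \<in> carrier G" "h \<in> carrier G" "h' \<in> carrier G" using h xy Ac Hc by auto
    have "x \<otimes> inv y = (a \<otimes> inv a) \<otimes> (h \<otimes> inv h')"
      unfolding h inv_mult[OF c(1,3)] using c by (simp only: m_ac m_closed inv_closed)
    then have "x \<otimes> inv y = h \<otimes> inv h'" using c by simp
    then show ?thesis using h H subgroup.m_closed subgroup.m_inv_closed by metis
  qed
  have aHA: "a <# H \<subseteq> H <#> A" if "a \<in> A" for a
    using l_coset_subset_set_mult[OF that, of H] set_mult_commute[of A H] Ac Hc by simp
  have AHA: "A \<subseteq> H <#> A" using subset_set_mult_left Ac subgroup.one_closed[OF H(1)] by blast
  have disj: "(a <# H) \<inter> (b <# H) = {}" if "a \<in> A" "b \<in> A" "b \<notin> a <# H" for a b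
    using l_coset_subgroup_disjoint[OF H(1) _ _ that(3)] that Ac by auto
  have cP: "card (a <# H) = card H" if "a \<in> A" for a using that Ac Hc by auto
  obtain b where b: "b \<in> A" "b \<notin> H" using H by blast
  have b1: "b \<notin> \<one> <# H" using b Hc by simp
  let ?U = "(\<one> <# H) \<union> (b <# H)"
  have d1: "(\<one> <# H) \<inter> (b <# H) = {}" using disj b1 b Ac by blast
  have cU: "card ?U = 2 * card H"
    using card_Un_disjoint[OF _ _ d1] cP[of b] cP[of \<one>] b Ac H by simp
  have cPP: "card (A \<inter> ?U) = card (P \<one>) + card (P b)"
    unfolding P_def Int_Un_distrib by (rule card_Un_disjoint) (use Ac d1 in auto)
  have q: "card (P \<one>) * (card (P \<one>) - 1) + card (P b) * (card (P b) - 1) + 1 \<le> card H"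
    by (rule thin_subgroup_card[OF Ac(1,2) A(2) H(1,2)]) (use d1 PH Ac b in \<open>auto simp: P_def\<close>)
  have m1: "1 \<le> card (P a)" if "a \<in> A" for a
  proof -
    have "a \<in> P a" using mem_own_l_coset[OF H(1)] that Ac by (auto simp: P_def)
    then show ?thesis using Ac by (auto simp: P_def Suc_le_eq card_gt_0_iff)
  qed
  have lbY: "card Y + card (A - Y) \<le> card (H <#> A)" if "Y \<subseteq> H <#> A" for Y
  proof -
    have "finite Y" using that H Ac finite_subset finite_set_mult by blast
    then have "card Y + card (A - Y) = card (Y \<union> (A - Y))"
      using Ac by (intro card_Un_disjoint[symmetric]) auto
    also have "\<dots> \<le> card (H <#> A)" using that AHA H Ac by (intro card_mono) auto
    finally show ?thesis .
  qed
  have lb: "card ?U + card (A - ?U) \<le> card (H <#> A)" using lbY aHA b Ac by simp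
  have cA: "card A = card (A \<inter> ?U) + card (A - ?U)"
    using Ac by (metis card_Int_Diff)
  show "card H + card A \<le> card (H <#> A) + 1"
    using quadratic_aux(1)[OF q] lb cA cU cPP by linarith
  show "card H + card A \<le> card (H <#> A)" if "2 \<le> card H"
    using quadratic_aux(2)[OF q that] lb cA cU cPP by linarith
  show "card H + card A + 1 \<le> card (H <#> A)" if h2: "2 \<le> card H" and a4: "4 \<le> card A"
  proof (cases "A \<subseteq> ?U")
    case True
    then have "card A = card (P \<one>) + card (P b)" using cPP by (simp add: Int_absorb2)
    then show ?thesis
      using quadratic_aux(3)[OF q] m1[OF b(1)] m1[OF Ac(3)] a4 lb cA cU by linarith
  next
    case False
    then obtain d where d: "d \<in> A" "d \<notin> ?U" by blast
    have d2: "?U \<inter> (d <# H) = {}" using disj d b Ac by blast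
    have "P d \<subseteq> A" by (auto simp: P_def)
    then have "card (P d) * (card (P d) - 1) + 1 \<le> card H"
      using thin_subgroup_card[OF Ac(1,2) A(2) H(1,2), of "P d" "{}"] PH[OF _ _ d(1)] by simp
    \<comment> \<open>The trivial second summand brings the estimate into the two-piece form with n
      = 1, so that \<open>quadratic_aux(2)\<close> yields the extra 1.\<close>
    then have "card (P d) * (card (P d) - 1) + 1 * ((1::nat) - 1) + 1 \<le> card H" by simp
    then have pd: "card (P d) + 1 \<le> card H" using quadratic_aux(2) h2 by blast
    let ?V = "?U \<union> (d <# H)"
    have cV: "card ?V = 3 * card H"
      using card_Un_disjoint[OF _ _ d2] cU cP[OF d(1)] H by simp
    have "card (A \<inter> ?V) = card (A \<inter> ?U) + card (P d)"
      unfolding P_def Int_Un_distrib[of A ?U] by (rule card_Un_disjoint) (use Ac d2 in auto)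
    moreover have "card A = card (A \<inter> ?V) + card (A - ?V)" using Ac by (metis card_Int_Diff)
    moreover have "card ?V + card (A - ?V) \<le> card (H <#> A)" using lbY aHA b d Ac by simp
    ultimately show ?thesis using quadratic_aux(2)[OF q h2] cPP cV pd by linarith
  qed
qed

section \<open>Unions of translates of thin sets\<close>

lemma thin_inter:
  assumes "A \<subseteq> carrier G" "finite A" "thin t A" "x \<in> carrier G" "y \<in> carrier G" "x \<noteq> y"
  shows "card ((x <# A) \<inter> (y <# A)) \<le> t"
proof -
  have g: "inv x \<otimes> y \<in> carrier G" using assms by simp
  have "inv x \<otimes> y \<noteq> \<one>" using assms by (metis inv_equality inv_inv inv_closed m_comm)
  then have "card (A \<inter> ((inv x \<otimes> y) <# A)) \<le> t" using assms g by (simp add: thin_def)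
  moreover have "(x <# A) \<inter> (y <# A) = x <# (A \<inter> ((inv x \<otimes> y) <# A))"
    using assms by (simp add: l_coset_Int l_coset_l_coset m_assoc[symmetric])
  moreover have "card (x <# (A \<inter> ((inv x \<otimes> y) <# A))) = card (A \<inter> ((inv x \<otimes> y) <# A))"
    by (rule card_l_coset) (use assms in auto)
  ultimately show ?thesis by simp
qed

lemma two_translates:
  assumes A: "A \<subseteq> carrier G" "finite A" "thin t A" and Y: "Y \<subseteq> carrier G" "finite Y" "2 \<le> card Y"
  shows "2 * card A \<le> card (Y <#> A) + t"
proof -
  obtain T where T: "T \<subseteq> Y" "card T = 2" using obtain_subset_with_card_n[OF Y(3)] by metis
  then obtain x y where xy: "T = {x, y}" "x \<noteq> y" by (meson card_2_iff)
  then have c: "x \<in> carrier G" "y \<in> carrier G" using T Y by auto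
  have "card ((x <# A) \<union> (y <# A)) \<le> card (Y <#> A)"
    using T xy Y A by (intro card_mono) (auto intro: subsetD[OF l_coset_subset_set_mult])
  moreover have "card (x <# A) + card (y <# A) = card ((x <# A) \<union> (y <# A)) + card ((x <# A) \<inter> (y <# A))"
    using A by (intro card_Un_Int) auto
  ultimately show ?thesis using thin_inter[OF A c xy(2)] c A by simp
qed

text \<open>Bonferroni: each of the three pairs of translates shares at most t points, and triple
  intersections only help.\<close>

lemma three_translates:
  assumes A: "A \<subseteq> carrier G" "finite A" "thin t A" and Y: "Y \<subseteq> carrier G" "finite Y" "3 \<le> card Y"
  shows "3 * card A \<le> card (Y <#> A) + 3 * t"
proof -
  obtain T where T: "T \<subseteq> Y" "card T = 3" using obtain_subset_with_card_n[OF Y(3)] by metis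
  then obtain x y z where xy: "T = {x, y, z}" "x \<noteq> y" "x \<noteq> z" "y \<noteq> z"
    by (metis card_3_iff)
  then have c: "x \<in> carrier G" "y \<in> carrier G" "z \<in> carrier G" using T Y by auto
  let ?U = "(x <# A) \<union> (y <# A)"
  have "card (?U \<union> (z <# A)) \<le> card (Y <#> A)"
    using T xy Y A by (intro card_mono) (auto intro: subsetD[OF l_coset_subset_set_mult])
  moreover have "card (x <# A) + card (y <# A) = card ?U + card ((x <# A) \<inter> (y <# A))"
    using A by (intro card_Un_Int) auto
  moreover have "card ?U + card (z <# A) = card (?U \<union> (z <# A)) + card (?U \<inter> (z <# A))"
    using A by (intro card_Un_Int) auto
  moreover have "card (?U \<inter> (z <# A)) \<le> card ((x <# A) \<inter> (z <# A)) + card ((y <# A) \<inter> (z <# A))"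
    unfolding Int_Un_distrib2 by (rule card_Un_le)
  ultimately show ?thesis
    using thin_inter[OF A c(1,2) xy(2)] thin_inter[OF A c(1,3) xy(3)] thin_inter[OF A c(2,3) xy(4)] c A
    by simp
qed

text \<open>A is compared with its own 2-atom N. The parameter e covers both uses: e = 1 for
  \<open>kappa\<close> below |S|, giving |A| <= 2, and e = 0 for equality, giving |A| <= 3. A
  subgroup N contradicts the coset bounds; otherwise N is thin too, and |N| = 2 is settled by two
  translates.\<close>

lemma thin_card_le_3:
  assumes A: "based A" "thin 1 A" "generate G A = carrier G"
    and X: "k_separating G 2 A X" "card (X <#> A) + e \<le> card X + card A" and e: "e \<le> 1"
  shows "card A + e \<le> 3"
proof (rule ccontr)
  assume *: "\<not> card A + e \<le> 3"
  have Ac: "A \<subseteq> carrier G" "finite A" "\<one> \<in> A" using A by (auto simp: based_def)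
  obtain N where N: "atom 2 A N" "\<one> \<in> N" using atom_exists[OF A(1) X(1)] by auto
  have Nf: "fragment G 2 A N" using N by (simp add: atom_def)
  have Nc: "N \<subseteq> carrier G" "finite N" "2 \<le> card N" "large 2 (exterior G A N)"
    using Nf by (auto simp: fragment_def k_separating_iff)
  have "card (N <#> A) = card N + kappa G 2 A" using Nf A(1) fragment_iff by blast
  then have le: "card (N <#> A) + e \<le> card N + card A" using kappa_le[OF A(1) X(1)] X(2) by linarith
  show False
  proof (cases "subgroup N G")
    case True
    have "\<not> A \<subseteq> N"
    proof
      assume "A \<subseteq> N"
      then have "N = carrier G" using subgroup_eq_carrier True A by blast
      then have "exterior G A N = {}" using subset_set_mult[OF Ac(3) Nc(1)] by (auto simp: exterior_def)
      then show False using Nc by (simp add: large_def)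
    qed
    note t = thin_set_mult_subgroup(2,3)[OF A(1,2) True Nc(2) this Nc(3)]
    show False
    proof (cases "e = 0")
      case True
      then show False using t(2) le * by linarith
    next
      case False
      then show False using t(1) le by linarith
    qed
  next
    case False
    then have tN: "thin 1 N" using two_atom_thin A N by blast
    have NA: "card (N <#> A) = card (A <#> N)" using set_mult_commute[OF Nc(1) Ac(1)] by simp
    have cA: "3 \<le> card A" using * e by linarith
    show False
    proof (cases "3 \<le> card N")
      case True
      \<comment> \<open>Adding both estimates gives |A| + |N| + 2e <= 6, whereas |A| + e >= 4 and
        |N| >= 3.\<close>
      then show False
        using three_translates[OF Ac(1,2) A(2) Nc(1,2) True] three_translates[OF Nc(1,2) tN Ac(1,2) cA]
          le NA * e by linarith
    next
      case False
      then show False using two_translates[OF Ac(1,2) A(2) Nc(1,2,3)] Nc le * by linarith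
    qed
  qed
qed


subsection \<open>Progressions\<close>

lemma card_Un_l_coset:
  assumes "r \<in> carrier G" "X \<subseteq> carrier G" "finite X"
  shows "card (X \<union> (r <# X)) = card X + card ((r <# X) - X)"
    and "card (X - (r <# X)) = card ((r <# X) - X)"
proof -
  have "card (X \<union> ((r <# X) - X)) = card X + card ((r <# X) - X)"
    by (rule card_Un_disjoint) (use assms in auto)
  then show 1: "card (X \<union> (r <# X)) = card X + card ((r <# X) - X)" by simp
  have "card ((r <# X) \<union> (X - (r <# X))) = card (r <# X) + card (X - (r <# X))"
    by (rule card_Un_disjoint) (use assms in auto)
  then have "card (X \<union> (r <# X)) = card X + card (X - (r <# X))" using assms by (simp add: Un_commute)
  then show "card (X - (r <# X)) = card ((r <# X) - X)" using 1 by simp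
qed

lemma closed_under_generator:
  assumes "r \<in> carrier G" "generate G {r} = carrier G" "Y \<subseteq> carrier G" "finite Y" "Y \<noteq> {}"
    and "r <# Y \<subseteq> Y"
  shows "Y = carrier G"
  by (rule closed_eq_carrier[OF assms(3-5) _ assms(2)]) (use assms in auto)

text \<open>Start at a point x of X outside rX and multiply by r until X is left. The exit point
  uses up the only element of rX outside X, so what remains of X is closed under the generator r and
  therefore empty.\<close>

lemma progression_of_boundary:
  assumes r: "r \<in> carrier G" "generate G {r} = carrier G"
    and X: "X \<subseteq> carrier G" "finite X" "X \<noteq> {}" "X \<noteq> carrier G"
    and b: "card (X \<union> (r <# X)) \<le> card X + 1"
  obtains a where "a \<in> carrier G" "inj_on (\<lambda>i::nat. a \<otimes> r [^] i) {..<card X}"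
    "X = (\<lambda>i. a \<otimes> r [^] i) ` {..<card X}"
proof -
  have "\<not> X \<subseteq> r <# X"
    using subset_l_coset_eq[OF r(1) X(1,2)] closed_under_generator[OF r X(1-3)] X(4) by auto
  then obtain x where x: "x \<in> X" "x \<notin> r <# X" by blast
  have xc: "x \<in> carrier G" using x X by blast
  define f where "f i = x \<otimes> r [^] i" for i :: nat
  have f0: "f 0 = x" using xc by (simp add: f_def)
  have fS: "r \<otimes> f i = f (Suc i)" for i using xc r by (simp add: f_def m_ac)
  have fc: "f i \<in> carrier G" for i using xc r by (simp add: f_def)
  have per: "f (j - i) = x" if "i < j" "f i = f j" for i j
  proof -
    have "r [^] j = r [^] (j - i) \<otimes> r [^] i" using that r by (simp add: nat_pow_mult)
    then have "x \<otimes> r [^] i = f (j - i) \<otimes> r [^] i"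
      using that(2) xc r by (simp add: f_def m_assoc)
    then show ?thesis using xc r fc by simp
  qed
  \<comment> \<open>A repetition among the terms would return to the starting point x, whose
    predecessor would then lie in X, although x is outside rX.\<close>
  have inX: False if "i < j" "f i = f j" "f (j - i - 1) \<in> X" for i j
  proof -
    have "r \<otimes> f (j - i - 1) = x" using per[OF that(1,2)] fS[of "j - i - 1"] Suc_diff_Suc[OF that(1)] by simp
    then show False using x(2) that(3) by (auto simp: mem_l_coset)
  qed
  have "\<exists>m. f m \<notin> X"
  proof (rule ccontr)
    assume "\<nexists>m. f m \<notin> X"
    then have *: "f i \<in> X" for i by blast
    then have "finite (range f)" using X by (meson finite_subset image_subsetI)
    then have "\<not> inj f" using finite_imageD infinite_UNIV_nat by blast
    then obtain i j where "i < j" "f i = f j" by (metis injI linorder_neqE_nat)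
    then show False using inX * by blast
  qed
  define m where "m = (LEAST m. f m \<notin> X)"
  have mX: "f m \<notin> X" unfolding m_def by (rule LeastI_ex) fact
  have less: "f i \<in> X" if "i < m" for i using not_less_Least that unfolding m_def by blast
  obtain k where k: "m = Suc k" using mX f0 x by (cases m) auto
  have inj: "inj_on f {..<m}"
  proof (rule linorder_inj_onI)
    fix i j assume "i < j" "i \<in> {..<m}" "j \<in> {..<m}"
    then show "f i \<noteq> f j" using inX[of i j] less[of "j - i - 1"] by force
  qed (simp add: linear)
  define P where "P = f ` {..<m}"
  have PX: "P \<subseteq> X" using less by (auto simp: P_def)
  have "card ((r <# X) - X) \<le> 1" using card_Un_l_coset(1)[OF r(1) X(1,2)] b by linarith
  moreover have fm: "f m \<in> (r <# X) - X" using l_cosetI[of "f k" X G r] fS[of k] less[of k] mX k by simp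
  ultimately have uniq: "y = f m" if "y \<in> (r <# X) - X" for y
    using that X r by (auto simp: card_le_Suc0_iff_eq)
  have "r <# (X - P) \<subseteq> X - P"
  proof
    fix z assume "z \<in> r <# (X - P)"
    then obtain y where y: "y \<in> X" "y \<notin> P" "z = r \<otimes> y" by (auto simp: mem_l_coset)
    have yc: "y \<in> carrier G" using y X by blast
    have zr: "z \<in> r <# X" using y by (auto simp: mem_l_coset)
    have "z \<in> X"
    proof (rule ccontr)
      assume "z \<notin> X"
      then have "r \<otimes> y = r \<otimes> f k" using uniq zr y fS[of k] k by simp
      then have "y = f k" using yc fc r by simp
      then show False using y k by (auto simp: P_def)
    qed
    moreover have "z \<notin> P"
    proof
      assume "z \<in> P"
      then obtain i where i: "i < m" "z = f i" by (auto simp: P_def)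
      show False
      proof (cases i)
        case 0 then show False using i f0 x zr by simp
      next
        case (Suc j)
        then have "r \<otimes> y = r \<otimes> f j" using i y fS by simp
        then have "y = f j" using yc fc r by simp
        then show False using y i Suc by (auto simp: P_def)
      qed
    qed
    ultimately show "z \<in> X - P" by blast
  qed
  then have "X - P = {}"
    using closed_under_generator[OF r, of "X - P"] X by blast
  then have XP: "X = f ` {..<m}" using PX by (auto simp: P_def)
  then have "card X = m" using card_image[OF inj] by simp
  then show thesis using that[OF xc] inj XP unfolding f_def by simp
qed

lemma progression_exit:
  assumes r: "r \<in> carrier G" and a: "a \<in> carrier G" "U = (\<lambda>i::nat. a \<otimes> r [^] i) ` {..<n}"
    and U: "\<not> r <# U \<subseteq> U"
  shows "a \<otimes> r [^] n \<notin> U"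
proof
  let ?f = "\<lambda>i::nat. a \<otimes> r [^] i"
  assume n: "?f n \<in> U"
  have "r <# U \<subseteq> U"
  proof
    fix z assume "z \<in> r <# U"
    then obtain u where u: "u \<in> U" "z = r \<otimes> u" by (auto simp: mem_l_coset)
    then obtain i where i: "i < n" "z = r \<otimes> ?f i" using a(2) by blast
    then have "z = ?f (Suc i)" using a r by (simp add: m_ac)
    then show "z \<in> U" using n i a(2) by (metis Suc_lessI imageI lessThan_iff)
  qed
  then show False using U by blast
qed

lemma rj_progression_subset:
  assumes "a \<in> carrier G" "S \<subseteq> (\<lambda>i::nat. a \<otimes> r [^] i) ` {..<m}"
    and "card ((\<lambda>i::nat. a \<otimes> r [^] i) ` {..<m}) = card S + 1"
  shows "rj_progression G r (-1) S"
proof -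
  let ?P = "(\<lambda>i::nat. a \<otimes> r [^] i) ` {..<m}"
  have "arith_progression G r ?P" using assms(1) by (auto simp: arith_progression_def)
  moreover have "card (?P - S) = 1"
    using assms by (simp add: card_Diff_subset finite_subset)
  moreover have "S = ?P - (?P - S)" using assms by blast
  ultimately show ?thesis unfolding rj_progression_def by (intro exI[of _ ?P] exI[of _ "?P - S"]) auto
qed

text \<open>Append the next term, which is new because S is not closed under r, and count it as the
  deleted one.\<close>

lemma rj_progression_of_progression:
  assumes r: "r \<in> carrier G" "generate G {r} = carrier G"
    and S: "finite S" "S \<noteq> {}" "S \<noteq> carrier G"
    and a: "a \<in> carrier G" "S = (\<lambda>i::nat. a \<otimes> r [^] i) ` {..<n}"
  shows "rj_progression G r (-1) S"
proof -
  let ?f = "\<lambda>i::nat. a \<otimes> r [^] i"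
  have Sc: "S \<subseteq> carrier G" using a r by auto
  have "\<not> r <# S \<subseteq> S" using closed_under_generator[OF r Sc S(1,2)] S by blast
  then have "?f n \<notin> S" using progression_exit[OF r(1) a] by blast
  then have "card (?f ` {..<Suc n}) = card S + 1"
    using S a by (simp add: lessThan_Suc)
  then show ?thesis using rj_progression_subset[OF a(1), of S r "Suc n"] a by (auto simp: lessThan_Suc)
qed

lemma exterior_commute:
  "A \<subseteq> carrier G \<Longrightarrow> S \<subseteq> carrier G \<Longrightarrow> exterior G S A = exterior G A S"
  by (simp add: exterior_def set_mult_commute)

lemma generate_insert_one:
  assumes "r \<in> carrier G" "generate G {\<one>, r} = carrier G"
  shows "generate G {r} = carrier G"
proof -
  have s: "subgroup (generate G {r}) G" using assms by (intro generate_is_subgroup) auto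
  have "r \<in> generate G {r}" by (rule generate.incl) simp
  then have "{\<one>, r} \<subseteq> generate G {r}" using subgroup.one_closed[OF s] by auto
  then show ?thesis using subgroup_eq_carrier[OF s] assms(2) by blast
qed

lemma exterior_ne_carrier:
  assumes "based S" "k_separating G k S X" "0 < k"
  shows "X <#> S \<noteq> carrier G"
  using assms by (auto simp: k_separating_iff exterior_def large_def)

lemma subset_ne_carrier:
  assumes "A \<subseteq> carrier G" "B \<subseteq> carrier G" "A <#> B \<noteq> carrier G" "B \<noteq> {}"
  shows "A \<noteq> carrier G"
proof
  assume "A = carrier G"
  then have "carrier G <#> B \<noteq> carrier G" using assms by simp
  then show False using subgroup_set_mult[OF subgroup_self assms(2,4)] by simp
qed

lemma thin_atom_generates:
  assumes S: "based S" "generate G S = carrier G" "\<not> degenerate G S"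
    and A: "fragment G 2 S A" "based A" "thin 1 A \<or> card A = 3"
    and small: "kappa G 2 S + 2 < card A + card S"
    and big: "finite (carrier G) \<Longrightarrow> 2 * kappa G 2 S < card (carrier G)"
  shows "generate G A = carrier G"
proof (rule generate_fragment_eq_carrier[OF S A(1,2) _ small big])
  fix X assume X: "X \<subseteq> generate G A" "finite X" "X \<noteq> {}" "X <#> A \<noteq> generate G A"
  have cA: "2 \<le> card A" using A by (simp add: fragment_def k_separating_def)
  have Ac: "A \<subseteq> carrier G" "finite A" "\<one> \<in> A" using A by (auto simp: based_def)
  have "card X + (card A - 1) \<le> card (X <#> A)"
  proof (rule card_set_mult_ge_of_subgroups_within[OF A(2) refl _ X])
    fix H assume H: "subgroup H G" "finite H" "\<not> A \<subseteq> H"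
    show "card H + (card A - 1) \<le> card (H <#> A)"
      using A(3)
    proof
      assume "thin 1 A"
      then show ?thesis using thin_set_mult_subgroup(1)[OF A(2) _ H] cA by linarith
    next
      assume c3: "card A = 3"
      have Hc: "H \<subseteq> carrier G" using H subgroup.subset by blast
      obtain b where b: "b \<in> A" "b \<notin> H" using H by blast
      have bc: "b \<in> carrier G" using b Ac by blast
      have sub: "H \<union> (b <# H) \<subseteq> H <#> A"
        using l_coset_subset_set_mult[OF b(1), of H] l_coset_subset_set_mult[OF Ac(3), of H]
          set_mult_commute[OF Hc Ac(1)] Hc by simp
      have "H \<inter> (b <# H) = {}"
        using l_coset_subgroup_disjoint[OF H(1) one_closed bc] b Hc by simp
      then have "card (H \<union> (b <# H)) = 2 * card H" using H Hc bc by (simp add: card_Un_disjoint)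
      \<comment> \<open>Two cosets suffice when |H| >= 2; the bound |HA| >= 3 below is for trivial
        H.\<close>
      then have 1: "2 * card H \<le> card (H <#> A)"
        using card_mono[OF _ sub] H Ac by simp
      have AHA: "A \<subseteq> H <#> A" using subset_set_mult_left Ac subgroup.one_closed[OF H(1)] by blast
      then have "3 \<le> card (H <#> A)" using card_mono[OF _ AHA] c3 H Ac by simp
      moreover have "0 < card H" using H subgroup.one_closed[OF H(1)] by (auto simp: card_gt_0_iff)
      ultimately show ?thesis using 1 c3 by linarith
    qed
  qed
  then show "card X + card A \<le> card (X <#> A) + 1" using cA by linarith
qed auto

text \<open>S is a 2-separating set of its own 2-atom M, with deficit e = 1. Thus M = {1, r} with r
  a generator, and |S Un rS| <= |S| + 1.\<close>

theorem progression_of_kappa_2: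
  assumes S: "based S" "generate G S = carrier G" "\<not> degenerate G S"
    and X: "k_separating G 2 S X" and k: "kappa G 2 S + 1 \<le> card S" and c: "2 \<le> card S"
    and big: "finite (carrier G) \<Longrightarrow> 2 * kappa G 2 S < card (carrier G)"
  obtains r a where "r \<in> carrier G" "generate G {r} = carrier G" "a \<in> carrier G"
    "inj_on (\<lambda>i::nat. a \<otimes> r [^] i) {..<card S}" "S = (\<lambda>i. a \<otimes> r [^] i) ` {..<card S}"
proof -
  have Sc: "S \<subseteq> carrier G" "finite S" "\<one> \<in> S" using S by (auto simp: based_def)
  obtain M where M: "atom 2 S M" "\<one> \<in> M" using atom_exists[OF S(1) X] by auto
  have Mf: "fragment G 2 S M" using M by (simp add: atom_def)
  have Mc: "M \<subseteq> carrier G" "finite M" "2 \<le> card M" "large 2 (exterior G S M)"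
    using Mf by (auto simp: fragment_def k_separating_iff)
  have bM: "based M" using Mc M by (simp add: based_def)
  have tM: "thin 1 M" using two_atom_thin'[OF S(1) M S(3)] .
  have gM: "generate G M = carrier G"
    by (rule thin_atom_generates[OF S Mf bM]) (use tM k Mc big in auto)
  have MS: "card (M <#> S) = card M + kappa G 2 S" using Mf S fragment_iff by blast
  have sS: "k_separating G 2 M S"
    using Mc Sc c exterior_commute[OF Mc(1) Sc(1)] by (simp add: k_separating_iff)
  have "card M + 1 \<le> 3"
    by (rule thin_card_le_3[OF bM tM gM sS]) (use MS k set_mult_commute[OF Mc(1) Sc(1)] in auto)
  then have c2: "card M = 2" using Mc by linarith
  then obtain r where r: "M = {\<one>, r}" "r \<noteq> \<one>" using M(2)
    by (metis card_2_iff doubleton_eq_iff insertE singletonD)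
  have rc: "r \<in> carrier G" using r Mc by auto
  have gr: "generate G {r} = carrier G" using generate_insert_one rc gM r by simp
  have "M <#> S = S \<union> (r <# S)" using r Sc by (simp add: set_mult_insert_left)
  then have b: "card (S \<union> (r <# S)) \<le> card S + 1" using MS c2 k by simp
  have "S \<noteq> carrier G"
    using subset_ne_carrier[OF Sc(1) Mc(1)] exterior_ne_carrier[OF bM sS] M by auto
  then show thesis
    using progression_of_boundary[OF rc gr Sc(1,2) _ _ b] that[OF rc gr] Sc by blast
qed

text \<open>U = S Un rS has |S| + 2 elements and gains only one more under r, so U is a progression.
  No point of S is its last term, since its successor is again in U; thus S misses one of the first
  |S| + 1 terms.\<close>

lemma rj_progression_step_step:
  assumes r: "r \<in> carrier G" "generate G {r} = carrier G" and S: "S \<subseteq> carrier G" "finite S" "S \<noteq> {}"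
    and le: "card (S \<union> (r <# S) \<union> (r <# (r <# S))) \<le> card S + 3"
    and ge: "card S + 2 \<le> card (S \<union> (r <# S))"
    and big: "finite (carrier G) \<Longrightarrow> card S + 4 \<le> card (carrier G)"
  shows "rj_progression G r (-1) S"
proof -
  define U where "U = S \<union> (r <# S)"
  have U: "U \<subseteq> carrier G" "finite U" "U \<noteq> {}" using S r by (auto simp: U_def)
  have UU: "U \<union> (r <# U) = S \<union> (r <# S) \<union> (r <# (r <# S))" by (auto simp: U_def l_coset_Un)
  have cU: "card U \<le> card (U \<union> (r <# U))" using U r by (intro card_mono) auto
  have Un: "U \<noteq> carrier G" using big U UU cU le by auto
  have "\<not> r <# U \<subseteq> U" using closed_under_generator[OF r U] Un by blast
  then have "card U < card (U \<union> (r <# U))" using U r by (intro psubset_card_mono) auto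
  then have cU2: "card U = card S + 2" using le UU ge by (simp add: U_def)
  have "card (U \<union> (r <# U)) \<le> card U + 1" using le UU cU2 by simp
  from progression_of_boundary[OF r U Un this] obtain a where
    a: "a \<in> carrier G" "inj_on (\<lambda>i::nat. a \<otimes> r [^] i) {..<card U}" "U = (\<lambda>i. a \<otimes> r [^] i) ` {..<card U}"
    by blast
  let ?f = "\<lambda>i::nat. a \<otimes> r [^] i"
  have last: "?f (card U) \<notin> U" using progression_exit[OF r(1) a(1,3) \<open>\<not> r <# U \<subseteq> U\<close>] .
  have "S \<subseteq> ?f ` {..<card S + 1}"
  proof
    fix x assume x: "x \<in> S"
    then have "x \<in> U" by (simp add: U_def)
    then have "x \<in> ?f ` {..<card U}" using a(3) by simp
    then obtain i where i: "i < card U" "x = ?f i" by blast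
    have "r \<otimes> x \<in> U" using x by (auto simp: U_def mem_l_coset)
    then have "?f (Suc i) \<in> U" using i a r by (simp add: m_ac)
    then have "Suc i \<noteq> card U" using last by metis
    then show "x \<in> ?f ` {..<card S + 1}" using i cU2 by auto
  qed
  moreover have "card (?f ` {..<card S + 1}) = card S + 1"
    using card_image[OF inj_on_subset[OF a(2)], of "{..<card S + 1}"] cU2 by simp
  ultimately show ?thesis using rj_progression_subset a by blast
qed

text \<open>With U = S Un rS, the set r^3 S contributes a single point w outside U. Hence V = S Un
  rS Un r^2 S gains at most w under r and is a progression. Points of S have two successors in V, so
  S avoids its last two terms.\<close>

lemma rj_progression_step_triple:
  assumes r: "r \<in> carrier G" "generate G {r} = carrier G" and S: "S \<subseteq> carrier G" "finite S" "3 \<le> card S"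
    and le: "card (S \<union> (r <# S) \<union> (r <# (r <# (r <# S)))) \<le> card S + 3"
    and ge: "card S + 2 \<le> card (S \<union> (r <# S))"
    and big: "finite (carrier G) \<Longrightarrow> card S + 7 \<le> card (carrier G)"
  shows "rj_progression G r (-1) S"
proof -
  define S1 where "S1 = r <# S"
  define S2 where "S2 = r <# S1"
  define S3 where "S3 = r <# S2"
  have c: "S1 \<subseteq> carrier G" "S2 \<subseteq> carrier G" "S3 \<subseteq> carrier G" "finite S1" "finite S2" "finite S3"
    using S r by (auto simp: S1_def S2_def S3_def)
  define U where "U = S \<union> S1"
  define E where "E = S1 - S"
  define W where "W = U \<union> S3"
  define V where "V = U \<union> S2"
  have rS: "r \<otimes> x \<in> S1" if "x \<in> S" for x using that by (auto simp: S1_def mem_l_coset)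
  have rS1: "r \<otimes> x \<in> S2" if "x \<in> S1" for x using that by (auto simp: S2_def mem_l_coset)
  have rS2: "r \<otimes> x \<in> S3" if "x \<in> S2" for x using that by (auto simp: S3_def mem_l_coset)
  have fin: "finite U" "finite E" "finite W" "finite V" using S c by (auto simp: U_def E_def W_def V_def)
  have cc: "U \<subseteq> carrier G" "E \<subseteq> carrier G" "W \<subseteq> carrier G" "V \<subseteq> carrier G"
    using S c by (auto simp: U_def E_def W_def V_def)
  have Sne: "S \<noteq> {}" using S by auto
  have ne: "U \<noteq> {}" "V \<noteq> {}" using Sne by (auto simp: U_def V_def)
  have cU: "card U = card S + card E"
    using card_Un_l_coset(1)[OF r(1) S(1,2)] by (simp add: U_def E_def S1_def)
  have leW: "card W \<le> card S + 3" using le by (simp add: W_def U_def S1_def S2_def S3_def)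
  have cUW: "card U \<le> card W" using fin by (intro card_mono) (auto simp: W_def)
  have VU: "V - U \<subseteq> r <# E"
  proof
    fix z assume z: "z \<in> V - U"
    then obtain x where x: "x \<in> S1" "z = r \<otimes> x" by (auto simp: V_def S2_def mem_l_coset)
    then have "x \<notin> S" using rS z by (auto simp: U_def)
    then show "z \<in> r <# E" using x by (auto simp: E_def mem_l_coset)
  qed
  have crE: "card (r <# E) = card E" using r cc by simp
  have cVU: "card V = card U + card (V - U)"
    using fin by (metis V_def card_Diff_subset card_mono le_add_diff_inverse sup_ge1)
  have "card (V - U) \<le> card E" using card_mono[OF _ VU] fin crE by simp
  then have cV: "card V \<le> card U + card E" using cVU by linarith
  \<comment> \<open>The crude bound |V| <= |U| + |E| with |E| = |U| - |S| <= 3 is the origin of the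
    7 in \<open>big\<close>.\<close>
  have Vn: "V \<noteq> carrier G" if "card V \<le> card S + 6" using big fin(4) that by auto
  have Vn6: "card V \<le> card S + 6" using cV cU leW cUW by linarith
  note VnG = Vn[OF Vn6]
  have UnG: "U \<noteq> carrier G" using VnG cc by (auto simp: V_def)
  have rU: "r <# U = S1 \<union> S2" by (simp add: U_def l_coset_Un S1_def S2_def)
  have rV: "r <# V = S1 \<union> S2 \<union> S3" by (simp add: V_def l_coset_Un rU S3_def)
  have VV: "V \<union> (r <# V) = V \<union> S3" unfolding rV by (auto simp: V_def U_def)
  have nV: "\<not> r <# V \<subseteq> V" using closed_under_generator[OF r cc(4) fin(4) ne(2)] VnG by blast
  then have nS3: "\<not> S3 \<subseteq> V" unfolding rV by (auto simp: V_def U_def)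
  have nU: "\<not> r <# U \<subseteq> U" using closed_under_generator[OF r cc(1) fin(1) ne(1)] UnG by blast
  have "W \<noteq> U" using nS3 by (auto simp: W_def V_def)
  then have "card U < card W" using fin by (intro psubset_card_mono) (auto simp: W_def)
  then have cU2: "card U = card S + 2" and cW: "card W = card U + 1"
    using leW ge by (auto simp: U_def S1_def)
  have cE: "card E = 2" using cU cU2 by simp
  have "card (W - U) = 1"
    using cW fin by (simp add: W_def card_Diff_subset)
  then obtain w where w: "W - U = {w}" by (auto simp: card_1_singleton_iff)
  have S3w: "S3 \<subseteq> U \<union> {w}" using w unfolding W_def by blast
  moreover have "U \<subseteq> V" by (simp add: V_def)
  ultimately have "V \<union> (r <# V) \<subseteq> V \<union> {w}" unfolding VV by blast
  then have "card (V \<union> (r <# V)) \<le> card (V \<union> {w})" using fin by (intro card_mono) auto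
  also have "\<dots> \<le> card V + 1" using card_Un_le[of V "{w}"] by simp
  finally obtain a where
    a: "a \<in> carrier G" "inj_on (\<lambda>i::nat. a \<otimes> r [^] i) {..<card V}" "V = (\<lambda>i. a \<otimes> r [^] i) ` {..<card V}"
    using progression_of_boundary[OF r cc(4) fin(4) ne(2) VnG] by blast
  let ?f = "\<lambda>i::nat. a \<otimes> r [^] i"
  have fS: "r \<otimes> ?f i = ?f (Suc i)" for i using a r by (simp add: m_ac)
  have last: "?f (card V) \<notin> V" using progression_exit[OF r(1) a(1,3) nV] .
  have S_sub: "x \<in> ?f ` {..<card V - 2}" if x: "x \<in> S" for x
  proof -
    have "x \<in> V" using x by (simp add: V_def U_def)
    then have "x \<in> ?f ` {..<card V}" using a(3) by simp
    then obtain i where i: "i < card V" "x = ?f i" by blast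
    have "r \<otimes> x \<in> V" "r \<otimes> (r \<otimes> x) \<in> V" using rS rS1 x by (auto simp: V_def U_def)
    then have "?f (Suc i) \<in> V" "?f (Suc (Suc i)) \<in> V" using i fS by metis+
    then have "Suc i \<noteq> card V" "Suc (Suc i) \<noteq> card V" using last by metis+
    then show ?thesis using i by auto
  qed
  have "U \<noteq> V" using nU unfolding rU by (auto simp: V_def U_def)
  then have cV3: "card S + 3 \<le> card V"
    using cU2 psubset_card_mono[OF fin(4), of U] by (auto simp: V_def psubset_eq)
  \<comment> \<open>If |V| = |S| + 3, the first |V| - 2 terms contain S with one gap. The only other
    possibility is |V| = |S| + 4, which is refuted.\<close>
  show ?thesis
  proof (cases "card V = card S + 3")
    case True
    have "S \<subseteq> ?f ` {..<card S + 1}" using S_sub True by auto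
    moreover have "card (?f ` {..<card S + 1}) = card S + 1"
      using card_image[OF inj_on_subset[OF a(2)], of "{..<card S + 1}"] True by simp
    ultimately show ?thesis using rj_progression_subset a by blast
  next
    case False
    then have "card (V - U) = 2" using cV3 cV cU2 cE cVU by linarith
    then have VUE: "V - U = r <# E" using card_seteq[OF _ VU] crE cE fin by simp
    have rE: "r \<otimes> e \<notin> U" if "e \<in> E" for e
    proof -
      have "r \<otimes> e \<in> r <# E" using that by (auto simp: mem_l_coset)
      then show ?thesis using VUE by blast
    qed
    have rrE: "r \<otimes> (r \<otimes> e) \<in> U \<or> r \<otimes> (r \<otimes> e) = w" if "e \<in> E" for e
    proof -
      have "r \<otimes> (r \<otimes> e) \<in> S3" using that rS1 rS2 by (auto simp: E_def)
      then show ?thesis using S3w by blast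
    qed
    have Vw: "\<exists>e\<in>E. r \<otimes> (r \<otimes> e) = w"
    proof (rule ccontr)
      assume "\<not> ?thesis"
      then have *: "r \<otimes> (r \<otimes> e) \<in> U" if "e \<in> E" for e using rrE that by blast
      have "S3 \<subseteq> V"
      proof
        fix z assume "z \<in> S3"
        then obtain x where x: "x \<in> S" "z = r \<otimes> (r \<otimes> (r \<otimes> x))"
          by (auto simp: S1_def S2_def S3_def mem_l_coset)
        show "z \<in> V"
        proof (cases "r \<otimes> x \<in> S")
          case True then show ?thesis using x rS rS1 by (auto simp: V_def)
        next
          case False
          then have "r \<otimes> x \<in> E" using rS x by (auto simp: E_def)
          then show ?thesis using * x by (auto simp: V_def)
        qed
      qed
      then show False using nS3 by blast
    qed
    then obtain e' where e': "e' \<in> E" "r \<otimes> (r \<otimes> e') = w" by blast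
    \<comment> \<open>If g had a predecessor in S, then r^2 g would lie in r^3 S but not in U, hence
      equal w = r^2 e'; then rg = re' would be both inside and outside U. So a point of S whose
      successor leaves S is itself without predecessor in S.\<close>
    have F: "g \<notin> S1" if g: "g \<in> S" "r \<otimes> g \<in> E" for g
    proof
      assume "g \<in> S1"
      then have "r \<otimes> (r \<otimes> g) \<in> S3" using rS1 rS2 by blast
      then have "r \<otimes> (r \<otimes> g) = w" using rE[OF g(2)] S3w by blast
      then have "r \<otimes> (r \<otimes> g) = r \<otimes> (r \<otimes> e')" using e' by simp
      moreover have gc: "g \<in> carrier G" "e' \<in> carrier G" using g e' S cc by auto
      ultimately have "r \<otimes> g = r \<otimes> e'" using r by simp
      moreover have "r \<otimes> g \<in> U" using g rS by (auto simp: U_def)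
      ultimately show False using rE[OF e'(1)] by simp
    qed
    let ?F = "S - S1"
    have cF: "card ?F = 2" using card_Un_l_coset(2)[OF r(1) S(1,2)] cE by (simp add: S1_def E_def)
    have Fc: "?F \<subseteq> carrier G" using S by blast
    have "E \<subseteq> r <# ?F"
    proof
      fix e assume e: "e \<in> E"
      then obtain g where "g \<in> S" "e = r \<otimes> g" by (auto simp: E_def S1_def mem_l_coset)
      then show "e \<in> r <# ?F" using F e by (auto simp: mem_l_coset)
    qed
    moreover have "card (r <# ?F) = 2" using cF Fc r by simp
    ultimately have EF: "E = r <# ?F" using cE S by (intro card_subset_eq) auto
    have "r <# (S - ?F) \<subseteq> S - ?F"
    proof
      fix z assume "z \<in> r <# (S - ?F)"
      then obtain x where x: "x \<in> S" "x \<notin> ?F" "z = r \<otimes> x" by (auto simp: mem_l_coset)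
      then have "z \<in> S1" using rS by blast
      moreover have "z \<in> S"
      proof (rule ccontr)
        assume "z \<notin> S"
        then have "z \<in> r <# ?F" using EF \<open>z \<in> S1\<close> by (auto simp: E_def)
        then have "x \<in> ?F" using l_coset_mem_iff[OF r(1) Fc] x S by blast
        then show False using x by blast
      qed
      ultimately show "z \<in> S - ?F" by blast
    qed
    \<comment> \<open>The two isolated points \<open>?F\<close> do not exhaust S because |S| >= 3;
      the rest is closed under r.\<close>
    moreover have "S - ?F \<noteq> {}"
    proof
      assume "S - ?F = {}"
      then have "card S \<le> card ?F" using S by (intro card_mono) auto
      then show False using cF S by simp
    qed
    ultimately have "S - ?F = carrier G" using closed_under_generator[OF r, of "S - ?F"] S by blast
    then show ?thesis using UnG cc by (auto simp: U_def)
  qed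
qed


subsection \<open>The size of a 3-atom\<close>

text \<open>Removing a point leaves a separating set too small to be a fragment, so its excess is
  larger by at least one and the product cannot shrink. Consequently every element of AS has two
  representations.\<close>

lemma atom_redundant:
  assumes S: "based S" and A: "atom k S A" and z: "z \<in> A" and k: "k < card A"
  shows "(A - {z}) <#> S = A <#> S"
proof -
  have Sc: "S \<subseteq> carrier G" "finite S" using S by (auto simp: based_def)
  have Af: "fragment G k S A" using A by (simp add: atom_def)
  have Ac: "A \<subseteq> carrier G" "finite A" "large k (exterior G S A)"
    using Af by (auto simp: fragment_def k_separating_iff)
  have c1: "card (A - {z}) + 1 = card A" using z Ac by (metis Suc_eq_plus1 card.remove)
  have "large k (exterior G S (A - {z}))"
    using large_mono[OF Ac(3) exterior_antimono] by blast
  then have sep: "k_separating G k S (A - {z})" using Ac c1 k by (auto simp: k_separating_iff)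
  have "\<not> fragment G k S (A - {z})" using A c1 unfolding atom_def by fastforce
  then have "card (A - {z}) + kappa G k S < card ((A - {z}) <#> S)"
    using fragmentI[OF S sep] by linarith
  moreover have "card (A <#> S) = card A + kappa G k S" using Af S fragment_iff by blast
  ultimately have "card (A <#> S) \<le> card ((A - {z}) <#> S)" using c1 by linarith
  moreover have "(A - {z}) <#> S \<subseteq> A <#> S" by (rule mono_set_mult) auto
  ultimately show ?thesis using card_seteq Ac Sc by (metis finite_set_mult)
qed

text \<open>A non-trivial translation has no fixed point, so it swaps the two elements.\<close>

lemma pair_stable:
  assumes "z \<in> carrier G" "z \<noteq> \<one>" "F \<subseteq> carrier G" "card F = 2" "z <# F = F"
  shows "z \<otimes> z = \<one>"
proof -
  obtain f f' where F: "F = {f, f'}" "f \<noteq> f'" using assms(4) by (meson card_2_iff)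
  have c: "f \<in> carrier G" "f' \<in> carrier G" using F assms by auto
  have ne: "z \<otimes> f \<noteq> f" "z \<otimes> f' \<noteq> f'" using assms c by auto
  have "z \<otimes> f \<in> F" "z \<otimes> f' \<in> F" using l_cosetI[of f F G z] l_cosetI[of f' F G z] assms(5) F by auto
  then have "z \<otimes> f = f'" "z \<otimes> f' = f" using F ne by auto
  then have "(z \<otimes> z) \<otimes> f = f" using assms c by (simp add: m_assoc)
  then show ?thesis using assms c by simp
qed

lemma involution_subgroup:
  assumes "r \<in> carrier G" "r \<otimes> r = \<one>"
  shows "subgroup {\<one>, r} G"
proof (rule subgroupI)
  fix a assume "a \<in> {\<one>, r}"
  moreover have "inv r = r" using assms inv_equality by blast
  ultimately show "inv a \<in> {\<one>, r}" by auto
qed (use assms in auto)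

lemma order_three_subgroup:
  assumes d: "d \<in> carrier G" and ddd: "d \<otimes> d \<otimes> d = \<one>"
  shows "subgroup {\<one>, d, d \<otimes> d} G"
proof -
  have invd: "inv d = d \<otimes> d" "inv (d \<otimes> d) = d"
    using ddd d by (auto intro!: inv_equality simp: m_assoc)
  show ?thesis
    by (rule subgroupI) (use d ddd invd in \<open>auto simp: m_assoc[symmetric]\<close>)
qed

text \<open>The three descriptions of W express that z, 1 and r^2 can be deleted from {1, r, r^2,
  z}. With E = rS - S and F = S - rS, both of size two, they yield zF = F and zE = r^2 E. So z and
  r^2/z are involutions and r^4 = 1; then E = rF, whence zE = E lies in W, while r^2 E avoids
  W.\<close>

lemma four_set_progression:
  assumes S: "S \<subseteq> carrier G" "finite S" and r: "r \<in> carrier G" and z: "z \<in> carrier G" "z \<noteq> \<one>" "z \<noteq> r \<otimes> r"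
    and h1: "W = S \<union> (r <# S) \<union> (r <# (r <# S))"
    and h2: "W = (r <# S) \<union> (r <# (r <# S)) \<union> (z <# S)"
    and h3: "W = S \<union> (r <# S) \<union> (z <# S)"
    and cW: "card W = card S + 4" and c1: "card (S \<union> (r <# S)) = card S + 2"
    and rho: "card (W \<union> (r <# W)) = card W + 2"
  shows False
proof -
  define S1 where "S1 = r <# S"
  define S2 where "S2 = r <# S1"
  define E where "E = S1 - S"
  define F where "F = S - S1"
  have c: "S1 \<subseteq> carrier G" "S2 \<subseteq> carrier G" "finite S1" "finite S2"
    using S r by (auto simp: S1_def S2_def)
  have Wc: "W \<subseteq> carrier G" "finite W" using S r h1 by auto
  have Ec: "E \<subseteq> carrier G" "finite E" and Fc: "F \<subseteq> carrier G" "finite F"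
    using S c by (auto simp: E_def F_def)
  have W1: "W = S \<union> S1 \<union> S2" and W2: "W = S1 \<union> S2 \<union> (z <# S)" and W3: "W = S \<union> S1 \<union> (z <# S)"
    using h1 h2 h3 by (simp_all add: S1_def S2_def)
  have rS: "r \<otimes> x \<in> S1" if "x \<in> S" for x using that by (auto simp: S1_def mem_l_coset)
  have rS1: "r \<otimes> x \<in> S2" if "x \<in> S1" for x using that by (auto simp: S2_def mem_l_coset)
  have zS: "z \<otimes> x \<in> W" if "x \<in> S" for x using that W2 by (auto simp: mem_l_coset)
  have rW: "r \<otimes> x \<in> r <# W" if "x \<in> W" for x using that by (auto simp: mem_l_coset)
  have S1W: "S1 \<subseteq> r <# W" unfolding S1_def by (rule l_coset_mono) (use W1 in blast)
  have S2W: "S2 \<subseteq> r <# W" unfolding S2_def by (rule l_coset_mono) (use W1 in blast)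
  have cE: "card E = 2" using card_Un_l_coset(1)[OF r S] c1 by (simp add: E_def S1_def)
  have cF: "card F = 2" using card_Un_l_coset(2)[OF r S] cE by (simp add: E_def F_def S1_def)
  have rE: "W - (S \<union> S1) = r <# E"
  proof (rule card_seteq)
    show "W - (S \<union> S1) \<subseteq> r <# E"
    proof
      fix x assume x: "x \<in> W - (S \<union> S1)"
      then have "x \<in> S2" using W1 by blast
      then obtain y where y: "y \<in> S1" "x = r \<otimes> y" by (auto simp: S2_def mem_l_coset)
      then have "y \<notin> S" using rS x by auto
      then show "x \<in> r <# E" using y by (auto simp: E_def mem_l_coset)
    qed
    have "card (W - (S \<union> S1)) = 2"
      using cW c1 W1 S c by (subst card_Diff_subset) (auto simp: S1_def)
    then show "card (r <# E) \<le> card (W - (S \<union> S1))" using cE Ec r by simp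
  qed (use Ec in simp)
  have cRW: "card ((r <# W) - W) = 2" "card (W - (r <# W)) = 2"
    using card_Un_l_coset[OF r Wc] rho by auto
  have rrE: "(r <# W) - W = r <# (r <# E)"
  proof (rule card_seteq)
    show "(r <# W) - W \<subseteq> r <# (r <# E)"
    proof
      fix x assume x: "x \<in> (r <# W) - W"
      then obtain y where y: "y \<in> W" "x = r \<otimes> y" by (auto simp: mem_l_coset)
      then have "y \<notin> S \<union> S1" using rS rS1 x W1 by auto
      then have "y \<in> r <# E" using rE y by blast
      then show "x \<in> r <# (r <# E)" unfolding y(2) by (rule l_cosetI)
    qed
    show "card (r <# (r <# E)) \<le> card ((r <# W) - W)" using cRW cE Ec r by simp
  qed (use Ec in simp)
  have FW: "W - (r <# W) = F"
  proof (rule card_seteq)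
    show "W - (r <# W) \<subseteq> F" using W1 S1W S2W by (auto simp: F_def)
    show "card F \<le> card (W - (r <# W))" using cRW cF by simp
  qed (use Fc in simp)
  have zF: "z <# F = F"
  proof (rule subset_l_coset_eq[OF z(1) Fc])
    show "F \<subseteq> z <# F"
    proof
      fix f assume f: "f \<in> F"
      then have f': "f \<in> W" "f \<notin> r <# W" using FW by auto
      then have "f \<in> z <# S" using W2 S1W S2W by blast
      then obtain s where s: "s \<in> S" "f = z \<otimes> s" by (auto simp: mem_l_coset)
      have "s \<notin> S1"
      proof
        assume "s \<in> S1"
        then obtain t where t: "t \<in> S" "s = r \<otimes> t" by (auto simp: S1_def mem_l_coset)
        then have "f = r \<otimes> (z \<otimes> t)" using s S r z by (simp add: m_lcomm subset_eq)
        then show False using f' rW zS t by simp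
      qed
      \<comment> \<open>The representation f = zs must use s without predecessor in S, as otherwise
        f itself would have a predecessor in W.\<close>
      then show "f \<in> z <# F" using s by (auto simp: F_def mem_l_coset)
    qed
  qed
  have zE: "r <# (r <# E) = z <# E"
  proof (rule card_seteq)
    show "r <# (r <# E) \<subseteq> z <# E"
    proof
      fix x assume x: "x \<in> r <# (r <# E)"
      then obtain e where e: "e \<in> E" "x = r \<otimes> (r \<otimes> e)" by (auto simp: mem_l_coset)
      have "r \<otimes> e \<in> r <# E" using e by (auto simp: mem_l_coset)
      then have "r \<otimes> e \<in> z <# S" using rE W3 by blast
      then obtain s where s: "s \<in> S" "r \<otimes> e = z \<otimes> s" by (auto simp: mem_l_coset)
      have xs: "x = z \<otimes> (r \<otimes> s)" using e s S r z by (simp add: m_lcomm subset_eq)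
      have "x \<notin> W" using x rrE by blast
      then have "r \<otimes> s \<notin> S" using zS xs by blast
      then show "x \<in> z <# E" using rS[OF s(1)] xs by (auto simp: E_def mem_l_coset)
    qed
    show "card (z <# E) \<le> card (r <# (r <# E))" using Ec r z by simp
  qed (use Ec in simp)
  have zz: "z \<otimes> z = \<one>" using pair_stable[OF z(1,2) Fc(1) cF zF] .
  let ?u = "inv z \<otimes> (r \<otimes> r)"
  have uE: "?u <# E = E"
  proof -
    have "?u <# E = inv z <# (r <# (r <# E))" using r z Ec by (simp add: l_coset_l_coset)
    then show ?thesis using zE z Ec by simp
  qed
  have "?u \<noteq> \<one>"
  proof
    assume "?u = \<one>"
    then have "z \<otimes> ?u = z" using z by simp
    then show False using z r by (simp add: m_assoc[symmetric])
  qed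
  then have uu: "?u \<otimes> ?u = \<one>" using pair_stable[of ?u E] uE Ec cE r z by simp
  have "r \<otimes> r \<otimes> (r \<otimes> r) = (z \<otimes> z) \<otimes> (?u \<otimes> ?u)"
  proof -
    have "z \<otimes> ?u = r \<otimes> r" using z r by (simp add: m_assoc[symmetric])
    then have "r \<otimes> r \<otimes> (r \<otimes> r) = (z \<otimes> ?u) \<otimes> (z \<otimes> ?u)" by simp
    also have "\<dots> = (z \<otimes> z) \<otimes> (?u \<otimes> ?u)"
      using z r by (simp only: m_ac m_closed inv_closed)
    finally show ?thesis .
  qed
  then have r4: "r \<otimes> r \<otimes> (r \<otimes> r) = \<one>" using zz uu by simp
  have ErF: "E = r <# F"
  proof (rule card_seteq)
    show "E \<subseteq> r <# F"
    proof
      fix e assume e: "e \<in> E"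
      then obtain g where g: "g \<in> S" "e = r \<otimes> g" by (auto simp: E_def S1_def mem_l_coset)
      have "g \<notin> S1"
      proof
        assume "g \<in> S1"
        then obtain t where t: "t \<in> S" "g = r \<otimes> t" by (auto simp: S1_def mem_l_coset)
        have tc: "t \<in> carrier G" using t S by blast
        \<comment> \<open>By r^4 = 1 a predecessor t of g in S would equal r^2 e, which lies outside
          W.\<close>
        have "r \<otimes> (r \<otimes> e) = (r \<otimes> r \<otimes> (r \<otimes> r)) \<otimes> t" using g t tc r by (simp add: m_assoc)
        then have "r \<otimes> (r \<otimes> e) \<in> W" using r4 tc t W1 by simp
        moreover have "r \<otimes> (r \<otimes> e) \<in> r <# (r <# E)" using e by (intro l_cosetI)
        ultimately show False using rrE by blast
      qed
      then show "e \<in> r <# F" using g by (auto simp: F_def mem_l_coset)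
    qed
    show "card (r <# F) \<le> card E" using cE cF Fc r by simp
  qed (use Fc in simp)
  then have "z <# E = E" using zF l_coset_commute[OF z(1) r Fc(1)] by simp
  then have "E \<inter> W = {}" using zE rrE by blast
  moreover have "E \<subseteq> W" using W1 by (auto simp: E_def)
  ultimately have "E = {}" by blast
  then show False using cE by simp
qed

text \<open>Deleting rz and z from {1, r, z, rz} describes the two points of W outside S Un rS both
  as E = zS - S and as rE, so r swaps them.\<close>

lemma four_set_square:
  assumes S: "S \<subseteq> carrier G" "finite S" and r: "r \<in> carrier G" "r \<noteq> \<one>" and z: "z \<in> carrier G"
    and h1: "W = S \<union> (r <# S) \<union> (r <# (z <# S))"
    and h2: "W = S \<union> (r <# S) \<union> (z <# S)"
    and cW: "card W = card S + 4" and c1: "card (S \<union> (r <# S)) = card S + 2"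
    and c2: "card (S \<union> (z <# S)) = card S + 2"
  shows "r \<otimes> r = \<one>"
proof -
  define E where "E = (z <# S) - S"
  define U where "U = S \<union> (r <# S)"
  have U: "U \<subseteq> carrier G" "finite U" using S r by (auto simp: U_def)
  have E: "E \<subseteq> carrier G" "finite E" using S l_coset_closed[OF z S(1)] by (auto simp: E_def)
  have cE: "card E = 2" using card_Un_l_coset(1)[OF z S] c2 by (simp add: E_def)
  have cWU: "card (W - U) = 2"
    using cW c1 U h1 by (subst card_Diff_subset) (auto simp: U_def)
  have 1: "W - U = E"
    by (rule card_seteq) (use h2 E cE cWU in \<open>auto simp: U_def E_def\<close>)
  have 2: "W - U = r <# E"
  proof (rule card_seteq)
    show "W - U \<subseteq> r <# E"
    proof
      fix x assume x: "x \<in> W - U"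
      then obtain y where y: "y \<in> z <# S" "x = r \<otimes> y" using h1 by (auto simp: U_def mem_l_coset)
      then have "y \<notin> S" using x by (auto simp: U_def mem_l_coset)
      then have "y \<in> E" using y by (simp add: E_def)
      then show "x \<in> r <# E" unfolding y(2) by (rule l_cosetI)
    qed
    show "card (r <# E) \<le> card (W - U)" using cWU cE E r by simp
  qed (use E in simp)
  show ?thesis using pair_stable[OF r E(1) cE] 1 2 by simp
qed

text \<open>Redundancy of the points of a larger atom controls how many elements of W = AS have no
  r-predecessor in W. Comparing with A Un rA then forces |A| = 4 and two r-steps inside A, arranged
  either as a chain or as a square.\<close>

lemma three_atom_card:
  assumes S: "based S" "\<not> degenerate G S" and k: "kappa G 2 S = card S" "kappa G 3 S = card S"
    and A: "atom 3 S A" "\<one> \<in> A"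
    and r: "r \<in> carrier G" "r \<noteq> \<one>" "fragment G 2 S {\<one>, r}"
  shows "card A = 3"
proof (rule ccontr)
  assume "card A \<noteq> 3"
  have Sc: "S \<subseteq> carrier G" "finite S" using S by (auto simp: based_def)
  have Af: "fragment G 3 S A" using A by (simp add: atom_def)
  have Ac: "A \<subseteq> carrier G" "finite A" "3 \<le> card A"
    using Af by (auto simp: fragment_def k_separating_iff)
  have a4: "4 \<le> card A" using \<open>card A \<noteq> 3\<close> Ac by linarith
  have A2: "fragment G 2 S A" by (rule fragment_le[OF S(1) Af]) (use k in auto)
  have thin: "thin 2 A" using three_atom_thin[OF S(1) A S(2)] k by simp
  have red: "(A - {z}) <#> S = A <#> S" if "z \<in> A" for z
    using atom_redundant[OF S(1) A(1) that] a4 by simp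
  define W where "W = A <#> S"
  have Wc: "W \<subseteq> carrier G" "finite W" using Ac Sc by (auto simp: W_def)
  have cW: "card W = card A + card S" using Af S k fragment_iff by (simp add: W_def)
  have "{\<one>, r} <#> S = S \<union> (r <# S)" using Sc by (simp add: set_mult_insert_left)
  then have c1: "card (S \<union> (r <# S)) = card S + 2" using r(2,3) S k fragment_iff by simp
  \<comment> \<open>Otherwise {1, r} would be a subgroup and a 2-fragment.\<close>
  have rr: "r \<otimes> r \<noteq> \<one>" using involution_subgroup[OF r(1)] r(3) S(2) by (auto simp: degenerate_def)
  have "card (S - (r <# S)) = 2" using card_Un_l_coset[OF r(1) Sc] c1 by simp
  then obtain f f' where F: "S - (r <# S) = {f, f'}" "f \<noteq> f'" by (meson card_2_iff)
  have fc: "f \<in> carrier G" "f' \<in> carrier G" using F Sc by blast+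
  \<comment> \<open>If w = as has no r-predecessor in W, then s has none in S, so s is f or f'. The
    two representations of w use different elements of S, hence both of them.\<close>
  have sub: "W - (r <# W) \<subseteq> (f <# A) \<inter> (f' <# A)"
  proof
    fix w assume w: "w \<in> W - (r <# W)"
    have rep: "s \<in> {f, f'}" if s: "s \<in> S" "a \<in> A" "w = a \<otimes> s" for a s
    proof (rule ccontr)
      assume "s \<notin> {f, f'}"
      then have "s \<in> r <# S" using F s by blast
      then obtain t where t: "t \<in> S" "s = r \<otimes> t" by (auto simp: mem_l_coset)
      then have "w = r \<otimes> (a \<otimes> t)" using s r Sc Ac by (simp add: m_lcomm subset_eq)
      moreover have "a \<otimes> t \<in> W" using s t unfolding W_def by (intro set_multI)
      ultimately show False using w by (auto simp: mem_l_coset)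
    qed
    obtain a s where as: "a \<in> A" "s \<in> S" "w = a \<otimes> s" using w by (auto simp: W_def mem_set_mult)
    have "w \<in> (A - {a}) <#> S" using red[OF as(1)] w by (simp add: W_def)
    then obtain b t where bt: "b \<in> A" "b \<noteq> a" "t \<in> S" "w = b \<otimes> t" by (auto simp: mem_set_mult)
    have cc: "a \<in> carrier G" "b \<in> carrier G" "s \<in> carrier G" "t \<in> carrier G" using as bt Ac Sc by auto
    have "s \<noteq> t" using as bt cc by auto
    then have "{s, t} = {f, f'}" using rep as bt by blast
    moreover have "w = s \<otimes> a" "w = t \<otimes> b" using as bt cc by (simp_all add: m_comm)
    then have "w \<in> s <# A" "w \<in> t <# A" using as bt l_cosetI by metis+
    ultimately show "w \<in> (f <# A) \<inter> (f' <# A)" by (auto simp: doubleton_eq_iff)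
  qed
  have "card (W - (r <# W)) \<le> card ((f <# A) \<inter> (f' <# A))" using sub Ac by (intro card_mono) auto
  then have rho: "card (W - (r <# W)) \<le> 2" using thin_inter[OF Ac(1,2) thin fc F(2)] by linarith
  have cWW: "card (W \<union> (r <# W)) = card W + card (W - (r <# W))"
    using card_Un_l_coset[OF r(1) Wc] by simp
  let ?B = "A \<union> (r <# A)"
  have B: "?B \<subseteq> carrier G" "finite ?B" using Ac r by auto
  have BS: "?B <#> S = W \<union> (r <# W)"
    using Ac Sc r by (simp add: set_mult_Un_left set_mult_l_coset W_def)
  have "large 2 (exterior G S ?B)"
  proof (rule large_exteriorI[OF Sc(2) B(2) Sc(1) B(1)])
    assume fin: "finite (carrier G)"
    have "card A + card (A <#> S) \<le> card (carrier G)"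
      by (rule large_exteriorD[OF atom_le_exterior[OF S(1) A(1) Af] fin Sc(1) Ac(1)])
    \<comment> \<open>The exterior of A has at least |A| >= 4 points, and at most two of them are
      lost by adjoining rA.\<close>
    then show "2 + card (?B <#> S) \<le> card (carrier G)"
      using BS cWW rho a4 by (simp add: W_def)
  qed
  moreover have "2 \<le> card ?B" using card_mono[OF B(2), of A] a4 by auto
  ultimately have "k_separating G 2 S ?B" using B by (simp add: k_separating_iff)
  then have "card ?B + card S \<le> card (W \<union> (r <# W))" using kappa_le[OF S(1)] k BS by fastforce
  moreover have "card ?B + card (A \<inter> (r <# A)) = 2 * card A"
    using card_Un_Int[of A "r <# A"] Ac r by simp
  moreover have i2: "card (A \<inter> (r <# A)) \<le> 2" using thin r by (simp add: thin_def)
  \<comment> \<open>2|A| - 2 <= |A Un rA| <= |A| + |W - rW| <= |A| + 2, so equality holds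
    throughout.\<close>
  ultimately have cA: "card A = 4" and i: "card (A \<inter> (r <# A)) = 2" and rho2: "card (W - (r <# W)) = 2"
    using cWW cW rho a4 by linarith+
  obtain p q where pq: "A \<inter> (r <# A) = {p, q}" "p \<noteq> q" using i by (meson card_2_iff)
  obtain p' q' where p': "p' \<in> A" "p = r \<otimes> p'" and q': "q' \<in> A" "q = r \<otimes> q'"
  proof -
    have "p \<in> r <# A" "q \<in> r <# A" using pq by auto
    then show thesis using that by (auto simp: mem_l_coset)
  qed
  have pA: "p \<in> A" "q \<in> A" using pq by auto
  have cc: "p \<in> carrier G" "q \<in> carrier G" "p' \<in> carrier G" "q' \<in> carrier G" using pA p' q' Ac by auto
  \<comment> \<open>The two steps p' to p and q' to q either share a point, giving u, ru, r^2 u and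
    a fourth element, or are disjoint, giving the square.\<close>
  show False
  proof (cases "p = q' \<or> q = p'")
    case True
    then obtain u where u: "u \<in> A" "r \<otimes> u \<in> A" "r \<otimes> (r \<otimes> u) \<in> A" using p' q' pA by blast
    have uc: "u \<in> carrier G" using u Ac by blast
    have d: "u \<noteq> r \<otimes> u" "r \<otimes> u \<noteq> r \<otimes> (r \<otimes> u)" using uc r by auto
    have d': "u \<noteq> r \<otimes> (r \<otimes> u)"
    proof
      assume "u = r \<otimes> (r \<otimes> u)"
      then have "(r \<otimes> r) \<otimes> u = u" using m_assoc[OF r(1) r(1) uc] by metis
      then show False using rr uc r by simp
    qed
    let ?T = "{u, r \<otimes> u, r \<otimes> (r \<otimes> u)}"
    have T: "card ?T = 3" "?T \<subseteq> A" using d d' u by auto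
    then have "card (A - ?T) = 1" using cA by (subst card_Diff_subset) auto
    then obtain v where v: "A - ?T = {v}" by (auto simp: card_1_singleton_iff)
    have vA: "v \<in> A" "v \<notin> ?T" using v by auto
    have AT: "A = {u, r \<otimes> u, r \<otimes> (r \<otimes> u), v}" using v T by blast
    have vc: "v \<in> carrier G" using vA Ac by blast
    define z where "z = v \<otimes> inv u"
    have zc: "z \<in> carrier G" using vc uc by (simp add: z_def)
    have zu: "z \<otimes> u = v" using vc uc by (simp add: z_def m_assoc)
    define S0 where "S0 = u <# S"
    have S0: "S0 \<subseteq> carrier G" "finite S0" "card S0 = card S" using uc Sc by (auto simp: S0_def)
    have tr: "r <# S0 = (r \<otimes> u) <# S" "r <# (r <# S0) = (r \<otimes> (r \<otimes> u)) <# S" "z <# S0 = v <# S"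
      using uc r zc Sc zu by (simp_all add: S0_def l_coset_l_coset)
    show False
    proof (rule four_set_progression[OF S0(1,2) r(1) zc])
      show "z \<noteq> \<one>" using zu vA uc by auto
      show "z \<noteq> r \<otimes> r" using zu vA uc r by (auto simp: m_assoc)
      have "A - {v} = {u, r \<otimes> u, r \<otimes> (r \<otimes> u)}" using AT vA by auto
      then show "W = S0 \<union> (r <# S0) \<union> (r <# (r <# S0))"
        using red[OF vA(1)] tr by (simp add: W_def set_mult_insert_left S0_def Un_assoc)
      have "A - {u} = {r \<otimes> u, r \<otimes> (r \<otimes> u), v}" using AT vA d d' by auto
      then show "W = (r <# S0) \<union> (r <# (r <# S0)) \<union> (z <# S0)"
        using red[OF u(1)] tr by (simp add: W_def set_mult_insert_left Un_assoc)
      have "A - {r \<otimes> (r \<otimes> u)} = {u, r \<otimes> u, v}" using AT vA d d' by auto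
      then show "W = S0 \<union> (r <# S0) \<union> (z <# S0)"
        using red[OF u(3)] tr by (simp add: W_def set_mult_insert_left S0_def Un_assoc)
      show "card W = card S0 + 4" using cW cA S0 by simp
      have "S0 \<union> (r <# S0) = u <# (S \<union> (r <# S))"
        using uc r Sc by (simp add: S0_def l_coset_Un l_coset_commute[of r u])
      then show "card (S0 \<union> (r <# S0)) = card S0 + 2" using c1 S0 uc Sc r by simp
      show "card (W \<union> (r <# W)) = card W + 2" using cWW rho2 by simp
    qed
  next
    case False
    have d: "p \<noteq> p'" "q \<noteq> q'" using p' q' cc r by auto
    have d': "p' \<noteq> q'" using pq p' q' by auto
    have "card {p', q', p, q} = 4" using False d d' pq by auto
    then have AT: "A = {p', q', p, q}"
      using card_seteq[OF Ac(2), of "{p', q', p, q}"] cA p' q' pA by auto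
    define z where "z = q' \<otimes> inv p'"
    have zc: "z \<in> carrier G" using cc by (simp add: z_def)
    have zp: "z \<otimes> p' = q'" using cc by (simp add: z_def m_assoc)
    define S0 where "S0 = p' <# S"
    have S0: "S0 \<subseteq> carrier G" "finite S0" "card S0 = card S" using cc Sc by (auto simp: S0_def)
    have tr: "r <# S0 = p <# S" "z <# S0 = q' <# S" "r <# (z <# S0) = q <# S"
      using cc r zc Sc zp p' q' by (simp_all add: S0_def l_coset_l_coset m_assoc)
    have "r \<otimes> r = \<one>"
    proof (rule four_set_square[OF S0(1,2) r(1,2) zc])
      have "A - {q'} = {p', p, q}" using AT False d d' by auto
      then show "W = S0 \<union> (r <# S0) \<union> (r <# (z <# S0))"
        using red[OF q'(1)] tr by (simp add: W_def set_mult_insert_left S0_def Un_assoc)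
      have "A - {q} = {p', p, q'}" using AT False d d' pq by auto
      then show "W = S0 \<union> (r <# S0) \<union> (z <# S0)"
        using red[OF pA(2)] tr by (simp add: W_def set_mult_insert_left S0_def Un_assoc)
      show "card W = card S0 + 4" using cW cA S0 by simp
      have "S0 \<union> (r <# S0) = p' <# (S \<union> (r <# S))"
        using cc r Sc by (simp add: S0_def l_coset_Un l_coset_commute[of r p'])
      then show "card (S0 \<union> (r <# S0)) = card S0 + 2" using c1 S0 cc Sc r by simp
      \<comment> \<open>{p, q} is an intersection of two 3-fragments; since both levels have the
        same \<open>kappa\<close>, it is a 2-fragment. This is the missing size condition for the
        z-direction.\<close>
      have rA: "fragment G 3 S (r <# A)" using fragment_l_coset[OF S(1) Af r(1)] .
      have rA2: "fragment G 2 S (r <# A)" by (rule fragment_le[OF S(1) rA]) (use k in auto)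
      have "fragment G 2 S (A \<inter> (r <# A))"
        by (rule uncross(1)[OF S(1) A2 rA2 _ atom_le_exterior[OF S(1) A(1) rA]]) (use i in simp)
      then have "card ({p, q} <#> S) = card S + 2" using pq S k fragment_iff by simp
      moreover have "{p, q} <#> S = r <# (S0 \<union> (z <# S0))"
        unfolding l_coset_Un tr(1,3) by (simp add: set_mult_insert_left)
      moreover have "card (r <# (S0 \<union> (z <# S0))) = card (S0 \<union> (z <# S0))"
        by (rule card_l_coset) (use S0 zc r in auto)
      ultimately show "card (S0 \<union> (z <# S0)) = card S0 + 2" using S0 by simp
    qed
    then show False using rr by blast
  qed
qed

section \<open>Excluding quotients of order two and three\<close>

text \<open>If d were an involution, H = {1, d} would not be a fragment, so HS would already fill
  the whole three-fold union. Then yS lies in HS, and HS is closed under the generators d and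
  y.\<close>

lemma three_set_no_involution:
  assumes S: "based S" "\<not> degenerate G S" "kappa G 2 S = card S"
    and d: "d \<in> carrier G" "d \<noteq> \<one>" and y: "y \<in> carrier G" and g: "generate G {\<one>, d, y} = carrier G"
    and c: "card (S \<union> (d <# S) \<union> (y <# S)) = card S + 3"
    and big: "finite (carrier G) \<Longrightarrow> card S + 8 \<le> card (carrier G)"
  shows "d \<otimes> d \<noteq> \<one>"
proof
  assume dd: "d \<otimes> d = \<one>"
  have Sc: "S \<subseteq> carrier G" "finite S" "\<one> \<in> S" using S by (auto simp: based_def)
  let ?H = "{\<one>, d}" and ?K = "S \<union> (d <# S)" and ?W = "S \<union> (d <# S) \<union> (y <# S)"
  have H: "subgroup ?H G" using involution_subgroup[OF d(1) dd] .
  have HS: "?H <#> S = ?K" using Sc by (simp add: set_mult_insert_left)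
  have K: "?K \<subseteq> carrier G" "finite ?K" "?K \<noteq> {}" using Sc d by auto
  have W: "finite ?W" using Sc by simp
  have KW: "card ?K \<le> card ?W" using W by (intro card_mono) auto
  have "large 2 (exterior G S ?H)"
    by (rule large_exteriorI) (use Sc d HS KW c big in auto)
  then have sep: "k_separating G 2 S ?H" using d by (simp add: k_separating_iff)
  have "\<not> fragment G 2 S ?H" using S(2) H by (auto simp: degenerate_def)
  then have "\<not> card ?K \<le> card S + 2" using fragmentI[OF S(1) sep] HS S(3) d by auto
  then have "card S + 2 < card ?K" by simp
  then have "?K = ?W" using c by (intro card_seteq[OF W]) auto
  then have yS: "y <# S \<subseteq> ?K" by blast
  have dK: "d <# ?K = ?K" using d Sc dd by (auto simp: l_coset_Un l_coset_l_coset)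
  have "y <# ?K \<subseteq> ?K"
  proof -
    have "y <# (d <# S) = d <# (y <# S)" using d y Sc by (simp add: l_coset_commute)
    also have "\<dots> \<subseteq> d <# ?K" by (rule l_coset_mono[OF yS])
    finally show ?thesis using yS dK by (simp add: l_coset_Un)
  qed
  then have "?K = carrier G"
    using K d y dK by (intro closed_eq_carrier[OF K _ g]) auto
  then have "finite (carrier G)" "card (carrier G) = card ?K" using K by simp_all
  then show False using big KW c by linarith
qed

text \<open>Let H be the subgroup of order 3 generated by d and K = HS. Non-degeneracy gives |K| >=
  |S| + 4. Together with the small union this splits S into two points isolated in their H-cosets
  and a union F of whole cosets, and F is shown to be closed under y as well.\<close>

lemma three_set_no_order_three:
  assumes S: "based S" "\<not> degenerate G S" "kappa G 2 S = card S" "3 \<le> card S"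
    and d: "d \<in> carrier G" "d \<noteq> \<one>" "d \<otimes> d \<noteq> \<one>"
    and y: "y \<in> carrier G" and g: "generate G {\<one>, d, y} = carrier G"
    and c: "card (S \<union> (d <# S) \<union> (y <# S)) = card S + 3"
    and big: "finite (carrier G) \<Longrightarrow> card S + 8 \<le> card (carrier G)"
  shows "d \<otimes> d \<otimes> d \<noteq> \<one>"
proof
  assume ddd: "d \<otimes> d \<otimes> d = \<one>"
  have Sc: "S \<subseteq> carrier G" "finite S" "\<one> \<in> S" using S by (auto simp: based_def)
  have d3: "d \<otimes> (d \<otimes> (d \<otimes> x)) = x" if "x \<in> carrier G" for x
    using that d ddd by (simp add: m_assoc[symmetric])
  let ?H = "{\<one>, d, d \<otimes> d}"
  have H: "subgroup ?H G" by (rule order_three_subgroup[OF d(1) ddd])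
  have cH: "card ?H = 3" using d by (auto simp: card_insert_if)
  define dS where "dS = d <# S"
  define N where "N = S \<union> dS"
  define K where "K = N \<union> (d <# dS)"
  define W where "W = N \<union> (y <# S)"
  have dc: "dS \<subseteq> carrier G" "finite dS" using Sc d by (auto simp: dS_def)
  have Nc: "N \<subseteq> carrier G" "finite N" using Sc dc by (auto simp: N_def)
  have K: "K \<subseteq> carrier G" "finite K" "K \<noteq> {}" using Nc dc d Sc by (auto simp: K_def N_def)
  have W: "finite W" "card W = card S + 3" using Nc Sc c by (auto simp: W_def N_def dS_def)
  have NW: "card N \<le> card W" using W by (intro card_mono) (auto simp: W_def)
  have HS: "?H <#> S = K" using Sc d
    by (simp add: set_mult_insert_left K_def N_def dS_def l_coset_l_coset Un_assoc)
  have dmem: "d \<otimes> x \<in> dS" if "x \<in> S" for x using that by (auto simp: dS_def mem_l_coset)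
  \<comment> \<open>The points of S that are alone in their coset of \<open>?H\<close>. Only their
    cosets contribute elements of K outside S Un dS.\<close>
  define S1 where "S1 = {s \<in> S. d \<otimes> s \<notin> S \<and> d \<otimes> (d \<otimes> s) \<notin> S}"
  have S1: "S1 \<subseteq> carrier G" "finite S1" using Sc by (auto simp: S1_def)
  define \<delta> where "\<delta> = card (dS - S)"
  have cN: "card N = card S + \<delta>"
    using card_Un_l_coset(1)[OF d(1) Sc(1,2)] by (simp add: N_def dS_def \<delta>_def)
  have d3': "\<delta> \<le> 3" using NW W cN by linarith
  have HN: "{\<one>, d} <#> S = N" using Sc by (simp add: set_mult_insert_left N_def dS_def)
  have "large 2 (exterior G S {\<one>, d})"
    by (rule large_exteriorI) (use Sc d HN NW W big in auto)
  then have "k_separating G 2 S {\<one>, d}" using d by (simp add: k_separating_iff)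
  then have d2: "2 \<le> \<delta>" using kappa_le[OF S(1)] HN cN S(3) d by fastforce
  have dS1: "d <# S1 \<subseteq> dS - S" by (auto simp: S1_def dS_def mem_l_coset)
  then have "card (d <# S1) \<le> \<delta>" unfolding \<delta>_def using dc by (intro card_mono) auto
  then have n1: "card S1 \<le> \<delta>" using S1 d by simp
  have "K - N \<subseteq> d <# (d <# S1)"
  proof
    fix x assume x: "x \<in> K - N"
    then obtain s where s: "s \<in> S" "x = d \<otimes> (d \<otimes> s)" by (auto simp: K_def dS_def mem_l_coset)
    then have "d \<otimes> s \<notin> S" "d \<otimes> (d \<otimes> s) \<notin> S" using x dmem by (auto simp: N_def)
    then have "s \<in> S1" using s by (simp add: S1_def)
    then show "x \<in> d <# (d <# S1)" unfolding s(2) by (intro l_cosetI)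
  qed
  then have "card (K - N) \<le> card (d <# (d <# S1))" using S1 by (intro card_mono) auto
  then have "card (K - N) \<le> card S1" using S1 d by simp
  moreover have "card K = card N + card (K - N)"
    using K Nc by (metis K_def card_Diff_subset card_mono le_add_diff_inverse sup_ge1)
  ultimately have cK: "card K \<le> card S + \<delta> + card S1" using cN by linarith
  have "large 2 (exterior G S ?H)"
    by (rule large_exteriorI) (use Sc d HS cK n1 d3' big in auto)
  then have sepH: "k_separating G 2 S ?H" using d cH by (simp add: k_separating_iff)
  have "\<not> fragment G 2 S ?H" using S(2) H by (auto simp: degenerate_def)
  then have K4: "card S + 4 \<le> card K" using fragmentI[OF S(1) sepH] HS S(3) cH by fastforce
  have hK: "h \<otimes> x \<in> K" if "h \<in> ?H" "x \<in> K" for h x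
  proof -
    have h: "h \<in> carrier G" using that d by auto
    have Hc: "?H \<subseteq> carrier G" using d by auto
    have "h <# K = (h <# ?H) <#> S" unfolding HS[symmetric] using set_mult_l_coset[OF h Hc Sc(1)] ..
    also have "h <# ?H = ?H" using coset_join3[OF h H that(1)] .
    finally show ?thesis using l_cosetI[OF that(2), of G h] HS by simp
  qed
  then have dK: "d \<otimes> x \<in> K" if "x \<in> K" for x using that by blast
  have KnG: "K \<noteq> carrier G" using big cK n1 d3' K by auto
  have "\<not> y <# K \<subseteq> K"
  proof
    assume yK: "y <# K \<subseteq> K"
    have "K = carrier G"
      by (rule closed_eq_carrier[OF K _ g]) (use yK K d y dK in \<open>auto simp: mem_l_coset\<close>)
    then show False using KnG by blast
  qed
  then obtain k where k: "k \<in> K" "y \<otimes> k \<notin> K" unfolding subset_iff mem_l_coset by blast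
  obtain h s where hs: "h \<in> ?H" "s \<in> S" "k = h \<otimes> s"
    using k(1) unfolding HS[symmetric] mem_set_mult by blast
  have "y \<otimes> k = h \<otimes> (y \<otimes> s)" using hs d y Sc by (auto simp: m_lcomm subset_eq)
  then have s: "s \<in> S" "y \<otimes> s \<notin> K" using hK[OF hs(1)] k(2) hs(2) by metis+
  have ysW: "y \<otimes> x \<in> W" if "x \<in> S" for x using that by (auto simp: W_def mem_l_coset)
  have NK: "N \<subseteq> K" by (auto simp: K_def)
  have cWN: "card (W - N) = 3 - \<delta>"
    using W cN Nc by (subst card_Diff_subset) (auto simp: W_def)
  have "y \<otimes> s \<in> W - N" using s ysW NK by blast
  then have "card (W - N) \<noteq> 0" using W by auto
  \<comment> \<open>Some ys falls outside K, because K is not closed under y; so the third translate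
    uses up one of the three extra elements and \<open>\<delta>\<close> cannot be 3.\<close>
  then have \<delta>2: "\<delta> = 2" and cWN1: "card (W - N) = 1" using cWN d2 by linarith+
  have uniq: "x = y \<otimes> s" if "x \<in> W - N" for x
    using cWN1 that \<open>y \<otimes> s \<in> W - N\<close> by (metis card_1_singletonE singletonD)
  have n12: "card S1 = 2" using K4 cK \<delta>2 n1 by linarith
  have dS1e: "d <# S1 = dS - S"
    by (rule card_subset_eq[OF _ dS1]) (use dc n12 \<delta>2 S1 d in \<open>auto simp: \<delta>_def\<close>)
  define F where "F = S - S1"
  have F: "F \<subseteq> carrier G" "finite F" using Sc by (auto simp: F_def)
  have "card F = card S - 2" using n12 S1 by (simp add: F_def card_Diff_subset S1_def)
  then have Fne: "F \<noteq> {}" using S(4) by auto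
  have dF: "d \<otimes> f \<in> F" if f: "f \<in> F" for f
  proof -
    have fc: "f \<in> S" "f \<notin> S1" "f \<in> carrier G" using f Sc by (auto simp: F_def)
    have "d \<otimes> f \<in> S"
    proof (rule ccontr)
      assume "d \<otimes> f \<notin> S"
      then have "d \<otimes> f \<in> d <# S1" using dS1e dmem fc by blast
      then show False using l_coset_mem_iff[OF d(1) S1(1) fc(3)] fc by blast
    qed
    moreover have "d \<otimes> f \<notin> S1" using d3 fc by (auto simp: S1_def)
    ultimately show ?thesis by (simp add: F_def)
  qed
  \<comment> \<open>If yf is outside N, it is the unique point ys of W - N and avoids K. As K is a
    union of cosets, y(df) avoids K too, so it is the same point and df = f.\<close>
  have yN: "y \<otimes> f \<in> N" if f: "f \<in> F" for f
  proof (rule ccontr)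
    assume n: "y \<otimes> f \<notin> N"
    have fc: "f \<in> S" "f \<in> carrier G" "d \<otimes> f \<in> S" "d \<otimes> f \<in> carrier G" using f dF[OF f] Sc by (auto simp: F_def)
    have e: "y \<otimes> f = y \<otimes> s" using uniq ysW fc n by blast
    then have nK: "y \<otimes> f \<notin> K" using s by simp
    have "y \<otimes> (d \<otimes> f) \<notin> K"
    proof
      assume "y \<otimes> (d \<otimes> f) \<in> K"
      then have "d \<otimes> (d \<otimes> (y \<otimes> (d \<otimes> f))) \<in> K" using dK by blast
      moreover have "d \<otimes> (d \<otimes> (y \<otimes> (d \<otimes> f))) = d \<otimes> (d \<otimes> (d \<otimes> (y \<otimes> f)))"
        using fc d y by (simp add: m_lcomm)
      ultimately show False using d3 fc y nK by simp
    qed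
    then have "y \<otimes> (d \<otimes> f) = y \<otimes> s" using uniq ysW fc NK by blast
    then have "d \<otimes> f = f" using e fc y Sc s by auto
    then show False using d fc by simp
  qed
  \<comment> \<open>The whole coset of yf lies in S Un dS. Such a coset meets S in at least two
    points, so it contains no point of \<open>S1\<close>; and as dS - S is d \<open>S1\<close>, none
    of its points is outside S.\<close>
  have yF: "y \<otimes> f \<in> F" if f: "f \<in> F" for f
  proof -
    have fc: "f \<in> carrier G" using f F by blast
    let ?x = "y \<otimes> f"
    have xc: "?x \<in> carrier G" using y fc by simp
    have dx: "d \<otimes> ?x \<in> N" "d \<otimes> (d \<otimes> ?x) \<in> N"
      using yN[OF dF[OF f]] yN[OF dF[OF dF[OF f]]] d y fc by (simp_all add: m_lcomm)
    have xS: "?x \<in> S"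
    proof (rule ccontr)
      assume n: "?x \<notin> S"
      then have xd: "?x \<in> dS - S" using yN[OF f] by (auto simp: N_def)
      then have "?x \<in> d <# S1" using dS1e by blast
      then obtain t where t: "t \<in> S1" "?x = d \<otimes> t" by (auto simp: mem_l_coset)
      have tc: "t \<in> carrier G" using t S1 by blast
      have "d \<otimes> ?x \<notin> S" using t by (auto simp: S1_def)
      then have "d \<otimes> ?x \<in> dS" using dx by (auto simp: N_def)
      then have "?x \<in> S" using l_coset_mem_iff[OF d(1) Sc(1) xc] by (simp add: dS_def)
      then show False using n by blast
    qed
    moreover have "?x \<notin> S1"
    proof
      assume x1: "?x \<in> S1"
      then have "d \<otimes> (d \<otimes> ?x) \<in> dS" using dx(2) by (auto simp: N_def S1_def)
      then have "d \<otimes> ?x \<in> S" using l_coset_mem_iff[OF d(1) Sc(1)] xc d by (simp add: dS_def)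
      then show False using x1 by (auto simp: S1_def)
    qed
    ultimately show ?thesis by (simp add: F_def)
  qed
  have "F = carrier G"
    by (rule closed_eq_carrier[OF F Fne _ g]) (use F d y dF yF in \<open>auto simp: mem_l_coset\<close>)
  then show False using KnG NK Sc F K by (auto simp: F_def N_def)
qed


subsection \<open>Three-element sets\<close>

definition short_shape :: "'a set \<Rightarrow> bool" where
  "short_shape T \<longleftrightarrow> (\<exists>g\<in>carrier G. \<exists>r\<in>carrier G.
     T = {g, r \<otimes> g, r \<otimes> (r \<otimes> g)} \<or> T = {g, r \<otimes> g, r \<otimes> (r \<otimes> (r \<otimes> g))})"

text \<open>Says that no quotient of two distinct elements of T has order 2 or 3. Stating it through
  squares and cubes avoids inverses, so that relations between products can be used directly after
  cancellation.\<close>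

definition no_small_order :: "'a set \<Rightarrow> bool" where
  "no_small_order T \<longleftrightarrow>
     (\<forall>a\<in>T. \<forall>b\<in>T. a \<noteq> b \<longrightarrow> a \<otimes> a \<noteq> b \<otimes> b \<and> a \<otimes> (a \<otimes> a) \<noteq> b \<otimes> (b \<otimes> b))"

lemma power_mult_eq_iff:
  assumes "d \<in> carrier G" "b \<in> carrier G"
  shows "(d \<otimes> b) \<otimes> (d \<otimes> b) = b \<otimes> b \<longleftrightarrow> d \<otimes> d = \<one>"
    and "(d \<otimes> b) \<otimes> ((d \<otimes> b) \<otimes> (d \<otimes> b)) = b \<otimes> (b \<otimes> b) \<longleftrightarrow> d \<otimes> d \<otimes> d = \<one>"
proof -
  have "(d \<otimes> b) \<otimes> (d \<otimes> b) = (d \<otimes> d) \<otimes> (b \<otimes> b)"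
    and "(d \<otimes> b) \<otimes> ((d \<otimes> b) \<otimes> (d \<otimes> b)) = (d \<otimes> d \<otimes> d) \<otimes> (b \<otimes> (b \<otimes> b))"
    using assms by (simp_all only: m_ac m_closed)
  then show "(d \<otimes> b) \<otimes> (d \<otimes> b) = b \<otimes> b \<longleftrightarrow> d \<otimes> d = \<one>"
    and "(d \<otimes> b) \<otimes> ((d \<otimes> b) \<otimes> (d \<otimes> b)) = b \<otimes> (b \<otimes> b) \<longleftrightarrow> d \<otimes> d \<otimes> d = \<one>"
    using assms by simp_all
qed

lemma no_small_orderD:
  assumes "no_small_order T" "b \<in> T" "d \<otimes> b \<in> T" "d \<noteq> \<one>" "d \<in> carrier G" "T \<subseteq> carrier G"
  shows "d \<otimes> d \<noteq> \<one>" "d \<otimes> d \<otimes> d \<noteq> \<one>"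
proof -
  have b: "b \<in> carrier G" using assms by blast
  then have "d \<otimes> b \<noteq> b" using assms by simp
  then show "d \<otimes> d \<noteq> \<one>" "d \<otimes> d \<otimes> d \<noteq> \<one>"
    using assms power_mult_eq_iff[OF assms(5) b] unfolding no_small_order_def by metis+
qed

lemma no_small_orderI:
  assumes T: "T \<subseteq> carrier G" "card T = 3"
    and d: "\<And>b d e. T = {b, d \<otimes> b, e} \<Longrightarrow> b \<in> carrier G \<Longrightarrow> d \<in> carrier G \<Longrightarrow> e \<in> carrier G \<Longrightarrow> d \<noteq> \<one> \<Longrightarrow>
      d \<otimes> d \<noteq> \<one> \<and> d \<otimes> d \<otimes> d \<noteq> \<one>"
  shows "no_small_order T"
  unfolding no_small_order_def
proof (intro ballI impI)
  fix a b assume ab: "a \<in> T" "b \<in> T" "a \<noteq> b"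
  have c: "a \<in> carrier G" "b \<in> carrier G" using ab T by auto
  have fT: "finite T" using T(2) by (metis card.infinite zero_neq_numeral)
  have "card (T - {a, b}) = 1" using T ab fT by (subst card_Diff_subset) auto
  then obtain e where e: "T - {a, b} = {e}" by (auto simp: card_1_singleton_iff)
  have Te: "T = {b, a, e}" using e ab by auto
  let ?d = "a \<otimes> inv b"
  have db: "?d \<otimes> b = a" using c by (simp add: m_assoc)
  have "?d \<otimes> ?d \<noteq> \<one> \<and> ?d \<otimes> ?d \<otimes> ?d \<noteq> \<one>"
    by (rule d[of b ?d e]) (use Te db c T ab in auto)
  then show "a \<otimes> a \<noteq> b \<otimes> b \<and> a \<otimes> (a \<otimes> a) \<noteq> b \<otimes> (b \<otimes> b)"
    using power_mult_eq_iff[of ?d b] db c by simp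
qed

lemma triple_eq:
  assumes "card T = 3" "a \<in> T" "b \<in> T" "c \<in> T" "a \<noteq> b" "a \<noteq> c" "b \<noteq> c"
  shows "T = {a, b, c}"
proof -
  have "finite T" using assms(1) by (metis card.infinite zero_neq_numeral)
  then show ?thesis using card_seteq[of T "{a, b, c}"] assms by auto
qed

text \<open>The colouring principle: with three colours, a vertex adjacent to two different colours
  has its colour determined.\<close>

lemma third_eq:
  assumes "card T = 3" "a \<in> T" "b \<in> T" "a \<noteq> b" "c \<in> T" "c \<noteq> a" "c \<noteq> b" "d \<in> T" "d \<noteq> a" "d \<noteq> b"
  shows "c = d"
  using triple_eq[of T a b c] assms by auto

text \<open>With r = a/b the relation reads c = r^3 b, so T would be b, rb, r^3 b; the case b = c
  contradicts \<open>no_small_order\<close>.\<close>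

lemma no_relation:
  assumes T: "T \<subseteq> carrier G" "card T = 3" "\<not> short_shape T" "no_small_order T"
    and a: "a \<in> T" "b \<in> T" "c \<in> T" "b \<noteq> a" "c \<noteq> a"
  shows "a \<otimes> (a \<otimes> a) \<noteq> b \<otimes> (b \<otimes> c)"
proof
  assume e: "a \<otimes> (a \<otimes> a) = b \<otimes> (b \<otimes> c)"
  have cc: "a \<in> carrier G" "b \<in> carrier G" "c \<in> carrier G" using a T by auto
  show False
  proof (cases "b = c")
    case True
    then show False using e a T(4) unfolding no_small_order_def by metis
  next
    case False
    let ?r = "a \<otimes> inv b"
    have rb: "?r \<otimes> b = a" using cc by (simp add: m_assoc)
    have "b \<otimes> (b \<otimes> (?r \<otimes> (?r \<otimes> (?r \<otimes> b)))) = (?r \<otimes> b) \<otimes> ((?r \<otimes> b) \<otimes> (?r \<otimes> b))"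
      using cc by (simp only: m_ac m_closed inv_closed)
    also have "\<dots> = b \<otimes> (b \<otimes> c)" using rb e by simp
    finally have "?r \<otimes> (?r \<otimes> (?r \<otimes> b)) = c" using cc by simp
    moreover have "T = {b, a, c}" using triple_eq[OF T(2), of b a c] a False by auto
    ultimately have "T = {b, ?r \<otimes> b, ?r \<otimes> (?r \<otimes> (?r \<otimes> b))}" using rb by simp
    then show False using T(3) cc unfolding short_shape_def by (metis inv_closed m_closed)
  qed
qed

text \<open>With r = a/b the relation reads c = r^2 b, the other pattern of
  \<open>short_shape\<close>.\<close>

lemma no_middle:
  assumes T: "T \<subseteq> carrier G" "card T = 3" "\<not> short_shape T"
    and a: "a \<in> T" "b \<in> T" "c \<in> T" "b \<noteq> a" "c \<noteq> a" "b \<noteq> c"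
  shows "a \<otimes> a \<noteq> b \<otimes> c"
proof
  assume e: "a \<otimes> a = b \<otimes> c"
  have cc: "a \<in> carrier G" "b \<in> carrier G" "c \<in> carrier G" using a T by auto
  let ?r = "a \<otimes> inv b"
  have rb: "?r \<otimes> b = a" using cc by (simp add: m_assoc)
  have "b \<otimes> (?r \<otimes> (?r \<otimes> b)) = (?r \<otimes> b) \<otimes> (?r \<otimes> b)"
    using cc by (simp only: m_ac m_closed inv_closed)
  also have "\<dots> = b \<otimes> c" using rb e by simp
  finally have "?r \<otimes> (?r \<otimes> b) = c" using cc by simp
  moreover have "T = {b, a, c}" using triple_eq[OF T(2), of b a c] a by auto
  ultimately have "T = {b, ?r \<otimes> b, ?r \<otimes> (?r \<otimes> b)}" using rb by simp
  then show False using T(3) cc unfolding short_shape_def by (metis inv_closed m_closed)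
qed

text \<open>Three translates of \<open>T\<close> that meet pairwise give a proper colouring, by elements of \<open>T\<close>, of
  a hexagon \<open>a b e f d c\<close> whose alternate vertices have equal products. Unless \<open>T\<close> satisfies a short
  relation, the alternate vertices have distinct colours.\<close>

lemma hexagon:
  assumes T: "T \<subseteq> carrier G" "card T = 3" "\<not> short_shape T" "no_small_order T"
    and m: "a \<in> T" "b \<in> T" "c \<in> T" "d \<in> T" "e \<in> T" "f \<in> T"
    and n: "a \<noteq> b" "b \<noteq> e" "e \<noteq> f" "f \<noteq> d" "d \<noteq> c" "c \<noteq> a"
    and eq: "a \<otimes> (e \<otimes> d) = b \<otimes> (f \<otimes> c)"
  shows "a \<noteq> e"
proof
  assume ae: "a = e"
  have cc: "a \<in> carrier G" "b \<in> carrier G" "c \<in> carrier G" "d \<in> carrier G" "e \<in> carrier G" "f \<in> carrier G"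
    using m T by auto
  note rel = no_relation[OF T]
  show False
  proof (cases "d = a")
    case True
    \<comment> \<open>With a = e = d the other three vertices have only two colours left, so two of
      them coincide and the equation becomes one excluded by \<open>no_relation\<close>.\<close>
    have "b = f \<or> b = c \<or> f = c"
      using triple_eq[OF T(2), of a b f] m n True ae by auto
    moreover have "a \<otimes> (a \<otimes> a) = b \<otimes> (f \<otimes> c)" using eq True ae by simp
    moreover have "a \<otimes> (a \<otimes> a) \<noteq> b \<otimes> (b \<otimes> c)" using rel[of a b c] m n by auto
    moreover have "a \<otimes> (a \<otimes> a) \<noteq> b \<otimes> (b \<otimes> f)" using rel[of a b f] m n ae by auto
    moreover have "a \<otimes> (a \<otimes> a) \<noteq> c \<otimes> (c \<otimes> b)" using rel[of a c b] m n by auto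
    ultimately show False using cc m_comm m_lcomm by metis
  next
    case False
    \<comment> \<open>Both f and c are adjacent to the colours a and d, so they share the third
      colour. The remaining vertex b has colour d or c, and either choice gives an excluded
      relation.\<close>
    have fc: "f = c" by (rule third_eq[OF T(2) m(1,4)]) (use m n False ae in auto)
    show False
    proof (cases "b = d")
      case True
      then have "d \<otimes> (a \<otimes> a) = d \<otimes> (c \<otimes> c)" using eq ae fc cc by (simp add: m_ac)
      then have "a \<otimes> a = c \<otimes> c" using cc by simp
      then show False using T(4) m n unfolding no_small_order_def by metis
    next
      case False
      have "b = c" by (rule third_eq[OF T(2) m(1,4)]) (use m n False \<open>d \<noteq> a\<close> ae in auto)
      then have "c \<otimes> (c \<otimes> c) = a \<otimes> (a \<otimes> d)" using eq ae fc cc by (simp add: m_ac)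
      then show False using rel[of c a d] m n by auto
    qed
  qed
qed

text \<open>Three translates with nine points in all and a union of at most six must meet pairwise
  in exactly one point each, with no common point. The resulting hexagon has distinct alternate
  colours a, e, d, which forces c = e and b = d; then z1, z2, z3 are the multiples of e, a, d by g =
  z1/e.\<close>

lemma triple_translate:
  assumes T: "T \<subseteq> carrier G" "card T = 3" "\<not> short_shape T" "no_small_order T" "thin 1 T"
    and Z: "Z \<subseteq> carrier G" "card Z = 3" "card (Z <#> T) \<le> 6"
  shows "\<exists>g\<in>carrier G. Z = g <# T"
proof -
  obtain z1 z2 z3 where z: "Z = {z1, z2, z3}" "z1 \<noteq> z2" "z1 \<noteq> z3" "z2 \<noteq> z3"
    using Z(2) by (metis card_3_iff)
  have zc: "z1 \<in> carrier G" "z2 \<in> carrier G" "z3 \<in> carrier G" using z Z by auto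
  have fT: "finite T" using T(2) by (metis card.infinite zero_neq_numeral)
  define A1 where "A1 = z1 <# T"
  define A2 where "A2 = z2 <# T"
  define A3 where "A3 = z3 <# T"
  have f: "finite A1" "finite A2" "finite A3" using fT by (auto simp: A1_def A2_def A3_def)
  have c: "card A1 = 3" "card A2 = 3" "card A3 = 3" using zc T by (auto simp: A1_def A2_def A3_def)
  have i: "card (A1 \<inter> A2) \<le> 1" "card (A1 \<inter> A3) \<le> 1" "card (A2 \<inter> A3) \<le> 1"
    using thin_inter[OF T(1) fT T(5)] zc z by (auto simp: A1_def A2_def A3_def)
  have ZT: "Z <#> T = A1 \<union> A2 \<union> A3"
    by (simp add: z set_mult_insert_left A1_def A2_def A3_def Un_assoc)
  have "card A1 + card A2 = card (A1 \<union> A2) + card (A1 \<inter> A2)" using f by (intro card_Un_Int)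
  moreover have "card (A1 \<union> A2) + card A3 = card (A1 \<union> A2 \<union> A3) + card ((A1 \<union> A2) \<inter> A3)"
    using f by (intro card_Un_Int) auto
  moreover have "card (A1 \<inter> A3) + card (A2 \<inter> A3) = card ((A1 \<union> A2) \<inter> A3) + card (A1 \<inter> A2 \<inter> A3)"
  proof -
    have e: "(A1 \<union> A2) \<inter> A3 = (A1 \<inter> A3) \<union> (A2 \<inter> A3)" "A1 \<inter> A2 \<inter> A3 = (A1 \<inter> A3) \<inter> (A2 \<inter> A3)"
      by auto
    show ?thesis unfolding e by (rule card_Un_Int) (use f in auto)
  qed
  ultimately have "card (A1 \<inter> A2) + card (A1 \<inter> A3) + card (A2 \<inter> A3) \<ge> 3 + card (A1 \<inter> A2 \<inter> A3)"
    using c Z(3)[unfolded ZT] by linarith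
  then have "card (A1 \<inter> A2) \<noteq> 0" "card (A1 \<inter> A3) \<noteq> 0" "card (A2 \<inter> A3) \<noteq> 0" "card (A1 \<inter> A2 \<inter> A3) = 0"
    using i by linarith+
  then have ne: "A1 \<inter> A2 \<noteq> {}" "A1 \<inter> A3 \<noteq> {}" "A2 \<inter> A3 \<noteq> {}" "A1 \<inter> A2 \<inter> A3 = {}"
    using f by auto
  obtain a c where ac: "a \<in> T" "c \<in> T" "z1 \<otimes> a = z2 \<otimes> c" "z1 \<otimes> a \<notin> A3"
  proof -
    obtain p where p: "p \<in> A1" "p \<in> A2" "p \<notin> A3" using ne(1,4) by blast
    then show thesis using that unfolding A1_def A2_def mem_l_coset by metis
  qed
  obtain b e where be: "b \<in> T" "e \<in> T" "z1 \<otimes> b = z3 \<otimes> e" "z1 \<otimes> b \<notin> A2"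
  proof -
    obtain p where p: "p \<in> A1" "p \<in> A3" "p \<notin> A2" using ne(2,4) by blast
    then show thesis using that unfolding A1_def A3_def mem_l_coset by metis
  qed
  obtain d f where df: "d \<in> T" "f \<in> T" "z2 \<otimes> d = z3 \<otimes> f" "z2 \<otimes> d \<notin> A1"
  proof -
    obtain p where p: "p \<in> A2" "p \<in> A3" "p \<notin> A1" using ne(3,4) by blast
    then show thesis using that unfolding A2_def A3_def mem_l_coset by metis
  qed
  have cc: "a \<in> carrier G" "b \<in> carrier G" "c \<in> carrier G" "d \<in> carrier G" "e \<in> carrier G" "f \<in> carrier G"
    using ac be df T by auto
  have mA: "z1 \<otimes> x \<in> A1" "z2 \<otimes> x \<in> A2" "z3 \<otimes> x \<in> A3" if "x \<in> T" for x
    using that by (auto simp: A1_def A2_def A3_def mem_l_coset)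
  have n: "a \<noteq> b" "b \<noteq> e" "e \<noteq> f" "f \<noteq> d" "d \<noteq> c" "c \<noteq> a"
  proof -
    show "a \<noteq> b" using ac(3) be(4) mA ac(2) by metis
    show "d \<noteq> c" using ac(1,3) df(4) mA by metis
    show "e \<noteq> f" using be(1,3) df(3,4) mA by metis
    show "b \<noteq> e" using be(3) z cc zc by auto
    show "f \<noteq> d" using df(3) z cc zc by auto
    show "c \<noteq> a" using ac(3) z cc zc by auto
  qed
  \<comment> \<open>Multiplying the three incidences za = z'c and cancelling z1 z2 z3 leaves the
    hexagon equation.\<close>
  have "z1 \<otimes> (z2 \<otimes> (z3 \<otimes> (a \<otimes> (e \<otimes> d)))) = (z1 \<otimes> a) \<otimes> ((z3 \<otimes> e) \<otimes> (z2 \<otimes> d))"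
    using zc cc by (simp only: m_ac m_closed)
  also have "\<dots> = (z2 \<otimes> c) \<otimes> ((z1 \<otimes> b) \<otimes> (z3 \<otimes> f))" using ac be df by simp
  also have "\<dots> = z1 \<otimes> (z2 \<otimes> (z3 \<otimes> (b \<otimes> (f \<otimes> c))))"
    using zc cc by (simp only: m_ac m_closed)
  finally have eq: "a \<otimes> (e \<otimes> d) = b \<otimes> (f \<otimes> c)" using zc cc by simp
  have "a \<noteq> e" by (rule hexagon[OF T(1-4) ac(1) be(1) ac(2) df(1) be(2) df(2) n eq])
  \<comment> \<open>The same hexagon read from other starting vertices.\<close>
  moreover have "e \<noteq> d"
    by (rule hexagon[OF T(1-4), of e f b a d c])
      (use ac be df n eq cc in \<open>auto simp: m_ac\<close>)
  moreover have "d \<noteq> a"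
    by (rule hexagon[OF T(1-4), of d c f e a b])
      (use ac be df n eq cc in \<open>auto simp: m_ac\<close>)
  ultimately have dist: "a \<noteq> e" "e \<noteq> d" "d \<noteq> a" by blast+
  have TT: "T = {e, a, d}" using triple_eq[OF T(2), of e a d] ac be df dist by auto
  have ce: "c = e" by (rule third_eq[OF T(2) ac(1) df(1)]) (use ac be df n dist in auto)
  have bd: "b = d" by (rule third_eq[OF T(2) ac(1) be(2)]) (use ac be df n dist in auto)
  let ?g = "z1 \<otimes> inv e"
  have 1: "?g \<otimes> e = z1" using zc cc by (simp add: m_assoc)
  have 2: "?g \<otimes> a = z2"
  proof -
    have "?g \<otimes> a = (z1 \<otimes> a) \<otimes> inv e" using zc cc by (simp add: m_ac)
    also have "z1 \<otimes> a = z2 \<otimes> e" using ac ce by simp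
    also have "z2 \<otimes> e \<otimes> inv e = z2" using zc cc by (simp add: m_assoc)
    finally show ?thesis .
  qed
  have 3: "?g \<otimes> d = z3"
  proof -
    have "?g \<otimes> d = (z1 \<otimes> d) \<otimes> inv e" using zc cc by (simp add: m_ac)
    also have "z1 \<otimes> d = z3 \<otimes> e" using be bd by simp
    also have "z3 \<otimes> e \<otimes> inv e = z3" using zc cc by (simp add: m_assoc)
    finally show ?thesis .
  qed
  have "Z = ?g <# T" unfolding TT z(1) by (simp add: l_coset_insert 1 2 3)
  then show ?thesis using zc cc by auto
qed

text \<open>A period g of B permutes the three boundary points. Starting from p, the points p, gp,
  g^2 p are distinct and exhaust the boundary, so g^3 p must be p.\<close>

lemma no_stabilizer:
  assumes B: "B \<subseteq> carrier G" "T \<subseteq> carrier G" "finite B" "finite T" "\<one> \<in> T"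
    and c: "card (B <#> T) = card B + 3" and g: "g \<in> carrier G" "g <# B = B"
    and o: "g \<noteq> \<one>" "g \<otimes> g \<noteq> \<one>" "g \<otimes> (g \<otimes> g) \<noteq> \<one>"
  shows False
proof -
  define D where "D = (B <#> T) - B"
  have BT: "B <#> T \<subseteq> carrier G" "finite (B <#> T)" "B \<subseteq> B <#> T" using B subset_set_mult by auto
  have "card D = 3" using c BT B by (simp add: D_def card_Diff_subset)
  have gBT: "g <# (B <#> T) = B <#> T" using g B by (simp add: set_mult_l_coset[symmetric])
  have gD: "g <# D = D" unfolding D_def using g gBT B BT by (simp add: l_coset_Diff)
  obtain p where p: "p \<in> D" using \<open>card D = 3\<close> by (metis card_3_iff insertI1)
  have pc: "p \<in> carrier G" using p BT by (auto simp: D_def)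
  have gm: "g \<otimes> x \<in> D" if "x \<in> D" for x using l_cosetI[OF that, of G g] gD by simp
  have q: "x \<otimes> p = p \<longleftrightarrow> x = \<one>" if "x \<in> carrier G" for x using that pc by simp
  have n1: "g \<otimes> p \<noteq> p" using q[OF g(1)] o by simp
  have n2: "g \<otimes> (g \<otimes> p) \<noteq> p" using q[of "g \<otimes> g"] o g pc by (simp add: m_assoc)
  have n3: "g \<otimes> (g \<otimes> (g \<otimes> p)) \<noteq> p" using q[of "g \<otimes> (g \<otimes> g)"] o g pc by (simp add: m_assoc)
  have gc: "g \<otimes> x = g \<otimes> y \<longleftrightarrow> x = y" if "x \<in> carrier G" "y \<in> carrier G" for x y using that g by simp
  have "D = {p, g \<otimes> p, g \<otimes> (g \<otimes> p)}"
    by (rule triple_eq[OF \<open>card D = 3\<close>]) (use p gm n1 n2 gc g pc in auto)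
  moreover have "g \<otimes> (g \<otimes> (g \<otimes> p)) \<in> D" using gm p by blast
  ultimately show False using n1 n2 n3 gc g pc by auto
qed

text \<open>Three sets meeting A in at most one point each can cover three points only by meeting it
  in three different points.\<close>

lemma redundant_triple:
  assumes f: "finite A" and c: "card A = 3" and s: "A \<subseteq> B \<union> C \<union> D"
    and i: "card (A \<inter> B) \<le> 1" "card (A \<inter> C) \<le> 1" "card (A \<inter> D) \<le> 1"
  shows "A \<inter> B \<noteq> {}" "A \<inter> C \<noteq> {}" "A \<inter> D \<noteq> {}" "A \<inter> B \<inter> D = {}"
proof -
  have "A = (A \<inter> B) \<union> (A \<inter> C) \<union> (A \<inter> D)" using s by blast
  then have u: "card A \<le> card ((A \<inter> B) \<union> (A \<inter> D)) + card (A \<inter> C)"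
    by (metis Un_assoc Un_commute card_Un_le)
  have w: "card ((A \<inter> B) \<union> (A \<inter> D)) + card (A \<inter> B \<inter> D) = card (A \<inter> B) + card (A \<inter> D)"
    using card_Un_Int[of "A \<inter> B" "A \<inter> D"] f by (simp add: Int_ac)
  have "card (A \<inter> B) \<noteq> 0" "card (A \<inter> C) \<noteq> 0" "card (A \<inter> D) \<noteq> 0" "card (A \<inter> B \<inter> D) = 0"
    using u w c i by linarith+
  then show "A \<inter> B \<noteq> {}" "A \<inter> C \<noteq> {}" "A \<inter> D \<noteq> {}" "A \<inter> B \<inter> D = {}" using f by auto
qed

text \<open>A subgroup H that is a 2-fragment satisfies 2|H| <= |HT| <= |H| + 2, so H = {1, h} with
  h an involution and T lies in H Un bH. The third element is then h or bh, and its square is that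
  of 1 or b.\<close>

lemma no_small_order_nondegenerate:
  assumes T: "based T" "card T = 3" "generate G T = carrier G" "no_small_order T" "kappa G 2 T \<le> 2"
  shows "\<not> degenerate G T"
proof
  assume "degenerate G T"
  then obtain H where H: "subgroup H G" "fragment G 2 T H" by (auto simp: degenerate_def)
  have Tc: "T \<subseteq> carrier G" "finite T" "\<one> \<in> T" using T by (auto simp: based_def)
  have sep: "k_separating G 2 T H" using H by (simp add: fragment_def)
  have Hc: "H \<subseteq> carrier G" "finite H" "2 \<le> card H" using sep by (auto simp: k_separating_def)
  have cHT: "card (H <#> T) \<le> card H + 2" using H T fragment_iff by simp
  have "H \<noteq> carrier G"
    using subset_ne_carrier[OF Hc(1) Tc(1) exterior_ne_carrier[OF T(1) sep]] Tc by auto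
  then obtain b where b: "b \<in> T" "b \<notin> H" using subgroup_eq_carrier[OF H(1) _ T(3)] by blast
  have bc: "b \<in> carrier G" using b Tc by blast
  have HT: "H <#> T = T <#> H" using set_mult_commute Hc Tc by blast
  have sub: "H \<union> (b <# H) \<subseteq> H <#> T"
    using l_coset_subset_set_mult[OF b(1), of H] subset_set_mult[OF Tc(3) Hc(1)] HT by simp
  have "H \<inter> (b <# H) = {}"
    using l_coset_subgroup_disjoint[OF H(1) one_closed bc] b Hc by simp
  then have c2: "card (H \<union> (b <# H)) = 2 * card H" using Hc bc by (simp add: card_Un_disjoint)
  then have cH: "card H = 2" using card_mono[OF _ sub] cHT Hc Tc by simp
  then have HTe: "H <#> T = H \<union> (b <# H)"
    using card_seteq[OF _ sub] c2 cHT Hc Tc by simp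
  obtain h where h: "H = {\<one>, h}" "h \<noteq> \<one>"
    using cH subgroup.one_closed[OF H(1)] by (metis card_2_iff doubleton_eq_iff insertE singletonD)
  have hc: "h \<in> carrier G" using h Hc by auto
  have "h \<otimes> h \<in> H" using subgroup.m_closed[OF H(1)] h by auto
  then have hh: "h \<otimes> h = \<one>" using h hc by auto
  have "b \<noteq> \<one>" using b h by auto
  obtain c where c: "c \<in> T" "c \<noteq> \<one>" "c \<noteq> b"
  proof -
    have "\<not> T \<subseteq> {\<one>, b}" using card_mono[of "{\<one>, b}" T] T(2) by (auto simp: card_insert_if split: if_splits)
    then show thesis using that by blast
  qed
  have "c \<in> H <#> T" using subset_set_mult_left[OF subgroup.one_closed[OF H(1)] Tc(1)] c by blast
  then have "c = h \<or> c = b \<otimes> h" using HTe h c bc by (auto simp: l_coset_insert)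
  then have "c \<otimes> c = \<one> \<otimes> \<one> \<or> c \<otimes> c = b \<otimes> b"
  proof
    assume "c = b \<otimes> h"
    then have "c \<otimes> c = (b \<otimes> b) \<otimes> (h \<otimes> h)" using bc hc by (simp add: m_ac)
    then show ?thesis using hh bc by simp
  qed (use hh in simp)
  then show False using T(4) c b Tc unfolding no_small_order_def by metis
qed

text \<open>The pair {1, g} must have a product of at least 5 elements, and |T Un gT| = 6 - |T Int
  gT|. The bound 8 = 6 + 2 makes the pair separating.\<close>

lemma thin_of_kappa:
  assumes T: "based T" "card T = 3" "kappa G 2 T = 3" and big: "finite (carrier G) \<Longrightarrow> 8 \<le> card (carrier G)"
  shows "thin 1 T"
  unfolding thin_def
proof (intro ballI impI)
  have Tc: "T \<subseteq> carrier G" "finite T" using T by (auto simp: based_def)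
  fix g assume g: "g \<in> carrier G" "g \<noteq> \<one>"
  have gT: "{\<one>, g} <#> T = T \<union> (g <# T)" using Tc by (simp add: set_mult_insert_left)
  have u: "card (T \<union> (g <# T)) + card (T \<inter> (g <# T)) = 6"
    using card_Un_Int[of T "g <# T"] Tc g T(2) by simp
  have "large 2 (exterior G T {\<one>, g})"
    by (rule large_exteriorI) (use Tc g gT u big in auto)
  then have "k_separating G 2 T {\<one>, g}" using g by (simp add: k_separating_iff)
  then have "5 \<le> card (T \<union> (g <# T))" using kappa_le[OF T(1)] gT T(3) g by fastforce
  then show "card (T \<inter> (g <# T)) \<le> 1" using u by linarith
qed

text \<open>If \<open>kappa\<close> at level 2 is at most 2, T is a progression. Otherwise levels 2
  and 4 both have value 3, and a 4-atom B is refuted: of size 4 because deletions from B would be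
  translates of T sharing two points, of larger size because redundancy forces |B| = 6 and a
  translate of T inside the intersection of B and yB.\<close>

theorem three_set_shape:
  assumes T: "based T" "card T = 3" "generate G T = carrier G" "no_small_order T"
    and X: "k_separating G 4 T X" "card (X <#> T) \<le> card X + 3"
  shows "short_shape T"
proof (rule ccontr)
  assume ns: "\<not> short_shape T"
  have Tc: "T \<subseteq> carrier G" "finite T" "\<one> \<in> T" using T by (auto simp: based_def)
  have Xc: "X \<subseteq> carrier G" "finite X" "4 \<le> card X" "large 4 (exterior G T X)"
    using X by (auto simp: k_separating_iff)
  have X2: "k_separating G 2 T X" using k_separating_le[OF X(1)] by simp
  have big: "8 \<le> card (carrier G)" if fin: "finite (carrier G)"
    using large_exteriorD[OF Xc(4) fin Tc(1) Xc(1)] card_set_mult_ge[OF Xc(1) Tc(1) Xc(2) Tc(2)] Tc Xc by fastforce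
  have k3: "3 \<le> kappa G 2 T"
  proof (rule ccontr)
    assume "\<not> 3 \<le> kappa G 2 T"
    then have k2: "kappa G 2 T \<le> 2" by simp
    have nd: "\<not> degenerate G T" by (rule no_small_order_nondegenerate[OF T k2])
    have "kappa G 2 T + 1 \<le> card T" "2 \<le> card T" using k2 T(2) by simp_all
    moreover have "2 * kappa G 2 T < card (carrier G)" if "finite (carrier G)"
      using big[OF that] k2 by linarith
    ultimately obtain r a where
      r: "r \<in> carrier G" "a \<in> carrier G" "T = (\<lambda>i::nat. a \<otimes> r [^] i) ` {..<card T}"
      using progression_of_kappa_2[OF T(1,3) nd X2] by metis
    have "{..<card T} = {0, 1, 2}" using T by auto
    then have "T = {a, r \<otimes> a, r \<otimes> (r \<otimes> a)}"
      using r by (simp add: numeral_2_eq_2 m_ac)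
    then show False using ns r unfolding short_shape_def by blast
  qed
  have k4: "kappa G 4 T \<le> 3" using kappa_le[OF T(1) X(1)] X(2) by linarith
  have k24: "kappa G 2 T \<le> kappa G 4 T" using kappa_mono[OF T(1) _ X(1)] by simp
  have k: "kappa G 2 T = 3" "kappa G 4 T = 3" using k3 k4 k24 by linarith+
  have thin: "thin 1 T" by (rule thin_of_kappa[OF T(1,2) k(1) big])
  note tri = triple_translate[OF Tc(1) T(2) ns T(4) thin]
  obtain B where B: "atom 4 T B" "\<one> \<in> B" using atom_exists[OF T(1) X(1)] by auto
  have Bf: "fragment G 4 T B" using B by (simp add: atom_def)
  have Bc: "B \<subseteq> carrier G" "finite B" "4 \<le> card B" "large 4 (exterior G T B)"
    using Bf by (auto simp: fragment_def k_separating_iff)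
  have cB: "card (B <#> T) = card B + 3" using Bf T(1) k fragment_iff by simp
  have B2: "fragment G 2 T B" by (rule fragment_le[OF T(1) Bf]) (use k in auto)
  show False
  proof (cases "card B = 4")
    case True
    \<comment> \<open>As |BT| = 4 + 3 = 7, these are the points whose deletion leaves BT
      unchanged.\<close>
    define R where "R = {z \<in> B. 7 \<le> card ((B - {z}) <#> T)}"
    have "card R < 3"
    proof (rule ccontr)
      assume "\<not> card R < 3"
      then have "3 \<le> card R" by simp
      then obtain R' where R': "R' \<subseteq> R" "card R' = 3" by (rule obtain_subset_with_card_n)
      then obtain z1 z2 z3 where z: "R' = {z1, z2, z3}" "z1 \<noteq> z2" "z1 \<noteq> z3" "z2 \<noteq> z3"
        by (metis card_3_iff)
      have zB: "z1 \<in> B" "z2 \<in> B" "z3 \<in> B" using z R' by (auto simp: R_def)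
      have "card (B - {z1, z2, z3}) = 1" using True zB z by (subst card_Diff_subset) auto
      then obtain z4 where z4: "B - {z1, z2, z3} = {z4}" by (auto simp: card_1_singleton_iff)
      have Be: "B = {z1, z2, z3, z4}" "z4 \<notin> {z1, z2, z3}" using z4 zB by auto
      define A where "A z = z <# T" for z
      have zc: "z \<in> carrier G" if "z \<in> B" for z using that Bc by blast
      have fA: "finite (A z)" for z using Tc by (simp add: A_def)
      have cA: "card (A z) = 3" if "z \<in> B" for z using zc[OF that] Tc T(2) by (simp add: A_def)
      have iA: "card (A z \<inter> A z') \<le> 1" if "z \<in> B" "z' \<in> B" "z \<noteq> z'" for z z'
        unfolding A_def by (rule thin_inter[OF Tc(1,2) thin zc zc]) (use that in auto)
      have all: "B <#> T = A z1 \<union> A z2 \<union> A z3 \<union> A z4"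
        unfolding Be(1) by (simp add: set_mult_insert_left A_def Un_assoc)
      have redu: "(B - {z}) <#> T = B <#> T" if "z \<in> R" for z
      proof (rule card_seteq)
        show "(B - {z}) <#> T \<subseteq> B <#> T" by (rule mono_set_mult) auto
        show "card (B <#> T) \<le> card ((B - {z}) <#> T)" using that cB True by (simp add: R_def)
      qed (use Bc Tc in simp)
      have b1: "B - {z1} = {z2, z3, z4}" "B - {z2} = {z1, z3, z4}" "B - {z3} = {z1, z2, z4}"
        using Be z by auto
      have "A z1 \<subseteq> A z2 \<union> A z3 \<union> A z4"
        using redu[of z1] all z(1) R'(1) by (auto simp: b1 set_mult_insert_left A_def)
      note r1 = redundant_triple[OF fA cA[OF zB(1)] this iA iA iA]
      have "A z2 \<subseteq> A z1 \<union> A z3 \<union> A z4"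
        using redu[of z2] all z(1) R'(1) by (auto simp: b1 set_mult_insert_left A_def)
      note r2 = redundant_triple[OF fA cA[OF zB(2)] this iA iA iA]
      have ne: "A z1 \<inter> A z2 \<noteq> {}" "A z1 \<inter> A z4 \<noteq> {}" "A z2 \<inter> A z4 \<noteq> {}" "A z1 \<inter> A z2 \<inter> A z4 = {}"
        using r1(1,3,4) r2(3) Be z by auto
      \<comment> \<open>The translates by z1, z2, z4 meet pairwise but have no common point, so
        their union has at most 9 - 3 = 6 elements, contrary to z3 being in R.\<close>
      let ?U = "A z1 \<union> A z2"
      have "card (A z1 \<inter> A z2) \<noteq> 0" using ne fA by simp
      moreover have "card ?U + card (A z1 \<inter> A z2) = 6"
        using card_Un_Int[OF fA fA, of z1 z2] cA zB by simp
      ultimately have u: "card ?U \<le> 5" by linarith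
      have e: "?U \<inter> A z4 = (A z1 \<inter> A z4) \<union> (A z2 \<inter> A z4)" by blast
      have "card ((A z1 \<inter> A z4) \<union> (A z2 \<inter> A z4)) = card (A z1 \<inter> A z4) + card (A z2 \<inter> A z4)"
        by (rule card_Un_disjoint) (use fA ne in auto)
      moreover have "card (A z1 \<inter> A z4) \<noteq> 0" "card (A z2 \<inter> A z4) \<noteq> 0" using ne fA by simp_all
      ultimately have "2 \<le> card (?U \<inter> A z4)" using e by simp
      moreover have "card (?U \<union> A z4) + card (?U \<inter> A z4) = card ?U + 3"
        using card_Un_Int[of ?U "A z4"] fA cA[of z4] Be by simp
      ultimately have "card (?U \<union> A z4) \<le> 6" using u by linarith
      moreover have "(B - {z3}) <#> T = ?U \<union> A z4"
        by (simp add: b1 set_mult_insert_left A_def Un_assoc)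
      moreover have "z3 \<in> R" using z R' by auto
      ultimately show False by (simp add: R_def)
    qed
    moreover have "card B = card R + card (B - R)"
      using Bc by (metis R_def card_Int_Diff Collect_conj_eq Collect_mem_eq inf.idem inf_left_idem)
    ultimately have "2 \<le> card (B - R)" using True by linarith
    then obtain R' where R': "R' \<subseteq> B - R" "card R' = 2" by (rule obtain_subset_with_card_n)
    then obtain z z' where z: "R' = {z, z'}" "z \<noteq> z'" by (meson card_2_iff)
    have zB: "z \<in> B" "z' \<in> B" "z \<notin> R" "z' \<notin> R" using z R' by auto
    \<comment> \<open>Deleting a point outside R leaves a triple with product of size at most 6,
      hence a translate of T. Two such triples share two points, against
      \<open>thin 1\<close>.\<close>
    have t: "\<exists>g\<in>carrier G. B - {w} = g <# T" if "w \<in> B" "w \<notin> R" for w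
      by (rule tri) (use that Bc True in \<open>auto simp: R_def\<close>)
    obtain g where g: "g \<in> carrier G" "B - {z} = g <# T" using t zB by blast
    obtain h where h: "h \<in> carrier G" "B - {z'} = h <# T" using t zB by blast
    have "g \<noteq> h" using g h zB z by auto
    then have "card ((g <# T) \<inter> (h <# T)) \<le> 1" using thin_inter[OF Tc(1,2) thin g(1) h(1)] by simp
    moreover have "(g <# T) \<inter> (h <# T) = B - {z, z'}" using g h by auto
    moreover have "card (B - {z, z'}) = 2" using True zB z by (subst card_Diff_subset) auto
    ultimately show False by simp
  next
    case False
    then have b5: "4 < card B" using Bc by linarith
    obtain x y where xy: "T = {\<one>, x, y}" "x \<noteq> \<one>" "y \<noteq> \<one>" "x \<noteq> y"
    proof -
      have "card (T - {\<one>}) = 2" using T(2) Tc by simp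
      then obtain x y where "T - {\<one>} = {x, y}" "x \<noteq> y" by (meson card_2_iff)
      then show thesis using that[of x y] Tc by blast
    qed
    have c: "x \<in> carrier G" "y \<in> carrier G" using xy Tc by auto
    \<comment> \<open>Four common points would make v/u a period of the 4-atom B;
      \<open>no_small_order\<close> rules out the orders 2 and 3 that \<open>no_stabilizer\<close>
      leaves open.\<close>
    have i3: "card ((u <# B) \<inter> (v <# B)) \<le> 3" if uv: "u \<in> T" "v \<in> T" "u \<noteq> v" for u v
    proof (rule ccontr)
      assume n: "\<not> ?thesis"
      have uc: "u \<in> carrier G" "v \<in> carrier G" using uv Tc by auto
      let ?g = "inv u \<otimes> v"
      have g: "?g \<in> carrier G" using uc by simp
      have ug: "u \<otimes> ?g = v" using uc by (simp add: m_assoc[symmetric])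
      have "(u <# B) \<inter> (v <# B) = u <# (B \<inter> (?g <# B))"
        using uc Bc g ug by (simp add: l_coset_Int l_coset_l_coset)
      moreover have "card (u <# (B \<inter> (?g <# B))) = card (B \<inter> (?g <# B))"
        by (rule card_l_coset) (use uc Bc in auto)
      ultimately have "4 \<le> card (B \<inter> (?g <# B))" using n by simp
      then have gB: "?g <# B = B" using atom_translate[OF T(1) B(1) g] by simp
      have "?g \<noteq> \<one>" using ug uc uv by auto
      moreover have "?g \<otimes> ?g \<noteq> \<one>" "?g \<otimes> (?g \<otimes> ?g) \<noteq> \<one>"
        using no_small_orderD[OF T(4) uv(1) _ calculation g Tc(1)] ug uv uc g
        by (simp_all add: m_comm[of ?g u] m_assoc[OF g g g, symmetric])
      ultimately show False
        using no_stabilizer[OF Bc(1) Tc(1) Bc(2) Tc(2,3) cB g gB] by blast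
    qed
    define Bx where "Bx = x <# B"
    define By where "By = y <# B"
    have f: "finite Bx" "finite By" "card Bx = card B" "card By = card B"
      using c Bc by (auto simp: Bx_def By_def)
    have BT: "B <#> T = B \<union> Bx \<union> By"
      using set_mult_commute[OF Bc(1) Tc(1)] Bc by (simp add: xy set_mult_insert_left Bx_def By_def Un_assoc)
    \<comment> \<open>Redundancy of b gives tb a second representation, which by cancellation must
      use another element of T.\<close>
    have red: "t <# B \<subseteq> (T - {t}) <#> B" if "t \<in> T" for t
    proof
      fix w assume "w \<in> t <# B"
      then obtain b where b: "b \<in> B" "w = t \<otimes> b" by (auto simp: mem_l_coset)
      have c: "b \<in> carrier G" "t \<in> carrier G" using b that Bc Tc by auto
      then have w: "w = b \<otimes> t" using b by (simp add: m_comm)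
      then have "w \<in> (B - {b}) <#> T"
        using atom_redundant[OF T(1) B(1) b(1) b5] b that by (simp add: set_multI)
      then obtain b' t' where b': "b' \<in> B" "b' \<noteq> b" "t' \<in> T" "w = b' \<otimes> t'"
        by (auto simp: mem_set_mult)
      have c': "b' \<in> carrier G" "t' \<in> carrier G" using b' Bc Tc by auto
      then have "t' \<noteq> t" "w = t' \<otimes> b'" using b' c w by (auto simp: m_comm)
      then show "w \<in> (T - {t}) <#> B" using b' by (auto intro: set_multI)
    qed
    have "T - {\<one>} = {x, y}" "T - {x} = {\<one>, y}" "T - {y} = {\<one>, x}" using xy by auto
    then have r0: "B \<subseteq> Bx \<union> By" and rx: "Bx \<subseteq> B \<union> By" and ry: "By \<subseteq> B \<union> Bx"
      using red[of \<one>] red[of x] red[of y] xy Bc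
      by (simp_all add: set_mult_insert_left Bx_def By_def)
    have "B <#> T = Bx \<union> By" "B <#> T = B \<union> By" "B <#> T = B \<union> Bx" using BT r0 rx ry by auto
    then have u: "card (Bx \<union> By) = card B + 3" "card (B \<union> By) = card B + 3" "card (B \<union> Bx) = card B + 3"
      using cB by simp_all
    have i: "card (Bx \<inter> By) + 3 = card B" "card (B \<inter> By) + 3 = card B" "card (B \<inter> Bx) + 3 = card B"
      using card_Un_Int[OF f(1,2)] card_Un_Int[OF Bc(2) f(2)] card_Un_Int[OF Bc(2) f(1)] u f by linarith+
    have le3: "card (B \<inter> By) \<le> 3" using i3[of \<one> y] xy Bc by (simp add: By_def)
    have "B = (B \<inter> Bx) \<union> (B \<inter> By)" using r0 by blast
    then have "card B + card (B \<inter> Bx \<inter> By) = card (B \<inter> Bx) + card (B \<inter> By)"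
      using card_Un_Int[of "B \<inter> Bx" "B \<inter> By"] Bc by (simp add: Int_ac)
    \<comment> \<open>With t the size of the triple intersection, the counts give |B| = 6 + t and |B
      Int By| = 3 + t; the bound 3 leaves t = 0.\<close>
    then have c3: "card (B \<inter> By) = 3" and t0: "card (B \<inter> Bx \<inter> By) = 0" using i le3 by linarith+
    have t: "B \<inter> Bx \<inter> By = {}" using t0 Bc by simp
    have yB: "fragment G 4 T By" using fragment_l_coset[OF T(1) Bf c(2)] by (simp add: By_def)
    have yB2: "fragment G 2 T By" by (rule fragment_le[OF T(1) yB]) (use k in auto)
    \<comment> \<open>Uncrossing at level 2 makes the three-point intersection a fragment, hence a
      translate gT. Then gx lies in B, in xB since g is in B, and in yB, although these have no
      common point.\<close>
    have "fragment G 2 T (B \<inter> By)"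
      by (rule uncross(1)[OF T(1) B2 yB2 _ atom_le_exterior[OF T(1) B(1) yB]]) (use c3 in simp)
    then have "card ((B \<inter> By) <#> T) \<le> 6" using fragment_iff[OF T(1)] c3 k by simp
    then obtain g where g: "g \<in> carrier G" "B \<inter> By = g <# T"
      using tri[of "B \<inter> By"] Bc c3 by auto
    have "g \<otimes> \<one> \<in> g <# T" "g \<otimes> x \<in> g <# T" using xy by (auto intro: l_cosetI)
    then have "g \<in> B" "g \<otimes> x \<in> B \<inter> By" using g by auto
    then have "g \<otimes> x \<in> B \<inter> Bx \<inter> By"
      using l_cosetI[of g B G x] c g(1) by (auto simp: Bx_def m_comm)
    then show False using t by blast
  qed
qed


section \<open>The exceptional group of order ten, and short shapes as progressions\<close>

lemma ratio_eq_iff: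
  assumes "a \<in> carrier G" "b \<in> carrier G" "c \<in> carrier G" "d \<in> carrier G"
  shows "a \<otimes> inv b = c \<otimes> inv d \<longleftrightarrow> a \<otimes> d = c \<otimes> b"
proof -
  have "(a \<otimes> inv b) \<otimes> (b \<otimes> d) = (b \<otimes> inv b) \<otimes> (a \<otimes> d)"
    using assms by (simp only: m_ac m_closed inv_closed)
  moreover have "(c \<otimes> inv d) \<otimes> (b \<otimes> d) = (d \<otimes> inv d) \<otimes> (c \<otimes> b)"
    using assms by (simp only: m_ac m_closed inv_closed)
  moreover have "a \<otimes> inv b = c \<otimes> inv d \<longleftrightarrow> (a \<otimes> inv b) \<otimes> (b \<otimes> d) = (c \<otimes> inv d) \<otimes> (b \<otimes> d)"
    using assms by simp
  ultimately show ?thesis using assms by simp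
qed

text \<open>The equation is a^2 d = b^2 c. Every way in which the four elements can coincide inside
  a three-element set reduces it to a relation already excluded.\<close>

lemma square_ratio_notin:
  assumes T: "T \<subseteq> carrier G" "card T = 3" "\<not> short_shape T" "no_small_order T"
    and a: "a \<in> T" "b \<in> T" "a \<noteq> b" and c: "c \<in> T" "d \<in> T" "c \<noteq> d"
  shows "(a \<otimes> a) \<otimes> inv (b \<otimes> b) \<noteq> c \<otimes> inv d"
proof
  assume e: "(a \<otimes> a) \<otimes> inv (b \<otimes> b) = c \<otimes> inv d"
  have cc: "a \<in> carrier G" "b \<in> carrier G" "c \<in> carrier G" "d \<in> carrier G" using T a c by auto
  then have e': "a \<otimes> (a \<otimes> d) = b \<otimes> (b \<otimes> c)" using e by (simp add: ratio_eq_iff) (simp add: m_ac)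
  show False
  proof (cases "d = a \<or> c = b")
    case True
    then show False
      using no_relation[OF T a(1,2) c(1)] no_relation[OF T a(2,1) c(2)] e' a c by auto
  next
    case False
    show False
    proof (cases "d = b")
      case True
      then have "b \<otimes> (a \<otimes> a) = b \<otimes> (b \<otimes> c)" using e' cc by (simp add: m_ac)
      then have aa: "a \<otimes> a = b \<otimes> c" using cc by simp
      then have "c \<noteq> a" using a cc by auto
      then show False using no_middle[OF T(1-3) a(1,2) c(1)] aa a False by auto
    next
      case db: False
      have ca: "c = a"
        by (rule third_eq[OF T(2) a(2) c(2) _ c(1) _ _ a(1)]) (use db False a c in auto)
      then have "a \<otimes> (a \<otimes> d) = a \<otimes> (b \<otimes> b)" using e' cc by (simp add: m_ac)
      then have "b \<otimes> b = a \<otimes> d" using cc by simp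
      then show False using no_middle[OF T(1-3) a(2,1) c(2)] a db False by auto
    qed
  qed
qed

text \<open>By the Sidon property the quotients of T fill six non-trivial elements, leaving three
  others. The quotients of squares must lie among these three, which is too few unless each square
  is the midpoint of the other two. That gives a quotient of squares with trivial third and fifth
  power.\<close>

lemma short_shape_of_order_10:
  assumes T: "T \<subseteq> carrier G" "card T = 3" "no_small_order T" "thin 1 T" and o: "card (carrier G) = 10"
  shows "short_shape T"
proof (rule ccontr)
  assume ns: "\<not> short_shape T"
  have fT: "finite T" using T(2) by (metis card.infinite zero_neq_numeral)
  have fG: "finite (carrier G)" using o by (metis card.infinite zero_neq_numeral)
  obtain p q s where t: "T = {p, q, s}" "p \<noteq> q" "p \<noteq> s" "q \<noteq> s" using T(2) by (metis card_3_iff)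
  have c: "p \<in> carrier G" "q \<in> carrier G" "s \<in> carrier G" using t T by auto
  let ?O = "{(a, b). a \<in> T \<and> b \<in> T \<and> a \<noteq> b}"
  define D where "D = (\<lambda>(a, b). a \<otimes> inv b) ` ?O"
  have "?O = {(p, q), (p, s), (q, p), (q, s), (s, p), (s, q)}" using t by auto
  then have "card ?O = 6" using t by simp
  then have cD: "card D = 6" unfolding D_def using card_image[OF thin_diff_inj[OF T(1) fT T(4)]] by simp
  have Dc: "D \<subseteq> carrier G" using T by (auto simp: D_def)
  have inv_ne: "a \<otimes> inv b \<noteq> \<one>" if "a \<in> carrier G" "b \<in> carrier G" "a \<noteq> b" for a b
    using that by (metis inv_equality inv_inv inv_closed)
  have "\<one> \<notin> D"
  proof
    assume "\<one> \<in> D"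
    then obtain a b where "a \<in> T" "b \<in> T" "a \<noteq> b" "\<one> = a \<otimes> inv b" by (auto simp: D_def)
    then show False using inv_ne[of a b] T(1) by auto
  qed
  define R where "R = carrier G - insert \<one> D"
  have "card (insert \<one> D) = 7" using cD \<open>\<one> \<notin> D\<close> Dc fG by (simp add: finite_subset)
  then have cR: "card R = 3"
    unfolding R_def using Dc fG o by (subst card_Diff_subset) (auto simp: finite_subset)
  define \<rho> where "\<rho> a b = (a \<otimes> a) \<otimes> inv (b \<otimes> b)" for a b
  have sq: "a \<otimes> a \<noteq> b \<otimes> b" if "a \<in> T" "b \<in> T" "a \<noteq> b" for a b
    using that T(3) unfolding no_small_order_def by metis
  have \<rho>R: "\<rho> a b \<in> R" if ab: "a \<in> T" "b \<in> T" "a \<noteq> b" for a b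
  proof -
    have "\<rho> a b \<notin> D" using square_ratio_notin[OF T(1,2) ns T(3) ab] by (auto simp: D_def \<rho>_def)
    moreover have "\<rho> a b \<noteq> \<one>" unfolding \<rho>_def by (rule inv_ne) (use sq ab T in auto)
    ultimately show ?thesis using ab T by (auto simp: R_def \<rho>_def)
  qed
  \<comment> \<open>The quotient of squares is the square of a/b, and tenth powers are
    trivial.\<close>
  have p5: "x [^] (5::nat) = \<one>" if x: "x = \<rho> a b" "a \<in> T" "b \<in> T" for x a b
  proof -
    let ?y = "a \<otimes> inv b"
    have c: "a \<in> carrier G" "b \<in> carrier G" using x T by auto
    have "x = ?y [^] (2::nat)" using c x by (simp add: \<rho>_def inv_mult m_ac numeral_2_eq_2)
    then have "x [^] (5::nat) = ?y [^] (10::nat)" using c by (simp add: nat_pow_pow)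
    then show ?thesis using pow_order_eq_1[of ?y] c o by (simp add: order_def)
  qed
  have x1: "x = \<one>" if x: "x [^] (5::nat) = \<one>" "x \<otimes> x = \<one> \<or> x \<otimes> (x \<otimes> x) = \<one>" "x \<in> carrier G" for x
  proof -
    have "x [^] (2::nat) = x \<otimes> x" "x [^] (3::nat) = x \<otimes> (x \<otimes> x)"
      using x(3) by (simp_all add: numeral_2_eq_2 numeral_3_eq_3 m_assoc)
    then have "(x [^] (2::nat)) [^] (3::nat) = \<one> \<or> (x [^] (3::nat)) [^] (2::nat) = \<one>" using x(2) by auto
    then have "x [^] (5 + 1 :: nat) = \<one>" using x(3) by (simp add: nat_pow_pow)
    then show ?thesis using x nat_pow_mult[OF x(3), of 5 1] by simp
  qed
  \<comment> \<open>If the squares of a and e were not symmetric about that of b, their ratios with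
    it in both directions would be four distinct elements of the three-element set R.\<close>
  have key: "(a \<otimes> a) \<otimes> (e \<otimes> e) = (b \<otimes> b) \<otimes> (b \<otimes> b)"
    if m: "a \<in> T" "b \<in> T" "e \<in> T" "a \<noteq> b" "a \<noteq> e" "b \<noteq> e" for a b e
  proof (rule ccontr)
    assume n: "\<not> ?thesis"
    have cc: "a \<otimes> a \<in> carrier G" "b \<otimes> b \<in> carrier G" "e \<otimes> e \<in> carrier G" using m T by auto
    have inv\<rho>: "\<rho> u v \<noteq> \<rho> v u" if uv: "u \<in> T" "v \<in> T" "u \<noteq> v" for u v
    proof
      assume eq: "\<rho> u v = \<rho> v u"
      have uc: "u \<otimes> u \<in> carrier G" "v \<otimes> v \<in> carrier G" using uv T by auto
      have rc: "\<rho> u v \<in> carrier G" using uc by (simp add: \<rho>_def)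
      have "\<rho> u v \<otimes> \<rho> v u = ((u \<otimes> u) \<otimes> inv (u \<otimes> u)) \<otimes> ((v \<otimes> v) \<otimes> inv (v \<otimes> v))"
        unfolding \<rho>_def using uc by (simp only: m_ac m_closed inv_closed)
      then have "\<rho> u v \<otimes> \<rho> u v = \<one>" using eq uc by simp
      then have "\<rho> u v = \<one>" using x1[OF p5[OF refl uv(1,2)] _ rc] by simp
      then show False using inv_ne[OF uc sq[OF uv]] by (simp add: \<rho>_def)
    qed
    have ae: "a \<otimes> a \<noteq> e \<otimes> e" using sq m by blast
    have "\<rho> a b \<noteq> \<rho> b e" unfolding \<rho>_def ratio_eq_iff[OF cc(1,2,2,3)] by (rule n)
    moreover have "\<rho> b a \<noteq> \<rho> e b"
      unfolding \<rho>_def ratio_eq_iff[OF cc(2,1,3,2)] m_comm[OF cc(3,1)] by (rule not_sym[OF n])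
    moreover have "\<rho> a b \<noteq> \<rho> e b"
      unfolding \<rho>_def ratio_eq_iff[OF cc(1,2,3,2)] right_cancel[OF cc(2,1,3)] by (rule ae)
    moreover have "\<rho> b a \<noteq> \<rho> b e"
      unfolding \<rho>_def ratio_eq_iff[OF cc(2,1,2,3)] m_comm[OF cc(2,3)] m_comm[OF cc(2,1)]
        right_cancel[OF cc(2,3,1)] by (rule not_sym[OF ae])
    ultimately have d: "\<rho> a b \<noteq> \<rho> b e" "\<rho> b a \<noteq> \<rho> e b" "\<rho> a b \<noteq> \<rho> e b" "\<rho> b a \<noteq> \<rho> b e"
      by blast+
    have "card {\<rho> a b, \<rho> b a, \<rho> e b, \<rho> b e} = 4"
      using d inv\<rho>[of a b] inv\<rho>[of e b] m by auto
    moreover have "{\<rho> a b, \<rho> b a, \<rho> e b, \<rho> b e} \<subseteq> R" using \<rho>R m by auto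
    ultimately show False using card_mono[of R "{\<rho> a b, \<rho> b a, \<rho> e b, \<rho> b e}"] cR fG by (simp add: R_def)
  qed
  define P where "P = p \<otimes> p"
  define Q where "Q = q \<otimes> q"
  define V where "V = s \<otimes> s"
  have cc: "P \<in> carrier G" "Q \<in> carrier G" "V \<in> carrier G" using c by (auto simp: P_def Q_def V_def)
  have k1: "P \<otimes> V = Q \<otimes> Q" and k2: "P \<otimes> Q = V \<otimes> V"
    using key[of p q s] key[of p s q] t by (auto simp: P_def Q_def V_def)
  have "P \<otimes> (V \<otimes> (V \<otimes> V)) = (P \<otimes> V) \<otimes> (V \<otimes> V)" using cc by (simp add: m_assoc)
  also have "\<dots> = (Q \<otimes> Q) \<otimes> (P \<otimes> Q)" using k1 k2 by simp
  also have "\<dots> = P \<otimes> (Q \<otimes> (Q \<otimes> Q))" using cc by (simp only: m_ac m_closed)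
  finally have VQ: "V \<otimes> (V \<otimes> V) = Q \<otimes> (Q \<otimes> Q)" using cc by simp
  let ?x = "V \<otimes> inv Q"
  have "?x \<otimes> (?x \<otimes> ?x) = (V \<otimes> (V \<otimes> V)) \<otimes> inv (Q \<otimes> (Q \<otimes> Q))"
    using cc by (simp only: m_ac m_closed inv_closed inv_mult)
  then have "?x \<otimes> (?x \<otimes> ?x) = \<one>" using VQ cc by simp
  moreover have "?x = \<rho> s q" by (simp add: \<rho>_def V_def Q_def)
  moreover have "?x \<in> carrier G" using cc by simp
  ultimately have "?x = \<one>" using x1[OF p5[of ?x s q]] t by simp
  then show False using inv_ne[of V Q] cc sq[of s q] t by (auto simp: V_def Q_def)
qed

text \<open>As the neutral element is one of the terms, g is a power of r up to inversion, so all of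
  T lies in the group generated by r.\<close>

lemma shape_generates:
  assumes T: "\<one> \<in> T" "generate G T = carrier G" and g: "g \<in> carrier G" "r \<in> carrier G"
    and s: "T \<subseteq> {g, r \<otimes> g, r \<otimes> (r \<otimes> g), r \<otimes> (r \<otimes> (r \<otimes> g))}"
  shows "generate G {r} = carrier G"
proof -
  let ?R = "generate G {r}"
  have R: "subgroup ?R G" using g by (intro generate_is_subgroup) auto
  have r: "r \<in> ?R" by (rule generate.incl) simp
  have down: "x \<in> ?R" if "r \<otimes> x \<in> ?R" "x \<in> carrier G" for x
  proof -
    have "inv r \<otimes> (r \<otimes> x) \<in> ?R"
      using that r subgroup.m_closed[OF R] subgroup.m_inv_closed[OF R] by blast
    then show ?thesis using that g by (simp add: m_assoc[symmetric])
  qed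
  have one: "\<one> \<in> ?R" using subgroup.one_closed[OF R] .
  consider "\<one> = g" | "\<one> = r \<otimes> g" | "\<one> = r \<otimes> (r \<otimes> g)" | "\<one> = r \<otimes> (r \<otimes> (r \<otimes> g))"
    using s T(1) by blast
  then have "g \<in> ?R"
  proof cases
    case 1 then show ?thesis using one by simp
  next
    case 2 then show ?thesis using one down[of g] g by simp
  next
    case 3 then show ?thesis using one down[of g] down[of "r \<otimes> g"] g by simp
  next
    case 4 then show ?thesis using one down[of g] down[of "r \<otimes> g"] down[of "r \<otimes> (r \<otimes> g)"] g by simp
  qed
  then have "T \<subseteq> ?R" using s r subgroup.m_closed[OF R] by blast
  then show ?thesis using subgroup_eq_carrier[OF R] T by blast
qed

lemma rj_progression_short_shape:
  assumes T: "based T" "card T = 3" "generate G T = carrier G" "short_shape T" "T \<noteq> carrier G"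
  shows "\<exists>r\<in>carrier G. rj_progression G r (-1) T"
proof -
  have Tc: "T \<subseteq> carrier G" "finite T" "\<one> \<in> T" using T by (auto simp: based_def)
  obtain g r where g: "g \<in> carrier G" "r \<in> carrier G"
    and s: "T = {g, r \<otimes> g, r \<otimes> (r \<otimes> g)} \<or> T = {g, r \<otimes> g, r \<otimes> (r \<otimes> (r \<otimes> g))}"
    using T(4) unfolding short_shape_def by blast
  have gen: "generate G {r} = carrier G"
    by (rule shape_generates[OF Tc(3) T(3) g]) (use s in auto)
  let ?f = "\<lambda>i::nat. g \<otimes> r [^] i"
  have f: "?f 0 = g" "?f 1 = r \<otimes> g" "?f 2 = r \<otimes> (r \<otimes> g)" "?f 3 = r \<otimes> (r \<otimes> (r \<otimes> g))"
    using g by (simp_all add: numeral_2_eq_2 numeral_3_eq_3 m_ac)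
  have i: "{..<3::nat} = {0, 1, 2}" "{..<4::nat} = {0, 1, 2, 3}" by auto
  from s show ?thesis
  proof
    assume "T = {g, r \<otimes> g, r \<otimes> (r \<otimes> g)}"
    then have "T = ?f ` {..<3}" unfolding i using f by simp
    then show ?thesis
      using rj_progression_of_progression[OF g(2) gen Tc(2) _ T(5) g(1)] Tc g by blast
  next
    assume t: "T = {g, r \<otimes> g, r \<otimes> (r \<otimes> (r \<otimes> g))}"
    then have d: "g \<noteq> r \<otimes> g" "g \<noteq> r \<otimes> (r \<otimes> (r \<otimes> g))" "r \<otimes> g \<noteq> r \<otimes> (r \<otimes> (r \<otimes> g))"
      using T(2) by (auto simp: card_insert_if split: if_splits)
    \<comment> \<open>The skipped term r^2 g is the single deleted element of a four-term
      progression.\<close>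
    then have "r \<otimes> (r \<otimes> g) \<notin> T" using t g by auto
    then have "card (insert (r \<otimes> (r \<otimes> g)) T) = card T + 1" using Tc by simp
    moreover have "?f ` {..<4} = insert (r \<otimes> (r \<otimes> g)) T" unfolding i t using f by auto
    ultimately show ?thesis
      using rj_progression_subset[OF g(1), of T r 4] g by auto
  qed
qed

section \<open>Absent separating sets and the case \<mu> = 1\<close>

lemma k_separating_infinite:
  assumes "infinite (carrier G)" "finite S"
  shows "\<exists>X. k_separating G k S X"
proof -
  obtain X where "X \<subseteq> carrier G" "finite X" "card X = k"
    using infinite_arbitrarily_large[OF assms(1)] by blast
  then have "k_separating G k S X"
    using infinite_exterior[OF assms(1,2)] by (simp add: k_separating_def)
  then show ?thesis by blast
qed

lemma kappa_no_separating:
  assumes "\<nexists>X. k_separating G k S X" "finite S"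
  shows "finite (carrier G)" "kappa G k S = card (carrier G) + 1 - 2 * k"
  using assms k_separating_infinite by (auto simp: kappa_def order_def)

text \<open>Let p and q be the two missing points and r = q/p, a generator since 5 is prime. As the
  r-predecessor p of q is missing, S Un rS avoids q and has at most 4 = |S| + 1 elements.\<close>

lemma progression_order_5:
  assumes S: "S \<subseteq> carrier G" "card S = 3" and o: "card (carrier G) = 5"
  shows "\<exists>r\<in>carrier G. \<exists>a\<in>carrier G. S = (\<lambda>i::nat. a \<otimes> r [^] i) ` {..<card S}"
proof -
  have fG: "finite (carrier G)" using o by (metis card.infinite zero_neq_numeral)
  have fS: "finite S" using S fG finite_subset by blast
  have "card (carrier G - S) = 2" using S fS o by (simp add: card_Diff_subset)
  then obtain p q where pq: "carrier G - S = {p, q}" "p \<noteq> q" by (meson card_2_iff)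
  have c: "p \<in> carrier G" "q \<in> carrier G" "p \<notin> S" "q \<notin> S" using pq by auto
  let ?r = "q \<otimes> inv p"
  have r: "?r \<in> carrier G" using c by simp
  have rp: "?r \<otimes> p = q" using c by (simp add: m_assoc)
  have r1: "?r \<noteq> \<one>" using rp c pq by auto
  let ?R = "generate G {?r}"
  have R: "subgroup ?R G" using r by (intro generate_is_subgroup) auto
  have fR: "finite ?R" using fG subgroup.subset[OF R] finite_subset by blast
  have "2 \<le> card ?R" by (rule two_le_card_subgroup[OF R fR _ r1]) (rule generate.incl, simp)
  moreover have "card ?R dvd 5" using lagrange[OF R] o by (metis dvd_triv_right order_def)
  moreover have "n = 5" if "2 \<le> n" "n dvd 5" for n :: nat
  proof -
    have "n \<le> 5" using that by (simp add: dvd_imp_le)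
    then have "n \<in> {2, 3, 4, 5}" using that by auto
    then show ?thesis using that(2) by auto
  qed
  ultimately have "card ?R = 5" by blast
  then have gen: "?R = carrier G" using card_seteq[OF fG subgroup.subset[OF R]] o by simp
  have "q \<notin> ?r <# S"
  proof
    assume "q \<in> ?r <# S"
    then obtain s where s: "s \<in> S" "?r \<otimes> p = ?r \<otimes> s" using rp by (auto simp: mem_l_coset)
    then have "p = s" using r c S by (metis Units_eq Units_l_cancel subsetD)
    then show False using s c by simp
  qed
  then have "S \<union> (?r <# S) \<subseteq> carrier G - {q}" using l_coset_closed[OF r S(1)] S(1) c(4) by blast
  then have "card (S \<union> (?r <# S)) \<le> card (carrier G - {q})" using fG by (intro card_mono) auto
  then have b: "card (S \<union> (?r <# S)) \<le> card S + 1" using o c S by simp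
  have "S \<noteq> {}" "S \<noteq> carrier G" using S o by auto
  then show ?thesis using progression_of_boundary[OF r gen S(1) fS _ _ b] r by metis
qed

theorem rj_progression_zero:
  assumes S: "based S" "generate G S = carrier G" "\<not> degenerate G S" "3 \<le> card S"
    and le: "finite (carrier G) \<Longrightarrow> 2 * card S \<le> card (carrier G) + 1"
    and k: "kappa G 2 S \<le> card S - 1"
  shows "\<exists>r\<in>carrier G. rj_progression G r 0 S"
proof -
  have Sc: "S \<subseteq> carrier G" "finite S" "\<one> \<in> S" using S by (auto simp: based_def)
  have "\<exists>r\<in>carrier G. \<exists>a\<in>carrier G. S = (\<lambda>i::nat. a \<otimes> r [^] i) ` {..<card S}"
  proof (cases "\<exists>X. k_separating G 2 S X")
    case True
    then obtain X where X: "k_separating G 2 S X" by blast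
    have "kappa G 2 S + 1 \<le> card S" "2 \<le> card S" using k S by linarith+
    moreover have "2 * kappa G 2 S < card (carrier G)" if "finite (carrier G)"
      using le[OF that] k S by linarith
    ultimately show ?thesis using progression_of_kappa_2[OF S(1-3) X] by metis
  next
    case False
    note n = kappa_no_separating[OF False Sc(2)]
    \<comment> \<open>The default value gives |G| - 3 <= |S| - 1, while 2|S| <= |G| + 1.\<close>
    have "card S = 3" "card (carrier G) = 5" using n le[OF n(1)] k S by linarith+
    then show ?thesis using progression_order_5 Sc by blast
  qed
  then obtain r a where r: "r \<in> carrier G" "a \<in> carrier G"
    "S = (\<lambda>i::nat. a \<otimes> r [^] i) ` {..<card S}" by blast
  then have "arith_progression G r S" unfolding arith_progression_def by blast
  then have "rj_progression G r 0 S" unfolding rj_progression_def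
    by (intro exI[of _ S] exI[of _ "{}"]) simp
  then show ?thesis using r by blast
qed

lemma generate_translate:
  assumes "A \<subseteq> carrier G" "\<one> \<in> A" "u \<in> A" "generate G A = carrier G"
  shows "generate G (inv u <# A) = carrier G"
proof -
  have uc: "u \<in> carrier G" using assms by blast
  let ?R = "generate G (inv u <# A)"
  have R: "subgroup ?R G" using assms uc by (intro generate_is_subgroup) auto
  have m: "inv u \<otimes> a \<in> ?R" if "a \<in> A" for a using that by (intro generate.incl l_cosetI)
  have "inv (inv u \<otimes> \<one>) \<in> ?R" using m assms subgroup.m_inv_closed[OF R] by blast
  then have "u \<in> ?R" using uc by simp
  have "a \<in> ?R" if "a \<in> A" for a
  proof -
    have "u \<otimes> (inv u \<otimes> a) \<in> ?R" using m[OF that] \<open>u \<in> ?R\<close> subgroup.m_closed[OF R] by blast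
    then show ?thesis using uc that assms by (simp add: m_assoc[symmetric] subset_eq)
  qed
  then show ?thesis using subgroup_eq_carrier[OF R _ assms(4)] by blast
qed

text \<open>Dividing A by one of its elements b brings it to the form {1, d, y} required by the two
  exclusion lemmas, without changing |AS| or generation.\<close>

lemma fragment_no_small_order:
  assumes S: "based S" "\<not> degenerate G S" "kappa G 2 S = card S" "3 \<le> card S"
    and A: "A \<subseteq> carrier G" "\<one> \<in> A" "card A = 3" "generate G A = carrier G" "card (A <#> S) = card S + 3"
    and big: "finite (carrier G) \<Longrightarrow> card S + 8 \<le> card (carrier G)"
  shows "no_small_order A"
proof (rule no_small_orderI[OF A(1,3)])
  fix b d e
  assume Ae: "A = {b, d \<otimes> b, e}" and c: "b \<in> carrier G" "d \<in> carrier G" "e \<in> carrier G" and d1: "d \<noteq> \<one>"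
  have Sc: "S \<subseteq> carrier G" "finite S" using S by (auto simp: based_def)
  define y where "y = inv b \<otimes> e"
  have y: "y \<in> carrier G" using c by (simp add: y_def)
  have tr: "inv b <# A = {\<one>, d, y}" using c by (simp add: Ae l_coset_insert y_def m_lcomm)
  have b: "b \<in> A" using Ae by simp
  have g: "generate G {\<one>, d, y} = carrier G" using generate_translate[OF A(1,2) b A(4)] tr by simp
  have "S \<union> (d <# S) \<union> (y <# S) = (inv b <# A) <#> S"
    unfolding tr using Sc by (simp add: set_mult_insert_left Un_assoc)
  also have "\<dots> = inv b <# (A <#> S)" using c A Sc by (simp add: set_mult_l_coset)
  finally have cc: "card (S \<union> (d <# S) \<union> (y <# S)) = card S + 3" using A c Sc by simp
  have 2: "d \<otimes> d \<noteq> \<one>" by (rule three_set_no_involution[OF S(1-3) c(2) d1 y g cc big])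
  moreover have "d \<otimes> d \<otimes> d \<noteq> \<one>" by (rule three_set_no_order_three[OF S c(2) d1 2 y g cc big])
  ultimately show "d \<otimes> d \<noteq> \<one> \<and> d \<otimes> d \<otimes> d \<noteq> \<one>" by blast
qed

text \<open>A subgroup H containing the quotient d of two elements of S meets S in at most two
  cosets, so |HS| <= 2|H|. For |H| = 2 or 3 this is at most |H| + 3, which would make H a
  2-fragment.\<close>

lemma nondegenerate_no_small_order:
  assumes S: "based S" "\<not> degenerate G S" "kappa G 2 S = 3" "card S = 3"
    and big: "finite (carrier G) \<Longrightarrow> 10 \<le> card (carrier G)"
  shows "no_small_order S"
proof (rule no_small_orderI)
  have Sc: "S \<subseteq> carrier G" "finite S" using S by (auto simp: based_def)
  then show "S \<subseteq> carrier G" "card S = 3" using S by auto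
  fix b d e
  assume Se: "S = {b, d \<otimes> b, e}" and cc: "b \<in> carrier G" "d \<in> carrier G" "e \<in> carrier G" and d1: "d \<noteq> \<one>"
  have bound: "card H + 4 \<le> card (H <#> S)"
    if H: "subgroup H G" "finite H" "2 \<le> card H" "card (H <#> S) \<le> 6" for H
  proof -
    have Hc: "H \<subseteq> carrier G" using H subgroup.subset by blast
    have "large 2 (exterior G S H)"
      by (rule large_exteriorI) (use Sc H Hc big in auto)
    then have sep: "k_separating G 2 S H" using H Hc by (simp add: k_separating_iff)
    have "\<not> fragment G 2 S H" using S(2) H by (auto simp: degenerate_def)
    then show ?thesis using fragmentI[OF S(1) sep] S(3) by fastforce
  qed
  have sub: "H <#> S \<subseteq> (b <# H) \<union> (e <# H)" if H: "subgroup H G" "d \<in> H" for H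
  proof
    fix x assume "x \<in> H <#> S"
    then obtain h s where x: "h \<in> H" "s \<in> S" "x = h \<otimes> s" by (auto simp: mem_set_mult)
    have hc: "h \<in> carrier G" using subgroup.mem_carrier[OF H(1) x(1)] .
    consider "s = b" | "s = d \<otimes> b" | "s = e" using x Se by auto
    then show "x \<in> (b <# H) \<union> (e <# H)"
    proof cases
      case 1
      then have "x = b \<otimes> h" using x hc cc by (simp add: m_comm)
      then show ?thesis using l_cosetI[OF x(1)] by auto
    next
      case 2
      then have "x = b \<otimes> (h \<otimes> d)" using x(3) hc cc by (simp add: m_ac)
      then show ?thesis using l_cosetI[OF subgroup.m_closed[OF H(1) x(1) H(2)]] by auto
    next
      case 3
      then have "x = e \<otimes> h" using x hc cc by (simp add: m_comm)
      then show ?thesis using l_cosetI[OF x(1)] by auto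
    qed
  qed
  have le: "card (H <#> S) \<le> 2 * card H" if H: "subgroup H G" "finite H" "d \<in> H" for H
  proof -
    have Hc: "H \<subseteq> carrier G" using H subgroup.subset by blast
    have "card (H <#> S) \<le> card ((b <# H) \<union> (e <# H))" using sub[OF H(1,3)] H by (intro card_mono) auto
    also have "\<dots> \<le> card (b <# H) + card (e <# H)" by (rule card_Un_le)
    finally show ?thesis using Hc cc by simp
  qed
  have 2: "d \<otimes> d \<noteq> \<one>"
  proof
    assume "d \<otimes> d = \<one>"
    then have H: "subgroup {\<one>, d} G" using involution_subgroup cc by blast
    show False using le[OF H] bound[OF H] d1 by simp
  qed
  have 3: "d \<otimes> d \<otimes> d \<noteq> \<one>"
  proof
    assume ddd: "d \<otimes> d \<otimes> d = \<one>"
    have H: "subgroup {\<one>, d, d \<otimes> d} G"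
      by (rule order_three_subgroup[OF cc(2) ddd])
    have "card {\<one>, d, d \<otimes> d} = 3" using cc d1 2 by (auto simp: card_insert_if)
    then show False using le[OF H] bound[OF H] by simp
  qed
  show "d \<otimes> d \<noteq> \<one> \<and> d \<otimes> d \<otimes> d \<noteq> \<one>" using 2 3 by blast
qed

subsection \<open>Sets with few boundary points\<close>

text \<open>If the 2-atom has two elements, a 3-atom serves; otherwise the 2-atom generates G, and
  comparison with its own 2-atoms bounds its size by 3.\<close>

lemma three_fragment_exists:
  assumes S: "based S" "generate G S = carrier G" "\<not> degenerate G S" "3 \<le> card S"
    and k: "kappa G 2 S = card S" "kappa G 3 S = card S" and sep: "k_separating G 3 S X"
    and big: "finite (carrier G) \<Longrightarrow> 2 * card S + 4 \<le> card (carrier G)"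
  shows "\<exists>A. fragment G 2 S A \<and> based A \<and> card A = 3"
proof -
  have Sc: "S \<subseteq> carrier G" "finite S" "\<one> \<in> S" using S by (auto simp: based_def)
  have sep2: "k_separating G 2 S X" using k_separating_le[OF sep] by simp
  obtain M where M: "atom 2 S M" "\<one> \<in> M" using atom_exists[OF S(1) sep2] by auto
  have Mf: "fragment G 2 S M" using M by (simp add: atom_def)
  have Mc: "M \<subseteq> carrier G" "finite M" "2 \<le> card M" "large 2 (exterior G S M)"
    using Mf by (auto simp: fragment_def k_separating_iff)
  have bM: "based M" using Mc M by (simp add: based_def)
  have tM: "thin 1 M" using two_atom_thin'[OF S(1) M S(3)] .
  have MS: "card (M <#> S) = card M + card S" using Mf S(1) k fragment_iff by simp
  show ?thesis
  proof (cases "card M = 2")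
    case True
    then obtain r where r: "M = {\<one>, r}" "r \<noteq> \<one>" using M(2)
      by (metis card_2_iff doubleton_eq_iff insertE singletonD)
    have rc: "r \<in> carrier G" using r Mc by auto
    obtain A where A: "atom 3 S A" "\<one> \<in> A" using atom_exists[OF S(1) sep] by auto
    have Af: "fragment G 3 S A" using A by (simp add: atom_def)
    have "card A = 3" using three_atom_card[OF S(1,3) k A rc r(2)] Mf r by simp
    moreover have "based A" using Af A by (simp add: based_def fragment_def k_separating_def)
    moreover have "fragment G 2 S A" by (rule fragment_le[OF S(1) Af]) (use k in auto)
    ultimately show ?thesis by blast
  next
    case False
    then have c3: "3 \<le> card M" using Mc by linarith
    have gM: "generate G M = carrier G"
      by (rule thin_atom_generates[OF S(1-3) Mf bM]) (use tM k c3 big in auto)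
    have sS: "k_separating G 2 M S"
      using Mc Sc S(4) exterior_commute[OF Mc(1) Sc(1)] by (simp add: k_separating_iff)
    have "card M + 0 \<le> 3"
      by (rule thin_card_le_3[OF bM tM gM sS]) (use MS set_mult_commute[OF Mc(1) Sc(1)] in auto)
    then have "card M = 3" using c3 by linarith
    then show ?thesis using Mf bM by blast
  qed
qed

lemma rj_progression_of_three_fragment:
  assumes S: "based S" "generate G S = carrier G" "\<not> degenerate G S" "4 \<le> card S"
    and k: "kappa G 2 S = card S" and A: "fragment G 2 S A" "based A" "card A = 3"
    and big: "finite (carrier G) \<Longrightarrow> 2 * card S + 4 \<le> card (carrier G)"
  shows "\<exists>r\<in>carrier G. rj_progression G r (-1) S"
proof -
  have Sc: "S \<subseteq> carrier G" "finite S" "\<one> \<in> S" using S by (auto simp: based_def)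
  have Ac: "A \<subseteq> carrier G" "finite A" "\<one> \<in> A" using A by (auto simp: based_def)
  have AS: "card (A <#> S) = card S + 3" using A S(1) k fragment_iff by simp
  have gA: "generate G A = carrier G"
    by (rule thin_atom_generates[OF S(1-3) A(1,2)]) (use A k S(4) big in auto)
  have "no_small_order A"
    by (rule fragment_no_small_order[OF S(1,3) k _ Ac(1,3) A(3) gA AS]) (use S big in auto)
  \<comment> \<open>S must have four elements to be a 4-separating set of A; this is why |S| = 3 is
    treated apart.\<close>
  moreover have "large 4 (exterior G S A)"
    by (rule large_exteriorI) (use Sc Ac AS big S(4) in auto)
  then have "k_separating G 4 A S"
    using S(4) Sc exterior_commute[OF Ac(1) Sc(1)] by (simp add: k_separating_iff)
  moreover have "card (S <#> A) \<le> card S + 3" using AS set_mult_commute[OF Ac(1) Sc(1)] by simp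
  ultimately have "short_shape A" using three_set_shape[OF A(2,3) gA] by blast
  then obtain g r where g: "g \<in> carrier G" "r \<in> carrier G"
    and s: "A = {g, r \<otimes> g, r \<otimes> (r \<otimes> g)} \<or> A = {g, r \<otimes> g, r \<otimes> (r \<otimes> (r \<otimes> g))}"
    unfolding short_shape_def by blast
  have gen: "generate G {r} = carrier G"
    by (rule shape_generates[OF Ac(3) gA g]) (use s in auto)
  define U where "U = S \<union> (r <# S)"
  have U: "U \<subseteq> carrier G" "finite U" using Sc g by (auto simp: U_def)
  have gU: "g <# U = (g <# S) \<union> ((r \<otimes> g) <# S)"
    using Sc g by (simp add: U_def l_coset_Un l_coset_l_coset m_comm)
  have r1: "r \<noteq> \<one>" using s A(3) g by auto
  have HS: "{\<one>, r} <#> S = U" using Sc by (simp add: set_mult_insert_left U_def)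
  have "card (g <# U) \<le> card (A <#> S)"
  proof (rule card_mono)
    show "g <# U \<subseteq> A <#> S"
      unfolding gU using s l_coset_subset_set_mult[of g A S] l_coset_subset_set_mult[of "r \<otimes> g" A S] by auto
  qed (use Ac Sc in simp)
  then have "card U \<le> card S + 3" using U g AS by simp
  then have "large 2 (exterior G S {\<one>, r})"
    using big S(4) by (intro large_exteriorI) (use Sc g HS in auto)
  then have "k_separating G 2 S {\<one>, r}" using g r1 by (simp add: k_separating_iff)
  then have ge: "card S + 2 \<le> card (S \<union> (r <# S))"
    using kappa_le[OF S(1)] k HS r1 by (fastforce simp: U_def)
  from s have "rj_progression G r (-1) S"
  proof
    assume "A = {g, r \<otimes> g, r \<otimes> (r \<otimes> g)}"
    then have "A <#> S = g <# (S \<union> (r <# S) \<union> (r <# (r <# S)))"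
      using g Sc by (simp add: set_mult_insert_left l_coset_Un l_coset_l_coset m_ac Un_assoc)
    then have le: "card (S \<union> (r <# S) \<union> (r <# (r <# S))) \<le> card S + 3" using AS g Sc by simp
    show ?thesis
      by (rule rj_progression_step_step[OF g(2) gen Sc(1,2) _ le ge]) (use Sc S(4) big in auto)
  next
    assume "A = {g, r \<otimes> g, r \<otimes> (r \<otimes> (r \<otimes> g))}"
    then have "A <#> S = g <# (S \<union> (r <# S) \<union> (r <# (r <# (r <# S))))"
      using g Sc by (simp add: set_mult_insert_left l_coset_Un l_coset_l_coset m_ac Un_assoc)
    then have le: "card (S \<union> (r <# S) \<union> (r <# (r <# (r <# S)))) \<le> card S + 3" using AS g Sc by simp
    show ?thesis
      by (rule rj_progression_step_triple[OF g(2) gen Sc(1,2) _ le ge]) (use S(4) big in auto)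
  qed
  then show ?thesis using g by blast
qed

text \<open>Here S itself takes the place of the three-element fragment, and its 4-fragments,
  supplied by the extra hypothesis, replace the exchange of roles.\<close>

lemma rj_progression_of_three_set:
  assumes S: "based S" "generate G S = carrier G" "\<not> degenerate G S" "card S = 3"
    and k: "kappa G 2 S = 3" "kappa G 4 S \<le> 3"
    and big: "finite (carrier G) \<Longrightarrow> 10 \<le> card (carrier G)"
  shows "\<exists>r\<in>carrier G. rj_progression G r (-1) S"
proof -
  have Sc: "S \<subseteq> carrier G" "finite S" "\<one> \<in> S" using S by (auto simp: based_def)
  have n: "no_small_order S" by (rule nondegenerate_no_small_order[OF S(1,3) k(1) S(4) big])
  have "short_shape S"
  proof (cases "\<exists>X. k_separating G 4 S X")
    case True
    then obtain F where F: "fragment G 4 S F" using fragment_exists by blast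
    then have "k_separating G 4 S F" "card (F <#> S) \<le> card F + 3"
      using fragment_iff[OF S(1)] k by auto
    then show ?thesis using three_set_shape[OF S(1,4,2) n] by blast
  next
    case False
    note nk = kappa_no_separating[OF False Sc(2)]
    \<comment> \<open>The default value |G| - 7 is at most 3, while |G| >= 10.\<close>
    have c10: "card (carrier G) = 10" using nk big[OF nk(1)] k by linarith
    have "thin 1 S" by (rule thin_of_kappa[OF S(1,4) k(1)]) (use c10 in simp)
    then show ?thesis using short_shape_of_order_10[OF Sc(1) S(4) n _ c10] by blast
  qed
  moreover have "S \<noteq> carrier G" using big Sc S(4) by auto
  ultimately show ?thesis using rj_progression_short_shape[OF S(1,4,2)] by blast
qed

theorem rj_progression_minus_one:
  assumes S: "based S" "generate G S = carrier G" "\<not> degenerate G S" "3 \<le> card S"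
    and big: "finite (carrier G) \<Longrightarrow> 2 * card S + 4 \<le> card (carrier G)"
    and k: "kappa G 3 S \<le> card S" "card S = 3 \<Longrightarrow> kappa G 4 S \<le> card S"
  shows "\<exists>r\<in>carrier G. rj_progression G r (-1) S"
proof -
  have Sc: "S \<subseteq> carrier G" "finite S" "\<one> \<in> S" using S by (auto simp: based_def)
  obtain X where X: "k_separating G 3 S X"
  proof (cases "\<exists>X. k_separating G 3 S X")
    case False
    note n = kappa_no_separating[OF False Sc(2)]
    \<comment> \<open>The default value would be |G| - 5 >= 2|S| - 1, which exceeds |S|.\<close>
    show thesis using n big[OF n(1)] k(1) S(4) by linarith
  qed (use that in blast)
  have X2: "k_separating G 2 S X" using k_separating_le[OF X] by simp
  have k23: "kappa G 2 S \<le> kappa G 3 S" using kappa_mono[OF S(1) _ X] by simp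
  show ?thesis
  proof (cases "kappa G 2 S = card S")
    case False
    \<comment> \<open>In this case S is a full progression, and the claim is obtained by appending
      one term.\<close>
    have "kappa G 2 S + 1 \<le> card S" "2 \<le> card S" using False k23 k S(4) by linarith+
    moreover have "2 * kappa G 2 S < card (carrier G)" if "finite (carrier G)"
      using big[OF that] k23 k(1) by linarith
    ultimately obtain r a where r: "r \<in> carrier G" "generate G {r} = carrier G" "a \<in> carrier G"
      "S = (\<lambda>i::nat. a \<otimes> r [^] i) ` {..<card S}"
      using progression_of_kappa_2[OF S(1-3) X2] by metis
    have "S \<noteq> carrier G" "S \<noteq> {}" using big Sc by auto
    then show ?thesis using rj_progression_of_progression[OF r(1,2) Sc(2) _ _ r(3,4)] r by blast
  next
    case True
    have k3: "kappa G 3 S = card S" using True k23 k by simp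
    show ?thesis
    proof (cases "card S = 3")
      case c3: True
      show ?thesis
        by (rule rj_progression_of_three_set[OF S(1-3) c3]) (use True c3 k big in auto)
    next
      case False
      then have "4 \<le> card S" using S by linarith
      then show ?thesis
        using three_fragment_exists[OF S True k3 X big] rj_progression_of_three_fragment[OF S(1-3) _ True _ _ _ big]
        by blast
    qed
  qed
qed

end

theorem theorem2:
  fixes G :: "('a, 'b) monoid_scheme" and S :: "'a set" and \<mu> :: nat
  assumes "comm_group G"
    and "\<mu> \<in> {0, 1}"
    and "S \<subseteq> carrier G" and "finite S"
    and "generate G S = carrier G"
    and "\<one>\<^bsub>G\<^esub> \<in> S"
    and "3 \<le> card S"
    and "finite (carrier G) \<Longrightarrow> real (card S) \<le> (real (order G) + 5 * real \<mu> - 4) / 2"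
    and "kappa G (3 - \<mu>) S \<le> card S - \<mu>"
    and "card S = 3 \<and> \<mu> = 0 \<Longrightarrow> kappa G 4 S \<le> card S"
    and "\<not> degenerate G S"
  shows "\<exists>r \<in> carrier G. rj_progression G r (int \<mu> - 1) S"
proof -
  interpret comm_group G by fact
  have S: "based S" using assms by (simp add: based_def)
  show ?thesis
  proof (cases "\<mu> = 0")
    case True
    have "2 * card S + 4 \<le> card (carrier G)" if "finite (carrier G)"
      using assms(8)[OF that] True by (simp add: order_def field_simps)
    then show ?thesis
      using rj_progression_minus_one[OF S assms(5,11,7)] assms(9,10) True by simp
  next
    case False
    then have \<mu>: "\<mu> = 1" using assms(2) by simp
    have "2 * card S \<le> card (carrier G) + 1" if "finite (carrier G)"
      using assms(8)[OF that] \<mu> by (simp add: order_def field_simps)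
    then show ?thesis
      using rj_progression_zero[OF S assms(5,11,7)] assms(9) \<mu> by simp
  qed
qed

end
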